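(* In the setting described in the context, assume $\alpha\in(3/2,2)$ and $\frac12+\frac1{2\alpha}<\beta<\frac32-\frac1\alpha$. Then the process $(X_t)_{t\ge0}$ on $H$ solving $dX_t+[AX_t+N(X_t)]\,dt=dL_t$ is accessible to $0$: for every $\lambda>0$, every $x\in H$ and every neighborhood $\mathcal U$ of $0$ in $H$, $$\mathcal R_\lambda(x,\mathcal U):=\int_0^\infty e^{-\lambda t}P_t(x,\mathcal U)\,dt>0,$$ where $P_t(x,\cdot)$ is the law of $X_t^x$.
   Context: Let $\mathbb T=\mathbb R/\mathbb Z$ with Lebesgue measure $d\xi$, and let $H=\{x\in L^2(\mathbb T,\mathbb R):\int_{\mathbb T}x(\xi)\,d\xi=0\}$ with inner product $\langle x,y\rangle_H=\int_{\mathbb T}x(\xi)y(\xi)\,d\xi$. $A$ is the closure in $H$ of $-\frac{d^2}{d\xi^2}$ on $C^2(\mathbb T)\cap H$, a positive definite self-adjoint operator. Let $\mathbb Z_*=\mathbb Z\setminus\{0\}$, $\gamma_k=4\pi^2|k|^2$ and $e_k(\xi)=e^{i2\pi k\xi}$ for $k\in\mathbb Z_*$; $\{e_k\}_{k\in\mathbb Z_*}$ is the orthonormal basis used for $H$, each $x\in H$ being represented as $x=\sum_{k\in\mathbb Z_*}x_ke_k$ with $x_k\in\mathbb C$, $x_{-k}=\overline{x_k}$, and $Ae_k=\gamma_ke_k$. $V=\mathcal D(A^{1/2})$ with $\|x\|_V^2=\sum_{k\in\mathbb Z_*}\gamma_k|x_k|^2$. Noise: $(l_k(t))_{t\ge0}$,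 $k\in\mathbb Z_*$, are i.i.d. one-dimensional symmetric $\alpha$-stable processes on a probability space $(\Omega,\mathcal F,\mathbb P)$ with $\mathbb E[e^{i\lambda l_k(t)}]=e^{-t|\lambda|^\alpha}$. $L_t=\sum_{k\in\mathbb Z_*}\beta_kl_k(t)e_k$, where $C_1\gamma_k^{-\beta}\le|\beta_k|\le C_2\gamma_k^{-\beta}$ for some constants $C_1,C_2>0$. Nonlinearity: $N(u)=-(u-u^3)$. For $x\in H$, $X^x$ denotes the (almost surely unique) mild solution with $X_0=x$ whose paths are right continuous with left limits in $H$ on $[0,\infty)$ and in $V$ on $(0,\infty)$: $X_t=e^{-At}x-\int_0^te^{-A(t-s)}N(X_s)\,ds+\int_0^te^{-A(t-s)}\,dL_s$.
   Formalization: Independent real l_k with complex e_k would put L_t outside the real space H, so the noise is expanded in √2 cos(2πkξ) and √2 sin(2π|k|ξ) instead; since u-u³ need not have zero mean, N is followed by the projection onto H (mean removed). *)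

theory Defs
  imports "HOL-Probability.Probability"
begin

section \<open>The Hilbert space $H$ of mean-zero square-integrable functions on the torus\<close>

text \<open>The torus is identified with the half-open unit interval.\<close>

definition torus :: "real measure" where
  "torus = restrict_space lborel {0..<1}"

definition L2_torus :: "(real \<Rightarrow> real) set" where
  "L2_torus = {f \<in> borel_measurable torus. integrable torus (\<lambda>\<xi>. (f \<xi>)\<^sup>2)}"

definition L2_mean_zero :: "(real \<Rightarrow> real) set" where
  "L2_mean_zero = {f \<in> L2_torus. (LINT \<xi>|torus. f \<xi>) = 0}"

lemma finite_measure_torus: "finite_measure torus"
  by (rule finite_measureI) (simp add: torus_def emeasure_restrict_space space_restrict_space)

lemma L2_torus_integrable_mult:
  assumes "f \<in> L2_torus" "g \<in> L2_torus"
  shows "integrable torus (\<lambda>\<xi>. f \<xi> * g \<xi>)"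
proof (rule Bochner_Integration.integrable_bound)
  show "integrable torus (\<lambda>\<xi>. (f \<xi>)\<^sup>2 + (g \<xi>)\<^sup>2)"
    using assms by (simp add: L2_torus_def)
  show "(\<lambda>\<xi>. f \<xi> * g \<xi>) \<in> borel_measurable torus"
    using assms by (auto simp: L2_torus_def intro: borel_measurable_times)
  have "\<bar>a * b\<bar> \<le> a\<^sup>2 + b\<^sup>2" for a b :: real
    using sum_squares_bound[of "\<bar>a\<bar>" "\<bar>b\<bar>"] mult_nonneg_nonneg[of "\<bar>a\<bar>" "\<bar>b\<bar>"]
    unfolding abs_mult power2_abs by linarith
  then show "AE \<xi> in torus. norm (f \<xi> * g \<xi>) \<le> norm ((f \<xi>)\<^sup>2 + (g \<xi>)\<^sup>2)"
    by (intro AE_I2) simp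
qed

lemma L2_torus_const: "(\<lambda>_. c) \<in> L2_torus"
  using finite_measure.integrable_const[OF finite_measure_torus] by (simp add: L2_torus_def)

lemma L2_torus_integrable: "f \<in> L2_torus \<Longrightarrow> integrable torus f"
  using L2_torus_integrable_mult[OF _ L2_torus_const[of 1]] by simp

lemma L2_torus_scale: "f \<in> L2_torus \<Longrightarrow> (\<lambda>\<xi>. c * f \<xi>) \<in> L2_torus"
  by (auto simp: L2_torus_def power_mult_distrib intro: borel_measurable_times)

lemma L2_torus_add:
  assumes "f \<in> L2_torus" "g \<in> L2_torus"
  shows "(\<lambda>\<xi>. f \<xi> + g \<xi>) \<in> L2_torus"
  using assms L2_torus_integrable_mult[OF assms]
  by (auto simp: L2_torus_def power2_sum mult.assoc intro: borel_measurable_add)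

lemma L2_mean_zero_const0: "(\<lambda>_. 0) \<in> L2_mean_zero"
  by (simp add: L2_mean_zero_def L2_torus_const)

lemma L2_mean_zero_add:
  "f \<in> L2_mean_zero \<Longrightarrow> g \<in> L2_mean_zero \<Longrightarrow> (\<lambda>\<xi>. f \<xi> + g \<xi>) \<in> L2_mean_zero"
  by (simp add: L2_mean_zero_def L2_torus_add L2_torus_integrable)

lemma L2_mean_zero_scale: "f \<in> L2_mean_zero \<Longrightarrow> (\<lambda>\<xi>. c * f \<xi>) \<in> L2_mean_zero"
  by (simp add: L2_mean_zero_def L2_torus_scale)

lemma L2_mean_zero_uminus: "f \<in> L2_mean_zero \<Longrightarrow> (\<lambda>\<xi>. - f \<xi>) \<in> L2_mean_zero"
  using L2_mean_zero_scale[of f "-1"] by simp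

lemma L2_mean_zero_diff:
  "f \<in> L2_mean_zero \<Longrightarrow> g \<in> L2_mean_zero \<Longrightarrow> (\<lambda>\<xi>. f \<xi> - g \<xi>) \<in> L2_mean_zero"
  using L2_mean_zero_add[OF _ L2_mean_zero_uminus, of f g] by simp

lemma L2_mean_zero_center:
  assumes "f \<in> L2_torus"
  shows "(\<lambda>\<xi>. f \<xi> - (LINT \<eta>|torus. f \<eta>)) \<in> L2_mean_zero"
proof -
  have "measure torus (space torus) = 1"
    by (simp add: torus_def measure_restrict_space space_restrict_space)
  then show ?thesis
    using assms L2_torus_add[OF assms L2_torus_const[of "- (LINT \<eta>|torus. f \<eta>)"]]
      L2_torus_integrable[OF assms] L2_torus_integrable[OF L2_torus_const]
    by (simp add: L2_mean_zero_def)
qed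

quotient_type H = "real \<Rightarrow> real" / partial:
  "\<lambda>f g. f \<in> L2_mean_zero \<and> g \<in> L2_mean_zero \<and> (AE \<xi> in torus. f \<xi> = g \<xi>)"
proof (rule part_equivpI)
  show "\<exists>f. f \<in> L2_mean_zero \<and> f \<in> L2_mean_zero \<and> (AE \<xi> in torus. f \<xi> = f \<xi>)"
    using L2_mean_zero_const0 by auto
  show "symp (\<lambda>f g. f \<in> L2_mean_zero \<and> g \<in> L2_mean_zero \<and> (AE \<xi> in torus. f \<xi> = g \<xi>))"
    by (auto intro!: sympI elim: AE_mp)
  show "transp (\<lambda>f g. f \<in> L2_mean_zero \<and> g \<in> L2_mean_zero \<and> (AE \<xi> in torus. f \<xi> = g \<xi>))"
    by (intro transpI) (auto elim: eventually_elim2)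
qed

instantiation H :: real_inner
begin

lift_definition zero_H :: H is "\<lambda>_. 0"
  by (simp add: L2_mean_zero_const0)

lift_definition plus_H :: "H \<Rightarrow> H \<Rightarrow> H" is "\<lambda>f g \<xi>. f \<xi> + g \<xi>"
  by (auto simp: L2_mean_zero_add elim: eventually_elim2)

lift_definition minus_H :: "H \<Rightarrow> H \<Rightarrow> H" is "\<lambda>f g \<xi>. f \<xi> - g \<xi>"
  by (auto simp: L2_mean_zero_diff elim: eventually_elim2)

lift_definition uminus_H :: "H \<Rightarrow> H" is "\<lambda>f \<xi>. - f \<xi>"
  by (auto simp: L2_mean_zero_uminus)

lift_definition scaleR_H :: "real \<Rightarrow> H \<Rightarrow> H" is "\<lambda>c f \<xi>. c * f \<xi>"
  by (auto simp: L2_mean_zero_scale elim: eventually_mono)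

lift_definition inner_H :: "H \<Rightarrow> H \<Rightarrow> real" is "\<lambda>f g. LINT \<xi>|torus. f \<xi> * g \<xi>"
  by (rule integral_cong_AE)
     (auto simp: L2_mean_zero_def L2_torus_def elim: eventually_elim2)

definition norm_H :: "H \<Rightarrow> real" where "norm_H x = sqrt (inner x x)"
definition dist_H :: "H \<Rightarrow> H \<Rightarrow> real" where "dist_H x y = norm (x - y)"
definition sgn_H :: "H \<Rightarrow> H" where "sgn_H x = inverse (norm x) *\<^sub>R x"
definition uniformity_H :: "(H \<times> H) filter"
  where "uniformity_H = (INF e\<in>{0<..}. principal {(x, y). dist x y < e})"
definition open_H :: "H set \<Rightarrow> bool"
  where "open_H U \<longleftrightarrow> (\<forall>x\<in>U. eventually (\<lambda>(x', y). x' = x \<longrightarrow> y \<in> U) uniformity)"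

instance
proof
  fix x y z :: H and a b :: real and U :: "H set"
  show "x + y + z = x + (y + z)"
    by transfer (auto simp: L2_mean_zero_add add.assoc)
  show "x + y = y + x"
    by transfer (auto simp: L2_mean_zero_add add.commute)
  show "0 + x = x"
    by transfer auto
  show "- x + x = 0"
    by transfer (auto simp: L2_mean_zero_const0)
  show "x - y = x + - y"
    by transfer (auto simp: L2_mean_zero_diff)
  show "a *\<^sub>R (x + y) = a *\<^sub>R x + a *\<^sub>R y"
    by transfer (auto simp: L2_mean_zero_add L2_mean_zero_scale distrib_left)
  show "(a + b) *\<^sub>R x = a *\<^sub>R x + b *\<^sub>R x"
    by transfer (auto simp: L2_mean_zero_add L2_mean_zero_scale distrib_right)
  show "a *\<^sub>R b *\<^sub>R x = (a * b) *\<^sub>R x"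
    by transfer (auto simp: L2_mean_zero_scale mult.assoc)
  show "1 *\<^sub>R x = x"
    by transfer auto
  show "dist x y = norm (x - y)" by (rule dist_H_def)
  show "sgn x = inverse (norm x) *\<^sub>R x" by (rule sgn_H_def)
  show "uniformity = (INF e\<in>{0<..}. principal {(x, y). dist (x :: H) y < e})"
    by (rule uniformity_H_def)
  show "open U \<longleftrightarrow> (\<forall>x\<in>U. eventually (\<lambda>(x', y). x' = x \<longrightarrow> y \<in> U) uniformity)"
    by (rule open_H_def)
  show "norm x = sqrt (inner x x)" by (rule norm_H_def)
  show "inner x y = inner y x"
    by transfer (simp add: mult.commute)
  show "inner (x + y) z = inner x z + inner y z"
    by transfer (auto simp: L2_mean_zero_def distrib_right L2_torus_integrable_mult)
  show "inner (a *\<^sub>R x) y = a * inner x y"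
    by transfer (simp add: mult.assoc)
  show "0 \<le> inner x x"
    by transfer simp
  show "inner x x = 0 \<longleftrightarrow> x = 0"
  proof transfer
    fix f :: "real \<Rightarrow> real"
    assume "f \<in> L2_mean_zero \<and> f \<in> L2_mean_zero \<and> (AE \<xi> in torus. f \<xi> = f \<xi>)"
    then have "f \<in> L2_mean_zero" "integrable torus (\<lambda>\<xi>. f \<xi> * f \<xi>)"
      by (auto simp: L2_mean_zero_def L2_torus_integrable_mult)
    then show "(LINT \<xi>|torus. f \<xi> * f \<xi>) = 0 \<longleftrightarrow>
        f \<in> L2_mean_zero \<and> (\<lambda>_. 0) \<in> L2_mean_zero \<and> (AE \<xi> in torus. f \<xi> = 0)"
      by (subst integral_nonneg_eq_0_iff_AE) (auto simp: L2_mean_zero_const0)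
  qed
qed

end

lift_definition proj_H :: "(real \<Rightarrow> real) \<Rightarrow> H" is
  "\<lambda>f. if f \<in> L2_torus then (\<lambda>\<xi>. f \<xi> - (LINT \<eta>|torus. f \<eta>)) else (\<lambda>_. 0)"
  by (auto simp: L2_mean_zero_center L2_mean_zero_const0)


section \<open>The operator $A$, its semigroup and the space $V$\<close>

definition eigenval :: "int \<Rightarrow> real" where
  "eigenval k = 4 * pi\<^sup>2 * (real_of_int k)\<^sup>2"

text \<open>The coefficient $x_k$ of $x$ with respect to $e_k(\xi) = e^{i 2 \pi k \xi}$.\<close>

lift_definition fourier_coeff :: "H \<Rightarrow> int \<Rightarrow> complex" is
  "\<lambda>f k. LINT \<xi>|torus. complex_of_real (f \<xi>) * cnj (cis (2 * pi * of_int k * \<xi>))"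
proof (rule ext, rule integral_cong_AE)
  fix f g :: "real \<Rightarrow> real" and k :: int
  assume fg: "f \<in> L2_mean_zero \<and> g \<in> L2_mean_zero \<and> (AE \<xi> in torus. f \<xi> = g \<xi>)"
  have "(\<lambda>\<xi>::real. cnj (cis (2 * pi * of_int k * \<xi>))) \<in> borel_measurable borel"
    by (intro borel_measurable_continuous_onI continuous_intros)
  then have [measurable]: "(\<lambda>\<xi>. cnj (cis (2 * pi * of_int k * \<xi>))) \<in> borel_measurable torus"
    unfolding torus_def by (intro measurable_restrict_space1) simp
  have [measurable]: "f \<in> borel_measurable torus" "g \<in> borel_measurable torus"
    using fg by (auto simp: L2_mean_zero_def L2_torus_def)
  show "(\<lambda>\<xi>. complex_of_real (f \<xi>) * cnj (cis (2 * pi * of_int k * \<xi>))) \<in> borel_measurable torus"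
    by measurable
  show "(\<lambda>\<xi>. complex_of_real (g \<xi>) * cnj (cis (2 * pi * of_int k * \<xi>))) \<in> borel_measurable torus"
    by measurable
  show "AE \<xi> in torus. complex_of_real (f \<xi>) * cnj (cis (2 * pi * of_int k * \<xi>)) =
      complex_of_real (g \<xi>) * cnj (cis (2 * pi * of_int k * \<xi>))"
    using fg by (auto elim: eventually_mono)
qed

text \<open>$e^{-At}$ for $t \ge 0$, by the spectral calculus of $A e_k = \gamma_k e_k$.\<close>

definition semigroup_A :: "real \<Rightarrow> H \<Rightarrow> H" where
  "semigroup_A t x = (THE y. \<forall>k. k \<noteq> 0 \<longrightarrow>
     fourier_coeff y k = of_real (exp (- eigenval k * t)) * fourier_coeff x k)"

definition V_space :: "H set" where
  "V_space = {x. (\<lambda>k. eigenval k * (cmod (fourier_coeff x k))\<^sup>2) summable_on {k. k \<noteq> 0}}"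

definition V_norm :: "H \<Rightarrow> real" where
  "V_norm x = sqrt (\<Sum>\<^sub>\<infinity>k\<in>{k. k \<noteq> 0}. eigenval k * (cmod (fourier_coeff x k))\<^sup>2)"

text \<open>Elements of \<^term>\<open>V_space\<close> are bounded functions, so $u - u^3$ is square-integrable there.
  Its mean need not vanish; the equation is posed in $H$, so the constant mode is projected out.\<close>

definition nonlin :: "H \<Rightarrow> H" where
  "nonlin u = proj_H (\<lambda>\<xi>. - (rep_H u \<xi> - (rep_H u \<xi>) ^ 3))"


section \<open>The noise\<close>

definition rcll :: "(real \<Rightarrow> 'a::topological_space) \<Rightarrow> bool" where
  "rcll f \<longleftrightarrow> (\<forall>t\<ge>0. (f \<longlongrightarrow> f t) (at_right t)) \<and> (\<forall>t>0. \<exists>y. (f \<longlongrightarrow> y) (at_left t))"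

definition symmetric_stable_process :: "'w measure \<Rightarrow> real \<Rightarrow> (real \<Rightarrow> 'w \<Rightarrow> real) \<Rightarrow> bool" where
  "symmetric_stable_process M \<alpha> l \<longleftrightarrow>
     (\<forall>t\<ge>0. l t \<in> borel_measurable M) \<and>
     (AE \<omega> in M. l 0 \<omega> = 0) \<and>
     (AE \<omega> in M. rcll (\<lambda>t. l t \<omega>)) \<and>
     (\<forall>(t :: nat \<Rightarrow> real) n. 0 \<le> t 0 \<and> mono t \<longrightarrow>
        prob_space.indep_vars M (\<lambda>_. borel) (\<lambda>i \<omega>. l (t (Suc i)) \<omega> - l (t i) \<omega>) {..<n}) \<and>
     (\<forall>s t. 0 \<le> s \<and> s \<le> t \<longrightarrow>
        distr M borel (\<lambda>\<omega>. l t \<omega> - l s \<omega>) = distr M borel (l (t - s))) \<and>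
     (\<forall>t\<ge>0. \<forall>\<xi>. char (distr M borel (l t)) \<xi> = of_real (exp (- t * \<bar>\<xi>\<bar> powr \<alpha>)))"

text \<open>Independent processes; they are identically distributed since the marginal and increment laws
  in \<^const>\<open>symmetric_stable_process\<close> determine the law of the process.\<close>

definition iid_stable_processes ::
    "'w measure \<Rightarrow> real \<Rightarrow> (int \<Rightarrow> real \<Rightarrow> 'w \<Rightarrow> real) \<Rightarrow> bool" where
  "iid_stable_processes M \<alpha> l \<longleftrightarrow>
     (\<forall>k. k \<noteq> 0 \<longrightarrow> symmetric_stable_process M \<alpha> (l k)) \<and>
     prob_space.indep_vars M (\<lambda>_. PiM {0..} (\<lambda>_. borel)) (\<lambda>k \<omega>. \<lambda>t\<in>{0..}. l k t \<omega>) {k. k \<noteq> 0}"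

text \<open>Independent real coefficients \<open>\<beta>\<^sub>k l\<^sub>k(t)\<close>, $k \in \mathbb Z_*$, violate $x_{-k} = \overline{x_k}$,
  so their sum against the complex exponentials would not lie in the real space $H$. The noise is
  expanded in the real form of this basis: the pair $e_k, e_{-k}$ is replaced by
  $\sqrt 2 \cos(2 \pi k \xi), \sqrt 2 \sin(2 \pi k \xi)$, again orthonormal with eigenvalue $\gamma_k$.\<close>

definition real_basis :: "int \<Rightarrow> H" where
  "real_basis k = proj_H (\<lambda>\<xi>. sqrt 2 *
     (if k > 0 then cos (2 * pi * of_int k * \<xi>) else sin (2 * pi * of_int \<bar>k\<bar> * \<xi>)))"

definition noise ::
    "'w measure \<Rightarrow> (int \<Rightarrow> real) \<Rightarrow> (int \<Rightarrow> real \<Rightarrow> 'w \<Rightarrow> real) \<Rightarrow> (real \<Rightarrow> 'w \<Rightarrow> H) \<Rightarrow> bool" where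
  "noise M b l L \<longleftrightarrow> (AE \<omega> in M. \<forall>t\<ge>0.
     ((\<lambda>k. (b k * l k t \<omega>) *\<^sub>R real_basis k) has_sum L t \<omega>) {k. k \<noteq> 0})"


section \<open>Mild solutions and accessibility\<close>

text \<open>$\int_a^b F(s)\,dg(s) = I$ as a limit of Riemann-Stieltjes sums along gauges, the integrand
  being operator-valued. With $F(s) = e^{-A(t-s)}$ and $g$ a path of the noise this pathwise integral
  is the stochastic integral, its integrand being deterministic and smooth in each mode.\<close>

definition has_stieltjes_integral ::
    "(real \<Rightarrow> 'a \<Rightarrow> 'b) \<Rightarrow> (real \<Rightarrow> 'a::real_normed_vector) \<Rightarrow> 'b::real_normed_vector \<Rightarrow>
     real \<Rightarrow> real \<Rightarrow> bool" where
  "has_stieltjes_integral F g I a b \<longleftrightarrow>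
     ((\<lambda>p. \<Sum>(s, K)\<in>p. F s (g (Sup K) - g (Inf K))) \<longlongrightarrow> I) (division_filter (cbox a b))"

definition rcll_V :: "(real \<Rightarrow> H) \<Rightarrow> bool" where
  "rcll_V f \<longleftrightarrow> (\<forall>t>0. f t \<in> V_space \<and>
     ((\<lambda>s. V_norm (f s - f t)) \<longlongrightarrow> 0) (at_right t) \<and>
     (\<exists>y\<in>V_space. ((\<lambda>s. V_norm (f s - y)) \<longlongrightarrow> 0) (at_left t)))"

definition mild_solution ::
    "'w measure \<Rightarrow> (real \<Rightarrow> 'w \<Rightarrow> H) \<Rightarrow> H \<Rightarrow> (real \<Rightarrow> 'w \<Rightarrow> H) \<Rightarrow> bool" where
  "mild_solution M L x X \<longleftrightarrow>
     (\<forall>t\<ge>0. X t \<in> borel_measurable M) \<and>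
     (AE \<omega> in M. X 0 \<omega> = x \<and> rcll (\<lambda>t. X t \<omega>) \<and> rcll_V (\<lambda>t. X t \<omega>) \<and>
       (\<forall>t\<ge>0. \<exists>D Z.
          ((\<lambda>s. semigroup_A (t - s) (nonlin (X s \<omega>))) has_integral D) {0..t} \<and>
          has_stieltjes_integral (\<lambda>s. semigroup_A (t - s)) (\<lambda>s. L s \<omega>) Z 0 t \<and>
          X t \<omega> = semigroup_A t x - D + Z))"

definition transition ::
    "'w measure \<Rightarrow> ('a \<Rightarrow> real \<Rightarrow> 'w \<Rightarrow> 'a::topological_space) \<Rightarrow> real \<Rightarrow> 'a \<Rightarrow> 'a measure" where
  "transition M X t x = distr M borel (X x t)"

definition resolvent :: "(real \<Rightarrow> 'a \<Rightarrow> 'a measure) \<Rightarrow> real \<Rightarrow> 'a \<Rightarrow> 'a set \<Rightarrow> real" where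
  "resolvent P r x U = (LINT t:{0..}|lborel. exp (- r * t) * measure (P t x) U)"

text \<open>Neighbourhoods are taken Borel, since \<^term>\<open>measure (P t x) U\<close> is only meaningful then.\<close>

definition accessible_to :: "(real \<Rightarrow> 'a::topological_space \<Rightarrow> 'a measure) \<Rightarrow> 'a \<Rightarrow> bool" where
  "accessible_to P y \<longleftrightarrow>
     (\<forall>r>0. \<forall>x. \<forall>U\<in>sets borel. y \<in> interior U \<longrightarrow> resolvent P r x U > 0)"

end

theory Submission
  imports Defs
begin

text \<open>
  Put $Y = X - Z$ with $Z$ the stochastic convolution. Then $Y' = - A Y - N(Y + Z)$, and
  $y (y + z)^3 \ge - \delta^4$ whenever $|z| \le \delta$, so a bound $\delta$ on $\sup_t \|Z_t\|_\infty$
  alone makes $|Y|^2$ decay exponentially down to order $\delta^2$. Integration by parts bounds each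
  mode of $Z$ by $2 |\beta_k| \sup_s |l_k(s)|$; hence it suffices that
  $\sum_k |\beta_k| \sup_s |l_k(s)|$ is small with positive probability. Finitely many modes are
  handled by a small ball estimate for a one-dimensional stable process, the others by the bounds
  $\sup_s |l_k(s)| \le |k|^\kappa$ with $1/\alpha < \kappa < 2 \beta - 1$, whose failure
  probabilities are summable.
\<close>

text \<open>Two obstacles shape the argument. X is only right continuous with left limits and A Y
  need not be defined at a fixed time, so the energy balance is not differentiated: it comes from
  one Duhamel step of length h, tested in the inner product, and is closed by a Gronwall argument
  with one-sided hypotheses. And H serves as an inner product space only, so limits in H are built
  from absolutely summable trigonometric series. The window for \<kappa> is open because of the
  lower bound on \<beta>: with \<open>eigenval k\<close> of order k^2, \<kappa> \<alpha> > 1 makes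
  the failure probabilities, of order |k|^(-\<kappa> \<alpha>), summable, and 2 \<beta> - \<kappa> >
  1 makes the sum of |b k| |k|^\<kappa> converge. A resolvent integrates over time, so one event has
  to serve a whole time interval: smallness is imposed on the driving paths up to a fixed horizon,
  which controls X at all times of an interval [T, T + 1] simultaneously.\<close>

section \<open>Representatives of classes in H and integrals over the torus\<close>

lemma rep_H_mean_zero: "rep_H x \<in> L2_mean_zero"
  using Quotient_rep_reflp[OF Quotient_H, of x] by simp

lemma rep_H_L2: "rep_H x \<in> L2_torus"
  using rep_H_mean_zero[of x] by (simp add: L2_mean_zero_def)

lemma rep_H_measurable [measurable]: "rep_H x \<in> borel_measurable torus"
  using rep_H_L2[of x] by (simp add: L2_torus_def)

lemma rep_H_mean: "(LINT \<xi>|torus. rep_H x \<xi>) = 0"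
  using rep_H_mean_zero[of x] by (simp add: L2_mean_zero_def)

lemma AE_rep_abs: "f \<in> L2_mean_zero \<Longrightarrow> AE \<xi> in torus. rep_H (abs_H f) \<xi> = f \<xi>"
  using Quotient_rep_abs[OF Quotient_H, of f] by simp

lemma H_eqI: "AE \<xi> in torus. rep_H x \<xi> = rep_H y \<xi> \<Longrightarrow> x = y"
  using Quotient_rel_rep[OF Quotient_H, of x y] by (simp add: rep_H_mean_zero)

lemma AE_rep_add: "AE \<xi> in torus. rep_H (x + y) \<xi> = rep_H x \<xi> + rep_H y \<xi>"
  unfolding plus_H_def map_fun_apply
  by (rule AE_rep_abs) (intro L2_mean_zero_add rep_H_mean_zero)

lemma AE_rep_diff: "AE \<xi> in torus. rep_H (x - y) \<xi> = rep_H x \<xi> - rep_H y \<xi>"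
  unfolding minus_H_def map_fun_apply
  by (rule AE_rep_abs) (intro L2_mean_zero_diff rep_H_mean_zero)

lemma AE_rep_scale: "AE \<xi> in torus. rep_H (c *\<^sub>R x) \<xi> = c * rep_H x \<xi>"
  unfolding scaleR_H_def map_fun_apply id_apply
  by (rule AE_rep_abs) (intro L2_mean_zero_scale rep_H_mean_zero)

lemma AE_rep_zero: "AE \<xi> in torus. rep_H 0 \<xi> = 0"
  unfolding zero_H_def by (rule AE_rep_abs) (rule L2_mean_zero_const0)

lemma AE_rep_sum:
  "AE \<xi> in torus. rep_H (\<Sum>k\<in>F. x k) \<xi> = (\<Sum>k\<in>F. rep_H (x k) \<xi>)"
proof (induction F rule: infinite_finite_induct)
  case (insert k F)
  then show ?case
    using AE_rep_add[of "x k" "sum x F"] by (auto elim: eventually_elim2)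
qed (auto simp: AE_rep_zero)

lemma inner_H_eq: "inner x y = (LINT \<xi>|torus. rep_H x \<xi> * rep_H y \<xi>)"
  by (simp add: inner_H_def)

lemma space_torus: "space torus = {0..<1}"
  by (simp add: torus_def space_restrict_space)

interpretation torus: prob_space torus
  by (rule prob_spaceI) (simp add: torus_def emeasure_restrict_space space_restrict_space)

lemma integral_torus:
  fixes f :: "real \<Rightarrow> 'a::{banach, second_countable_topology}"
  shows "(LINT \<xi>|torus. f \<xi>) = (LINT \<xi>:{0..<1}|lborel. f \<xi>)"
  unfolding torus_def set_lebesgue_integral_def
  by (subst integral_restrict_space) auto

lemma measurable_torusI [measurable (raw)]:
  "f \<in> borel_measurable borel \<Longrightarrow> f \<in> borel_measurable torus"
  unfolding torus_def by (intro measurable_restrict_space1) simp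

lemma L2_torus_bounded:
  assumes [measurable]: "f \<in> borel_measurable torus" and "AE \<xi> in torus. \<bar>f \<xi>\<bar> \<le> B"
  shows "f \<in> L2_torus"
proof -
  have "AE \<xi> in torus. norm ((f \<xi>)\<^sup>2) \<le> B\<^sup>2"
    using assms(2) by eventually_elim (simp add: abs_le_square_iff[symmetric])
  then show ?thesis
    unfolding L2_torus_def by (auto intro!: torus.integrable_const_bound[where B="B\<^sup>2"])
qed

lemma norm_H_le_AE:
  assumes "AE \<xi> in torus. \<bar>rep_H x \<xi>\<bar> \<le> B" "0 \<le> B"
  shows "norm x \<le> B"
proof -
  have "(norm x)\<^sup>2 = (LINT \<xi>|torus. (rep_H x \<xi>)\<^sup>2)"
    unfolding power2_norm_eq_inner inner_H_eq by (simp add: power2_eq_square)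
  also have "\<dots> \<le> (LINT \<xi>|torus. B\<^sup>2)"
    using rep_H_L2[of x] assms
    by (intro integral_mono_AE) (auto simp: L2_torus_def abs_le_square_iff[symmetric])
  also have "\<dots> = B\<^sup>2"
    by (simp add: torus.prob_space)
  finally show ?thesis
    using assms(2) by (simp add: power2_le_iff_abs_le)
qed

section \<open>Completeness of the trigonometric system\<close>

text \<open>Inductive, so that closure under products and the vanishing of integrals against a fixed
  f pass from monomials to all trigonometric polynomials by rule induction.\<close>

inductive trig_poly :: "(real \<Rightarrow> complex) \<Rightarrow> bool" where
  monomial: "trig_poly (\<lambda>\<xi>. c * cis (2 * pi * of_int k * \<xi>))"
| add: "trig_poly p \<Longrightarrow> trig_poly q \<Longrightarrow> trig_poly (\<lambda>\<xi>. p \<xi> + q \<xi>)"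

lemma trig_poly_const: "trig_poly (\<lambda>_. c)"
  using trig_poly.monomial[of c 0] by simp

lemma trig_poly_mult:
  assumes "trig_poly p" "trig_poly q"
  shows "trig_poly (\<lambda>\<xi>. p \<xi> * q \<xi>)"
  using assms
proof (induction p rule: trig_poly.induct)
  case (monomial c k)
  from monomial show ?case
  proof (induction q rule: trig_poly.induct)
    case (monomial d j)
    have "c * cis (2 * pi * of_int k * \<xi>) * (d * cis (2 * pi * of_int j * \<xi>)) =
        c * d * cis (2 * pi * of_int (k + j) * \<xi>)" for \<xi>
    proof -
      have "2 * pi * of_int (k + j) * \<xi> = 2 * pi * of_int k * \<xi> + 2 * pi * of_int j * \<xi>"
        by (simp add: algebra_simps)
      then have "cis (2 * pi * of_int (k + j) * \<xi>) = cis (2 * pi * of_int k * \<xi>) * cis (2 * pi * of_int j * \<xi>)"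
        by (simp only: cis_mult)
      then show ?thesis by simp
    qed
    then show ?case
      by (simp only: trig_poly.monomial)
  next
    case (add p q)
    then show ?case
      by (simp add: distrib_left trig_poly.add)
  qed
next
  case (add p q)
  then show ?case
    by (simp add: distrib_right trig_poly.add)
qed

text \<open>On the unit circle the conjugate of z is its inverse, so Re z and Im z are combinations
  of the monomials with k = 1 and k = -1; polynomials in them stay trigonometric by closure under
  products.\<close>

lemma trig_poly_real_polynomial:
  fixes p :: "complex \<Rightarrow> real"
  assumes "real_polynomial_function p"
  shows "trig_poly (\<lambda>\<xi>. of_real (p (cis (2 * pi * \<xi>))))"
  using assms
proof (induction p rule: real_polynomial_function.induct)
  case (linear f)
  then interpret bounded_linear f .
  have eq: "f z = Re z * f 1 + Im z * f \<i>" for z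
  proof -
    have "f z = f (Re z *\<^sub>R 1 + Im z *\<^sub>R \<i>)"
      by (rule arg_cong[of _ _ f]) (simp add: complex_eq_iff)
    then show ?thesis by (simp add: add scaleR)
  qed
  have *: "of_real (f (cis (2 * pi * \<xi>))) =
      (of_real (f 1) / 2 - \<i> * of_real (f \<i>) / 2) * cis (2 * pi * of_int 1 * \<xi>) +
      (of_real (f 1) / 2 + \<i> * of_real (f \<i>) / 2) * cis (2 * pi * of_int (-1) * \<xi>)" for \<xi>
    unfolding eq[of "cis (2 * pi * \<xi>)"] by (simp add: complex_eq_iff field_simps)
  show ?case
    by (subst *) (rule trig_poly.add[OF trig_poly.monomial trig_poly.monomial])
next
  case (const c)
  then show ?case by (simp add: trig_poly_const)
qed (simp_all add: trig_poly.add trig_poly_mult)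

lemma integral_trig_poly_eq_0:
  fixes f :: "real \<Rightarrow> real"
  assumes f: "integrable torus f"
    and coeffs: "\<And>k. (LINT \<xi>|torus. of_real (f \<xi>) * cis (2 * pi * of_int k * \<xi>)) = 0"
    and "trig_poly p"
  shows "integrable torus (\<lambda>\<xi>. of_real (f \<xi>) * p \<xi>) \<and> (LINT \<xi>|torus. of_real (f \<xi>) * p \<xi>) = 0"
  using assms(3)
proof induction
  case (monomial c k)
  have [measurable]: "f \<in> borel_measurable torus" using f by simp
  have [measurable]: "(\<lambda>\<xi>. cis (2 * pi * of_int k * \<xi>)) \<in> borel_measurable torus"
    by (intro measurable_torusI borel_measurable_continuous_onI continuous_intros)
  have "integrable torus (\<lambda>\<xi>. of_real (f \<xi>) * cis (2 * pi * of_int k * \<xi>))"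
    by (rule Bochner_Integration.integrable_bound[OF f]) (auto simp: norm_mult)
  then show ?case
    using coeffs[of k] by (simp add: mult.left_commute[of _ c])
next
  case (add p q)
  then show ?case by (simp add: distrib_left)
qed

text \<open>Stone-Weierstrass on the unit circle: replacing u by a polynomial changes the integral
  by at most e times the L1 norm of f. Functions of \<open>cis (2 * pi * \<xi>)\<close> build in the
  identification of the endpoints 0 and 1.\<close>

lemma integral_circle_continuous_eq_0:
  fixes f :: "real \<Rightarrow> real" and u :: "complex \<Rightarrow> real"
  assumes f: "integrable torus f"
    and coeffs: "\<And>k. (LINT \<xi>|torus. of_real (f \<xi>) * cis (2 * pi * of_int k * \<xi>)) = 0"
    and u: "continuous_on UNIV u"
  shows "(LINT \<xi>|torus. f \<xi> * u (cis (2 * pi * \<xi>))) = 0"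
proof -
  have [measurable]: "f \<in> borel_measurable torus" using f by simp
  have meas: "(\<lambda>\<xi>. v (cis (2 * pi * \<xi>))) \<in> borel_measurable torus"
    if "continuous_on UNIV v" for v :: "complex \<Rightarrow> real"
    by (intro measurable_torusI borel_measurable_continuous_onI continuous_on_compose2[OF that]
        continuous_intros) auto
  have int: "integrable torus (\<lambda>\<xi>. f \<xi> * v (cis (2 * pi * \<xi>)))"
    if v: "continuous_on UNIV v" for v :: "complex \<Rightarrow> real"
  proof -
    have "bounded (v ` sphere 0 1)"
      by (intro compact_imp_bounded compact_continuous_image continuous_on_subset[OF v]) auto
    then obtain B where "\<forall>z\<in>sphere 0 1. \<bar>v z\<bar> \<le> B"
      unfolding bounded_iff by auto
    then have B: "\<bar>v (cis a)\<bar> \<le> B" for a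
      by simp
    note [measurable] = meas[OF v]
    show ?thesis
    proof (rule Bochner_Integration.integrable_bound[where f = "\<lambda>\<xi>. B * \<bar>f \<xi>\<bar>"])
      show "integrable torus (\<lambda>\<xi>. B * \<bar>f \<xi>\<bar>)" using f by simp
      have "\<bar>f \<xi>\<bar> * \<bar>v (cis (2 * pi * \<xi>))\<bar> \<le> \<bar>B\<bar> * \<bar>f \<xi>\<bar>" for \<xi>
        using mult_left_mono[OF order_trans[OF B abs_ge_self[of B]], of "\<bar>f \<xi>\<bar>"] by (simp add: mult.commute)
      then show "AE \<xi> in torus. norm (f \<xi> * v (cis (2 * pi * \<xi>))) \<le> norm (B * \<bar>f \<xi>\<bar>)"
        by (simp add: abs_mult)
    qed measurable
  qed
  have "\<bar>LINT \<xi>|torus. f \<xi> * u (cis (2 * pi * \<xi>))\<bar> \<le> e * (LINT \<xi>|torus. \<bar>f \<xi>\<bar>)" if "e > 0" for e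
  proof -
    obtain p where p: "real_polynomial_function p" "\<And>z. z \<in> sphere 0 1 \<Longrightarrow> \<bar>u z - p z\<bar> < e"
      by (rule Stone_Weierstrass_real_polynomial_function[of "sphere 0 1" u e])
         (use u \<open>e > 0\<close> in \<open>auto intro: continuous_on_subset\<close>)
    have pc: "continuous_on UNIV p"
      using p(1) by (simp add: continuous_at_imp_continuous_on continuous_real_polymonial_function)
    have "of_real (LINT \<xi>|torus. f \<xi> * p (cis (2 * pi * \<xi>)))
        = (LINT \<xi>|torus. of_real (f \<xi>) * (of_real (p (cis (2 * pi * \<xi>))) :: complex))"
      by (simp flip: integral_complex_of_real of_real_mult)
    also have "\<dots> = 0"
      using integral_trig_poly_eq_0[OF f coeffs trig_poly_real_polynomial[OF p(1)]] by simp
    finally have "(LINT \<xi>|torus. f \<xi> * p (cis (2 * pi * \<xi>))) = 0"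
      by simp
    then have 1: "(LINT \<xi>|torus. f \<xi> * u (cis (2 * pi * \<xi>))) =
        (LINT \<xi>|torus. f \<xi> * u (cis (2 * pi * \<xi>)) - f \<xi> * p (cis (2 * pi * \<xi>)))"
      using int[OF u] int[OF pc] by simp
    have 2: "norm (LINT \<xi>|torus. f \<xi> * u (cis (2 * pi * \<xi>)) - f \<xi> * p (cis (2 * pi * \<xi>)))
        \<le> (LINT \<xi>|torus. norm (f \<xi> * u (cis (2 * pi * \<xi>)) - f \<xi> * p (cis (2 * pi * \<xi>))))"
      by (rule integral_norm_bound)
    have 3: "(LINT \<xi>|torus. norm (f \<xi> * u (cis (2 * pi * \<xi>)) - f \<xi> * p (cis (2 * pi * \<xi>))))
        \<le> (LINT \<xi>|torus. e * \<bar>f \<xi>\<bar>)"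
    proof (rule integral_mono)
      show "norm (f \<xi> * u (cis (2 * pi * \<xi>)) - f \<xi> * p (cis (2 * pi * \<xi>))) \<le> e * \<bar>f \<xi>\<bar>" for \<xi>
        using mult_left_mono[OF less_imp_le[OF p(2)[of "cis (2 * pi * \<xi>)"]], of "\<bar>f \<xi>\<bar>"]
        by (simp add: abs_mult[symmetric] right_diff_distrib mult.commute)
      show "integrable torus (\<lambda>\<xi>. norm (f \<xi> * u (cis (2 * pi * \<xi>)) - f \<xi> * p (cis (2 * pi * \<xi>))))"
        by (intro integrable_norm Bochner_Integration.integrable_diff int u pc)
    qed (use f in simp)
    show ?thesis
      using order_trans[OF 2 3] by (simp add: 1)
  qed
  note bound = this
  have "\<bar>LINT \<xi>|torus. f \<xi> * u (cis (2 * pi * \<xi>))\<bar> \<le> 0 + e" if "e > 0" for e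
  proof -
    define I where "I = (LINT \<xi>|torus. \<bar>f \<xi>\<bar>)"
    have "I \<ge> 0" by (simp add: I_def)
    \<comment> \<open>The added 1 keeps the quotient positive when I = 0.\<close>
    then have "e / (I + 1) * I \<le> e" "e / (I + 1) > 0"
      using that by (auto simp: field_simps)
    then show ?thesis
      using bound[of "e / (I + 1)"] by (simp add: I_def)
  qed
  then have "\<bar>LINT \<xi>|torus. f \<xi> * u (cis (2 * pi * \<xi>))\<bar> \<le> 0"
    by (rule field_le_epsilon)
  then show ?thesis by simp
qed


lemma integral_circle_closed_eq_0:
  fixes f :: "real \<Rightarrow> real"
  assumes f: "integrable torus f"
    and coeffs: "\<And>k. (LINT \<xi>|torus. of_real (f \<xi>) * cis (2 * pi * of_int k * \<xi>)) = 0"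
    and C: "closed C" "C \<noteq> {}"
  shows "(LINT \<xi>|torus. f \<xi> * indicator C (cis (2 * pi * \<xi>))) = 0"
proof -
  \<comment> \<open>Continuous functions decreasing to the indicator of C. For empty C the default
    \<open>infdist z {} = 0\<close> would make them constantly 1, whence the assumption
    \<open>C \<noteq> {}\<close>.\<close>
  define \<phi> where "\<phi> n z = max 0 (1 - real n * infdist z C)" for n :: nat and z :: complex
  have \<phi>: "continuous_on UNIV (\<phi> n)" for n
    unfolding \<phi>_def by (intro continuous_intros)
  have [measurable]: "f \<in> borel_measurable torus" using f by simp
  have [measurable]: "(\<lambda>\<xi>. cis (2 * pi * \<xi>)) \<in> borel_measurable torus"
    by (intro measurable_torusI borel_measurable_continuous_onI continuous_intros)
  have [measurable]: "\<phi> n \<in> borel_measurable borel" for n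
    by (rule borel_measurable_continuous_onI[OF \<phi>])
  have [measurable]: "C \<in> sets borel" using C by simp
  have lim: "(\<lambda>n. \<phi> n z) \<longlonglongrightarrow> indicator C z" for z
  proof (cases "z \<in> C")
    case True
    then show ?thesis by (simp add: \<phi>_def)
  next
    case False
    then have pos: "infdist z C > 0"
      using C by (simp add: infdist_pos_not_in_closed)
    have "filterlim (\<lambda>n. real n * infdist z C) at_top sequentially"
      by (intro filterlim_at_top_mult_tendsto_pos[OF tendsto_const pos] filterlim_real_sequentially)
    then have "eventually (\<lambda>n. real n * infdist z C \<ge> 1) sequentially"
      by (simp add: filterlim_at_top)
    then have "eventually (\<lambda>n. \<phi> n z = 0) sequentially"
      by eventually_elim (simp add: \<phi>_def)
    then show ?thesis
      using False by (simp add: tendsto_eventually)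
  qed
  have "(\<lambda>n. LINT \<xi>|torus. f \<xi> * \<phi> n (cis (2 * pi * \<xi>)))
      \<longlonglongrightarrow> (LINT \<xi>|torus. f \<xi> * indicator C (cis (2 * pi * \<xi>)))"
  proof (rule integral_dominated_convergence[where w = "\<lambda>\<xi>. \<bar>f \<xi>\<bar>"])
    show "AE \<xi> in torus. (\<lambda>n. f \<xi> * \<phi> n (cis (2 * pi * \<xi>)))
        \<longlonglongrightarrow> f \<xi> * indicator C (cis (2 * pi * \<xi>))"
      by (intro AE_I2 tendsto_intros lim)
    have "\<bar>\<phi> n z\<bar> \<le> 1" for n z
      by (simp add: \<phi>_def infdist_nonneg)
    then show "AE \<xi> in torus. norm (f \<xi> * \<phi> n (cis (2 * pi * \<xi>))) \<le> \<bar>f \<xi>\<bar>" for n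
      by (intro AE_I2) (simp add: abs_mult mult_left_le)
  qed (use f in auto)
  then show ?thesis
    using integral_circle_continuous_eq_0[OF f coeffs \<phi>] by (simp add: LIMSEQ_const_iff)
qed

text \<open>A measure argument instead of convergence of Fourier series: half-lines cut the torus in
  closed arcs, whose indicators are limits of continuous functions, and half-lines form an
  intersection-stable generator of the Borel sets.\<close>

theorem fourier_coeffs_eq_0_imp_AE_eq_0:
  fixes f :: "real \<Rightarrow> real"
  assumes f: "integrable torus f"
    and coeffs: "\<And>k. (LINT \<xi>|torus. of_real (f \<xi>) * cis (2 * pi * of_int k * \<xi>)) = 0"
  shows "AE \<xi> in torus. f \<xi> = 0"
proof -
  have [measurable]: "f \<in> borel_measurable torus" using f by simp
  have int: "integrable torus (\<lambda>\<xi>. f \<xi> * indicator A \<xi>)" if "A \<in> sets borel" for A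
  proof -
    have [measurable]: "(indicator A :: real \<Rightarrow> real) \<in> borel_measurable torus"
      using that by (intro measurable_torusI) simp
    show ?thesis
      by (rule Bochner_Integration.integrable_bound[OF f]) (measurable, simp add: abs_mult indicator_def)
  qed
  have mean: "(LINT \<xi>|torus. f \<xi>) = 0"
    using integral_circle_continuous_eq_0[OF f coeffs, of "\<lambda>_. 1"] by simp
  have half_line: "(LINT \<xi>|torus. f \<xi> * indicator {..b} \<xi>) = 0" for b
  proof -
    consider "b < 0" | "1 \<le> b" | "0 \<le> b" "b < 1" by linarith
    then show ?thesis
    proof cases
      case 1
      then have "(LINT \<xi>|torus. f \<xi> * indicator {..b} \<xi>) = (LINT \<xi>|torus. 0)"
        by (intro Bochner_Integration.integral_cong) (auto simp: space_torus indicator_def)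
      then show ?thesis by simp
    next
      case 2
      then have "(LINT \<xi>|torus. f \<xi> * indicator {..b} \<xi>) = (LINT \<xi>|torus. f \<xi>)"
        by (intro Bochner_Integration.integral_cong) (auto simp: space_torus indicator_def)
      then show ?thesis by (simp add: mean)
    next
      case 3
      \<comment> \<open>\<open>cis\<close> winds [0, 1) once around the circle, so for b < 1 the arc
        over {0..b} contains no point with a parameter in (b, 1): two parameters of one point differ
        by an integer, here of absolute value below 1.\<close>
      define C where "C = (\<lambda>\<xi>. cis (2 * pi * \<xi>)) ` {0..b}"
      have "closed C"
        unfolding C_def by (intro compact_imp_closed compact_continuous_image continuous_intros) auto
      moreover have "C \<noteq> {}"
        using 3 by (auto simp: C_def)
      moreover have "cis (2 * pi * \<xi>) \<in> C \<longleftrightarrow> \<xi> \<le> b" if \<xi>: "0 \<le> \<xi>" "\<xi> < 1" for \<xi>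
      proof
        assume "cis (2 * pi * \<xi>) \<in> C"
        then obtain \<eta> where \<eta>: "0 \<le> \<eta>" "\<eta> \<le> b" "cis (2 * pi * \<xi>) = cis (2 * pi * \<eta>)"
          by (auto simp: C_def)
        then obtain n :: int where "2 * pi * \<xi> = 2 * pi * \<eta> + 2 * pi * of_int n"
          using sin_cos_eq_iff[of "2 * pi * \<xi>" "2 * pi * \<eta>"] by (auto simp: complex_eq_iff)
        then have "2 * pi * \<xi> = 2 * pi * (\<eta> + of_int n)"
          by (simp add: algebra_simps)
        then have "\<xi> = \<eta> + of_int n"
          by simp
        moreover from this have "n = 0"
          using \<xi> \<eta> 3 by linarith
        ultimately show "\<xi> \<le> b"
          using \<eta> by simp
      qed (use \<xi> in \<open>auto simp: C_def\<close>)
      ultimately have "(LINT \<xi>|torus. f \<xi> * indicator C (cis (2 * pi * \<xi>))) =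
          (LINT \<xi>|torus. f \<xi> * indicator {..b} \<xi>)"
        by (intro Bochner_Integration.integral_cong) (auto simp: space_torus indicator_def)
      then show ?thesis
        using integral_circle_closed_eq_0[OF f coeffs \<open>closed C\<close> \<open>C \<noteq> {}\<close>] by simp
    qed
  qed
  have all: "(LINT \<xi>|torus. f \<xi> * indicator A \<xi>) = 0" if "A \<in> sets borel" for A
  proof -
    have "Int_stable (range (\<lambda>b::real. {..b}))"
      by (auto simp: Int_stable_def)
    moreover have "range (\<lambda>b::real. {..b}) \<subseteq> Pow UNIV" by simp
    moreover have "A \<in> sigma_sets UNIV (range (\<lambda>b::real. {..b}))"
      using that by (simp add: borel_eq_atMost)
    ultimately show ?thesis
    proof (induction rule: sigma_sets_induct_disjoint)
      case (compl A)
      then have A: "A \<in> sets borel"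
        by (simp add: borel_eq_atMost)
      have "(LINT \<xi>|torus. f \<xi> * indicator (UNIV - A) \<xi>) =
          (LINT \<xi>|torus. f \<xi> - f \<xi> * indicator A \<xi>)"
        by (intro Bochner_Integration.integral_cong) (auto simp: indicator_def)
      then show ?case
        using compl mean f int[OF A] by simp
    next
      case (union A)
      then have A: "A i \<in> sets borel" for i
        by (auto simp: borel_eq_atMost)
      have AU: "(\<Union>i. A i) \<in> sets borel" using A by auto
      have "(\<lambda>i. LINT \<xi>|torus. f \<xi> * indicator (A i) \<xi>) sums (LINT \<xi>|torus. f \<xi> * indicator (\<Union>i. A i) \<xi>)"
        unfolding sums_def
      proof -
        have [measurable]: "(indicator B :: real \<Rightarrow> real) \<in> borel_measurable torus"
          if "B \<in> sets borel" for B
          using that by (intro measurable_torusI) simp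
        note [measurable] = A AU
        have "(\<lambda>n. LINT \<xi>|torus. f \<xi> * (\<Sum>i<n. indicator (A i) \<xi>)) \<longlonglongrightarrow>
            (LINT \<xi>|torus. f \<xi> * indicator (\<Union>i. A i) \<xi>)"
        proof (rule integral_dominated_convergence[where w = "\<lambda>\<xi>. \<bar>f \<xi>\<bar>"])
          show "AE \<xi> in torus. (\<lambda>n. f \<xi> * (\<Sum>i<n. indicator (A i) \<xi>)) \<longlonglongrightarrow> f \<xi> * indicator (\<Union>i. A i) \<xi>"
            using indicator_sums[of A] union(1)
            by (intro AE_I2 tendsto_intros) (auto simp: sums_def disjoint_family_on_def)
          have "(\<Sum>i<n. indicator (A i) \<xi> :: real) = indicator (\<Union>i<n. A i) \<xi>" for n \<xi>
            using union(1) by (intro indicator_UN_disjoint[symmetric]) (auto simp: disjoint_family_on_def)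
          then show "AE \<xi> in torus. norm (f \<xi> * (\<Sum>i<n. indicator (A i) \<xi>)) \<le> \<bar>f \<xi>\<bar>" for n
            by (intro AE_I2) (auto simp: indicator_def)
        qed (use f A AU in auto)
        moreover have "(LINT \<xi>|torus. f \<xi> * (\<Sum>i<n. indicator (A i) \<xi>)) =
            (\<Sum>i<n. LINT \<xi>|torus. f \<xi> * indicator (A i) \<xi>)" for n
          unfolding sum_distrib_left by (rule Bochner_Integration.integral_sum) (rule int[OF A])
        ultimately show "(\<lambda>n. \<Sum>i<n. LINT \<xi>|torus. f \<xi> * indicator (A i) \<xi>) \<longlonglongrightarrow>
            (LINT \<xi>|torus. f \<xi> * indicator (\<Union>i. A i) \<xi>)"
          by simp
      qed
      then show ?case
        using union by (simp add: sums_iff)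
    qed (use half_line in auto)
  qed
  have nonpos: "AE \<xi> in torus. g \<xi> \<le> 0"
    if g: "g \<in> borel_measurable torus" "\<And>A. A \<in> sets borel \<Longrightarrow> integrable torus (\<lambda>\<xi>. g \<xi> * indicator A \<xi>)"
      "\<And>A. A \<in> sets borel \<Longrightarrow> (LINT \<xi>|torus. g \<xi> * indicator A \<xi>) = 0" for g :: "real \<Rightarrow> real"
  proof -
    \<comment> \<open>The positivity set of g is the trace of a Borel set A. There g is positive
      with integral 0, so A is negligible; this is used for f and for - f.\<close>
    have "{\<xi>\<in>space torus. g \<xi> > 0} \<in> sets torus" using g(1) by measurable
    then obtain A where A: "A \<in> sets borel" "{\<xi>\<in>space torus. g \<xi> > 0} = {0..<1} \<inter> A"
      by (auto simp: torus_def sets_restrict_space)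
    have pos: "g \<xi> > 0 \<longleftrightarrow> \<xi> \<in> A" if "\<xi> \<in> space torus" for \<xi>
    proof -
      have "\<xi> \<in> {\<xi>\<in>space torus. g \<xi> > 0} \<longleftrightarrow> \<xi> \<in> {0..<1} \<inter> A" by (simp only: A)
      then show ?thesis using that by (auto simp: space_torus)
    qed
    then have "AE \<xi> in torus. 0 \<le> g \<xi> * indicator A \<xi>"
      by (intro AE_I2) (auto simp: indicator_def intro: less_imp_le)
    then have "AE \<xi> in torus. g \<xi> * indicator A \<xi> = 0"
      using g(2,3)[OF A(1)] by (simp add: integral_nonneg_eq_0_iff_AE)
    then show ?thesis
      using AE_space
    proof eventually_elim
      case (elim \<xi>)
      then show ?case using pos[of \<xi>] by (cases "\<xi> \<in> A") (auto simp: not_less)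
    qed
  qed
  have "AE \<xi> in torus. f \<xi> \<le> 0"
    by (rule nonpos) (auto simp: all int)
  moreover have "AE \<xi> in torus. - f \<xi> \<le> 0"
    by (rule nonpos) (auto simp: all int)
  ultimately show ?thesis
    by eventually_elim simp
qed

section \<open>The orthonormal basis\<close>

definition trig :: "int \<Rightarrow> real \<Rightarrow> real" where
  "trig k \<xi> = sqrt 2 * (if k > 0 then cos (2 * pi * of_int k * \<xi>) else sin (2 * pi * of_int \<bar>k\<bar> * \<xi>))"

lemma trig_measurable [measurable]: "trig k \<in> borel_measurable torus"
  unfolding trig_def
  by (cases "k > 0") (auto intro!: measurable_torusI borel_measurable_continuous_onI continuous_intros)

lemma abs_trig_le: "\<bar>trig k \<xi>\<bar> \<le> sqrt 2"
  by (simp add: trig_def abs_mult)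

lemma trig_L2: "trig k \<in> L2_torus"
  by (intro L2_torus_bounded[where B = "sqrt 2"]) (auto simp: abs_trig_le)

lemma integral_torus_FTC:
  fixes F f :: "real \<Rightarrow> real"
  assumes F: "\<And>x. (F has_real_derivative f x) (at x)" and f: "continuous_on UNIV f"
  shows "(LINT \<xi>|torus. f \<xi>) = F 1 - F 0"
proof -
  have "(f has_integral (F 1 - F 0)) {0..1}"
    by (rule fundamental_theorem_of_calculus)
       (auto intro: has_field_derivative_at_within F simp flip: has_real_derivative_iff_has_vector_derivative)
  moreover have "set_integrable lborel {0..1} f"
    by (rule borel_integrable_atLeastAtMost') (rule continuous_on_subset[OF f], simp)
  ultimately have "(LBINT \<xi>:{0..1}. f \<xi>) = F 1 - F 0"
    by (simp add: set_borel_integral_eq_integral integral_unique)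
  \<comment> \<open>The torus is half-open while the fundamental theorem uses the closed interval;
    they differ in the null set {1}.\<close>
  moreover have "(LBINT \<xi>:{0..<1}. f \<xi>) = (LBINT \<xi>:{0..1}. f \<xi>)"
    unfolding set_lebesgue_integral_def
  proof (rule integral_cong_AE)
    have [measurable]: "f \<in> borel_measurable borel"
      by (rule borel_measurable_continuous_onI[OF f])
    show "(\<lambda>x. indicator {0..<1} x *\<^sub>R f x) \<in> borel_measurable lborel" by simp
    show "(\<lambda>x. indicator {0..1} x *\<^sub>R f x) \<in> borel_measurable lborel" by simp
    show "AE x in lborel. indicator {0..<1} x *\<^sub>R f x = indicator {0..1} x *\<^sub>R f x"
      using AE_lborel_singleton[of 1] by eventually_elim (auto simp: indicator_def)
  qed
  ultimately show ?thesis
    by (simp add: integral_torus)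
qed

lemma integral_torus_cos: "(LINT \<xi>|torus. cos (2 * pi * of_int m * \<xi>)) = (if m = 0 then 1 else 0)"
proof (cases "m = 0")
  case False
  then have "((\<lambda>x. sin (2 * pi * of_int m * x) / (2 * pi * of_int m))
      has_real_derivative cos (2 * pi * of_int m * x)) (at x)" for x
    by (auto intro!: derivative_eq_intros)
  from integral_torus_FTC[OF this] show ?thesis
    using False by (simp add: continuous_intros)
qed (simp add: torus.prob_space)

lemma integral_torus_sin: "(LINT \<xi>|torus. sin (2 * pi * of_int m * \<xi>)) = 0"
proof (cases "m = 0")
  case False
  then have "((\<lambda>x. - cos (2 * pi * of_int m * x) / (2 * pi * of_int m))
      has_real_derivative sin (2 * pi * of_int m * x)) (at x)" for x
    by (auto intro!: derivative_eq_intros)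
  from integral_torus_FTC[OF this] show ?thesis
    using False by (simp add: continuous_intros)
qed simp


text \<open>Product-to-sum formulas. For indices of equal sign the sum frequency never vanishes, so
  only the difference frequency can have a nonzero mean; mixed signs give sines, whose mean is 0 at
  every frequency.\<close>

lemma integral_trig_mult:
  assumes "j \<noteq> 0" "k \<noteq> 0"
  shows "(LINT \<xi>|torus. trig j \<xi> * trig k \<xi>) = (if j = k then 1 else 0)"
proof -
  have c: "integrable torus (\<lambda>\<xi>. cos (2 * pi * of_int m * \<xi>))" for m
    by (rule torus.integrable_const_bound[where B=1])
       (auto intro!: measurable_torusI borel_measurable_continuous_onI continuous_intros)
  have s: "integrable torus (\<lambda>\<xi>. sin (2 * pi * of_int m * \<xi>))" for m
    by (rule torus.integrable_const_bound[where B=1])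
       (auto intro!: measurable_torusI borel_measurable_continuous_onI continuous_intros)
  have minus: "2 * pi * of_int (m - n) * \<xi> = 2 * pi * of_int m * \<xi> - 2 * pi * of_int n * \<xi>"
    and plus: "2 * pi * of_int (m + n) * \<xi> = 2 * pi * of_int m * \<xi> + 2 * pi * of_int n * \<xi>"
    for m n \<xi> by (simp_all add: algebra_simps)
  have *: "sqrt 2 * a * (sqrt 2 * b) = 2 * (a * b)" for a b :: real
    by simp
  have prods: "sqrt 2 * cos a * (sqrt 2 * cos b) = cos (a - b) + cos (a + b)"
    "sqrt 2 * cos a * (sqrt 2 * sin b) = sin (a + b) - sin (a - b)"
    "sqrt 2 * sin a * (sqrt 2 * cos b) = sin (a + b) + sin (a - b)"
    "sqrt 2 * sin a * (sqrt 2 * sin b) = cos (a - b) - cos (a + b)" for a b :: real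
    unfolding * cos_times_cos cos_times_sin sin_times_cos sin_times_sin by simp_all
  have trig_pos: "i > 0 \<Longrightarrow> trig i \<xi> = sqrt 2 * cos (2 * pi * of_int i * \<xi>)"
    and trig_neg: "i < 0 \<Longrightarrow> trig i \<xi> = sqrt 2 * sin (2 * pi * of_int \<bar>i\<bar> * \<xi>)" for i \<xi>
    by (simp_all add: trig_def)
  consider "j > 0" "k > 0" | "j > 0" "k < 0" | "j < 0" "k > 0" | "j < 0" "k < 0"
    using assms by linarith
  then show ?thesis
  proof cases
    case 1
    then have "trig j \<xi> * trig k \<xi> = cos (2 * pi * of_int (j - k) * \<xi>) + cos (2 * pi * of_int (j + k) * \<xi>)" for \<xi>
      by (simp only: trig_pos trig_neg minus plus prods)
    then show ?thesis
      using 1 by (simp add: c integral_torus_cos del: of_int_diff of_int_add)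
  next
    case 2
    then have "trig j \<xi> * trig k \<xi> = sin (2 * pi * of_int (j + \<bar>k\<bar>) * \<xi>) - sin (2 * pi * of_int (j - \<bar>k\<bar>) * \<xi>)" for \<xi>
      by (simp only: trig_pos trig_neg minus plus prods)
    then show ?thesis
      using 2 by (simp add: s integral_torus_sin del: of_int_diff of_int_add of_int_abs)
  next
    case 3
    then have "trig j \<xi> * trig k \<xi> = sin (2 * pi * of_int (\<bar>j\<bar> + k) * \<xi>) + sin (2 * pi * of_int (\<bar>j\<bar> - k) * \<xi>)" for \<xi>
      by (simp only: trig_pos trig_neg minus plus prods)
    then show ?thesis
      using 3 by (simp add: s integral_torus_sin del: of_int_diff of_int_add of_int_abs)
  next
    case 4
    then have "trig j \<xi> * trig k \<xi> = cos (2 * pi * of_int (\<bar>j\<bar> - \<bar>k\<bar>) * \<xi>) - cos (2 * pi * of_int (\<bar>j\<bar> + \<bar>k\<bar>) * \<xi>)" for \<xi>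
      by (simp only: trig_pos trig_neg minus plus prods)
    then show ?thesis
      using 4 by (simp add: c integral_torus_cos del: of_int_diff of_int_add of_int_abs)
  qed
qed

lemma trig_mean_zero: "k \<noteq> 0 \<Longrightarrow> (LINT \<xi>|torus. trig k \<xi>) = 0"
  using integral_torus_cos[of k] integral_torus_sin[of "\<bar>k\<bar>"]
  by (cases "k > 0") (simp_all add: trig_def del: of_int_abs)

section \<open>The basis as elements of H and its relation to the Fourier coefficients\<close>

lemma AE_rep_proj_H:
  assumes "f \<in> L2_torus"
  shows "AE \<xi> in torus. rep_H (proj_H f) \<xi> = f \<xi> - (LINT \<eta>|torus. f \<eta>)"
  unfolding proj_H_def map_fun_apply id_apply if_P[OF assms]
  by (intro AE_rep_abs L2_mean_zero_center assms)

lemma real_basis_eq: "real_basis k = proj_H (trig k)"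
  unfolding real_basis_def trig_def[abs_def] ..

lemma AE_rep_real_basis: "k \<noteq> 0 \<Longrightarrow> AE \<xi> in torus. rep_H (real_basis k) \<xi> = trig k \<xi>"
  using AE_rep_proj_H[OF trig_L2[of k]]
  by (simp add: real_basis_eq trig_mean_zero)

text \<open>The constant that \<open>proj_H\<close> removes is orthogonal to x, which has mean zero.
  Hence f may replace its projection in every pairing with an element of H, in particular inside
  \<open>nonlin\<close>.\<close>

lemma inner_proj_H:
  assumes f: "f \<in> L2_torus"
  shows "inner x (proj_H f) = (LINT \<xi>|torus. rep_H x \<xi> * f \<xi>)"
proof -
  have [measurable]: "f \<in> borel_measurable torus" using f by (simp add: L2_torus_def)
  have "inner x (proj_H f) = (LINT \<xi>|torus. rep_H x \<xi> * f \<xi> - rep_H x \<xi> * (LINT \<eta>|torus. f \<eta>))"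
    unfolding inner_H_eq
  proof (rule integral_cong_AE)
    show "AE \<xi> in torus. rep_H x \<xi> * rep_H (proj_H f) \<xi> = rep_H x \<xi> * f \<xi> - rep_H x \<xi> * (LINT \<eta>|torus. f \<eta>)"
      using AE_rep_proj_H[OF f] by eventually_elim (simp add: right_diff_distrib)
  qed measurable
  also have "\<dots> = (LINT \<xi>|torus. rep_H x \<xi> * f \<xi>)"
    using L2_torus_integrable_mult[OF rep_H_L2 f] L2_torus_integrable[OF rep_H_L2] rep_H_mean[of x]
    by simp
  finally show ?thesis .
qed

lemma inner_real_basis: "inner x (real_basis k) = (LINT \<xi>|torus. rep_H x \<xi> * trig k \<xi>)"
  by (simp add: real_basis_eq inner_proj_H[OF trig_L2])

lemma inner_real_basis_real_basis:
  assumes "j \<noteq> 0" "k \<noteq> 0"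
  shows "inner (real_basis j) (real_basis k) = (if j = k then 1 else 0)"
proof -
  have "inner (real_basis j) (real_basis k) = (LINT \<xi>|torus. trig j \<xi> * trig k \<xi>)"
    unfolding inner_real_basis
  proof (rule integral_cong_AE)
    show "AE \<xi> in torus. rep_H (real_basis j) \<xi> * trig k \<xi> = trig j \<xi> * trig k \<xi>"
      using AE_rep_real_basis[OF assms(1)] by eventually_elim simp
  qed measurable
  then show ?thesis by (simp add: integral_trig_mult assms)
qed

lemma norm_real_basis: "k \<noteq> 0 \<Longrightarrow> norm (real_basis k) = 1"
  by (simp add: norm_eq_sqrt_inner inner_real_basis_real_basis)

lemma integral_cis_real_basis:
  assumes "k > 0"
  shows "(LINT \<xi>|torus. of_real (rep_H x \<xi>) * cis (2 * pi * of_int k * \<xi>)) =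
    Complex (inner x (real_basis k)) (inner x (real_basis (- k))) / sqrt 2" (is ?A)
    and "(LINT \<xi>|torus. of_real (rep_H x \<xi>) * cis (- (2 * pi * of_int k * \<xi>))) =
    Complex (inner x (real_basis k)) (- inner x (real_basis (- k))) / sqrt 2" (is ?B)
proof -
  have int: "integrable torus (\<lambda>\<xi>. rep_H x \<xi> * trig j \<xi>)" for j
    by (rule L2_torus_integrable_mult[OF rep_H_L2 trig_L2])
  \<comment> \<open>The sign c = 1 or -1 treats both conjugate exponentials at once: each is (trig k
    + i c trig (-k)) / sqrt 2.\<close>
  have "(LINT \<xi>|torus. of_real (rep_H x \<xi>) * cis (c * (2 * pi * of_int k * \<xi>))) =
      (LINT \<xi>|torus. (of_real (rep_H x \<xi> * trig k \<xi>) + \<i> * c * of_real (rep_H x \<xi> * trig (-k) \<xi>)) / sqrt 2)"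
    if "c = 1 \<or> c = -1" for c :: real
    using assms that by (intro Bochner_Integration.integral_cong refl) (auto simp: trig_def complex_eq_iff)
  also have "\<dots> c = Complex (inner x (real_basis k)) (c * inner x (real_basis (- k))) / sqrt 2" for c :: real
    using int[of k] int[of "-k"]
    by (simp add: inner_real_basis complex_eq_iff del: of_real_mult)
  finally show ?A ?B
    by (auto dest: meta_spec[of _ 1] meta_spec[of _ "-1"])
qed

lemma fourier_coeff_eq_integral:
  "fourier_coeff x k = (LINT \<xi>|torus. of_real (rep_H x \<xi>) * cis (- (2 * pi * of_int k * \<xi>)))"
  by (simp add: fourier_coeff_def cis_cnj)

lemma fourier_coeff_pos:
  "k > 0 \<Longrightarrow> fourier_coeff x k =
    Complex (inner x (real_basis k)) (- inner x (real_basis (- k))) / sqrt 2"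
  by (simp add: fourier_coeff_eq_integral integral_cis_real_basis)

lemma fourier_coeff_neg:
  "k < 0 \<Longrightarrow> fourier_coeff x k =
    Complex (inner x (real_basis (- k))) (inner x (real_basis k)) / sqrt 2"
  using integral_cis_real_basis(1)[of "-k" x] by (simp add: fourier_coeff_eq_integral)

text \<open>The basis has no index 0; the missing coefficient of x - y is its mean, which vanishes
  in H.\<close>

lemma real_basis_complete:
  assumes "\<And>k. k \<noteq> 0 \<Longrightarrow> inner x (real_basis k) = inner y (real_basis k)"
  shows "x = y"
proof -
  have zero: "inner (x - y) (real_basis k) = 0" if "k \<noteq> 0" for k
    using assms[OF that] by (simp add: inner_diff_left)
  have "(LINT \<xi>|torus. of_real (rep_H (x - y) \<xi>) * cis (2 * pi * of_int k * \<xi>)) = 0" for k :: int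
  proof -
    consider "k = 0" | "k > 0" | "k < 0" by linarith
    then show ?thesis
    proof cases
      case 1
      then show ?thesis
        using rep_H_mean[of "x - y"] by (simp add: integral_complex_of_real)
    next
      case 2
      then show ?thesis by (simp add: integral_cis_real_basis zero complex_eq_iff)
    next
      case 3
      then show ?thesis
        using integral_cis_real_basis(2)[of "-k" "x - y"] by (simp add: zero complex_eq_iff)
    qed
  qed
  then have "AE \<xi> in torus. rep_H (x - y) \<xi> = 0"
    by (rule fourier_coeffs_eq_0_imp_AE_eq_0[OF L2_torus_integrable[OF rep_H_L2]])
  with AE_rep_diff[of x y] show ?thesis
    by (intro H_eqI) (auto elim: eventually_elim2)
qed

section \<open>Absolutely convergent expansions\<close>

abbreviation nz :: "int set" where "nz \<equiv> {k. k \<noteq> 0}"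

lemma summable_int_powr:
  assumes "s > 1"
  shows "(\<lambda>k::int. real_of_int \<bar>k\<bar> powr - s) summable_on nz"
proof -
  let ?f = "\<lambda>k::int. real_of_int \<bar>k\<bar> powr - s"
  have "summable (\<lambda>n. real n powr - s)"
    using assms by (simp add: summable_real_powr_iff)
  then have "summable (\<lambda>n. real (Suc n) powr - s)"
    by (subst summable_Suc_iff)
  then have "(\<lambda>n. real (Suc n) powr - s) summable_on UNIV"
    by (intro norm_summable_imp_summable_on) simp
  then have nat: "(?f \<circ> (\<lambda>n. int (Suc n))) summable_on UNIV" "(?f \<circ> (\<lambda>n. - int (Suc n))) summable_on UNIV"
    by (simp_all add: o_def add.commute)
  have "?f summable_on range (\<lambda>n. int (Suc n))"
    by (subst summable_on_reindex) (use nat in \<open>auto simp: inj_on_def\<close>)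
  moreover have "?f summable_on range (\<lambda>n. - int (Suc n))"
    by (subst summable_on_reindex) (use nat in \<open>auto simp: inj_on_def\<close>)
  ultimately have "?f summable_on (range (\<lambda>n. int (Suc n)) \<union> range (\<lambda>n. - int (Suc n)))"
    by (rule summable_on_union)
  moreover have "range (\<lambda>n. int (Suc n)) \<union> range (\<lambda>n. - int (Suc n)) = nz"
  proof -
    have "k \<in> range (\<lambda>n. int (Suc n)) \<union> range (\<lambda>n. - int (Suc n))" if "k \<noteq> 0" for k
    proof (cases "k > 0")
      case True
      then have "k = int (Suc (nat (k - 1)))" by simp
      then show ?thesis by blast
    next
      case False
      then have "k = - int (Suc (nat (- k - 1)))" using that by simp
      then show ?thesis by blast
    qed
    then show ?thesis by auto
  qed
  ultimately show ?thesis by simp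
qed

text \<open>Coefficients with respect to the real orthonormal basis; unlike the complex ones they are
  bounded linear functionals on \<^typ>\<open>H\<close> with values in the scalar field of \<^typ>\<open>H\<close>.\<close>

definition rcoeff :: "int \<Rightarrow> H \<Rightarrow> real" where "rcoeff k x = inner x (real_basis k)"

lemma bounded_linear_rcoeff: "bounded_linear (rcoeff k)"
  unfolding rcoeff_def by (rule bounded_linear_inner_left)

lemma rcoeff_add: "rcoeff k (x + y) = rcoeff k x + rcoeff k y"
  and rcoeff_diff: "rcoeff k (x - y) = rcoeff k x - rcoeff k y"
  and rcoeff_scaleR: "rcoeff k (c *\<^sub>R x) = c * rcoeff k x"
  by (simp_all add: rcoeff_def inner_add_left inner_diff_left)

lemma rcoeff_real_basis: "j \<noteq> 0 \<Longrightarrow> k \<noteq> 0 \<Longrightarrow> rcoeff k (real_basis j) = (if j = k then 1 else 0)"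
  by (simp add: rcoeff_def inner_real_basis_real_basis)

lemma rcoeff_eqI: "(\<And>k. k \<noteq> 0 \<Longrightarrow> rcoeff k x = rcoeff k y) \<Longrightarrow> x = y"
  unfolding rcoeff_def by (rule real_basis_complete)

lemma abs_rcoeff_le: "k \<noteq> 0 \<Longrightarrow> \<bar>rcoeff k x\<bar> \<le> norm x"
  using Cauchy_Schwarz_ineq2[of x "real_basis k"] by (simp add: rcoeff_def norm_real_basis)

lemma rcoeff_expansion:
  assumes "((\<lambda>k. a k *\<^sub>R real_basis k) has_sum x) nz" "j \<noteq> 0"
  shows "rcoeff j x = a j"
proof -
  have "((\<lambda>k. rcoeff j (a k *\<^sub>R real_basis k)) has_sum rcoeff j x) nz"
    by (rule has_sum_bounded_linear[OF bounded_linear_rcoeff assms(1)])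
  moreover have "((\<lambda>k. rcoeff j (a k *\<^sub>R real_basis k)) has_sum a j) nz"
    using has_sum_cong_neutral[of nz "{j}" "\<lambda>k. rcoeff j (a k *\<^sub>R real_basis k)" "\<lambda>k. rcoeff j (a k *\<^sub>R real_basis k)" "a j"] assms(2)
    by (auto simp: rcoeff_scaleR rcoeff_real_basis has_sum_finite_iff)
  ultimately show ?thesis
    by (rule has_sum_unique)
qed

lemma bessel:
  assumes "finite F" "F \<subseteq> nz"
  shows "(\<Sum>k\<in>F. (rcoeff k x)\<^sup>2) \<le> (norm x)\<^sup>2"
proof -
  define y where "y = (\<Sum>k\<in>F. rcoeff k x *\<^sub>R real_basis k)"
  have xy: "inner x y = (\<Sum>k\<in>F. (rcoeff k x)\<^sup>2)"
    by (simp add: y_def inner_sum_right rcoeff_def power2_eq_square)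
  have "inner y (real_basis k) = rcoeff k x" if "k \<in> F" for k
  proof -
    have "inner y (real_basis k) = (\<Sum>j\<in>F. rcoeff j x * (if j = k then 1 else 0))"
      unfolding y_def inner_sum_left inner_scaleR_left
      using assms that by (intro sum.cong refl) (subst inner_real_basis_real_basis, auto)
    also have "\<dots> = rcoeff k x"
      using assms(1) that by (simp add: if_distrib sum.delta cong: if_cong)
    finally show ?thesis .
  qed
  moreover have "inner y (\<Sum>k\<in>F. rcoeff k x *\<^sub>R real_basis k) = (\<Sum>k\<in>F. rcoeff k x * inner y (real_basis k))"
    by (simp add: inner_sum_right)
  ultimately have "inner y y = (\<Sum>k\<in>F. (rcoeff k x)\<^sup>2)"
    by (simp add: y_def[symmetric] power2_eq_square)
  then have "(norm (x - y))\<^sup>2 = (norm x)\<^sup>2 - (\<Sum>k\<in>F. (rcoeff k x)\<^sup>2)"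
    by (simp add: power2_norm_eq_inner inner_diff xy inner_commute[of y x])
  then show ?thesis
    using zero_le_power2[of "norm (x - y)"] by linarith
qed

text \<open>Membership in the Wiener algebra. Absolute summability makes the expansion converge
  uniformly, so its limit is built pointwise, without completeness of H, and the sum of the
  coefficients controls the supremum norm.\<close>

definition abs_conv :: "H \<Rightarrow> bool" where
  "abs_conv x \<longleftrightarrow> (\<lambda>k. \<bar>rcoeff k x\<bar>) summable_on nz"

definition wiener_norm :: "H \<Rightarrow> real" where
  "wiener_norm x = (\<Sum>\<^sub>\<infinity>k\<in>nz. \<bar>rcoeff k x\<bar>)"

text \<open>Weierstrass M-test: the terms are at most sqrt 2 |a k|, so the series converges
  uniformly to a bounded measurable g of mean zero; on a space of mass 1 the uniform tail bound is
  also a bound in the norm of H.\<close>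

lemma trig_series:
  assumes a: "(\<lambda>k. \<bar>a k\<bar>) summable_on nz"
  shows "\<exists>x. ((\<lambda>k. a k *\<^sub>R real_basis k) has_sum x) nz \<and>
    (AE \<xi> in torus. \<bar>rep_H x \<xi>\<bar> \<le> sqrt 2 * (\<Sum>\<^sub>\<infinity>k\<in>nz. \<bar>a k\<bar>))"
proof -
  define A where "A = (\<Sum>\<^sub>\<infinity>k\<in>nz. \<bar>a k\<bar>)"
  define g where "g \<xi> = (\<Sum>\<^sub>\<infinity>k\<in>nz. a k * trig k \<xi>)" for \<xi>
  have A: "((\<lambda>k. \<bar>a k\<bar>) has_sum A) nz"
    using a by (simp add: A_def)
  have le: "\<bar>a k * trig k \<xi>\<bar> \<le> sqrt 2 * \<bar>a k\<bar>" for k \<xi>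
    using mult_left_mono[OF abs_trig_le, of "\<bar>a k\<bar>" k \<xi>] by (simp add: abs_mult mult.commute)
  have abs: "(\<lambda>k. norm (a k * trig k \<xi>)) summable_on nz" for \<xi>
    by (rule summable_on_comparison_test[OF summable_on_cmult_right[OF a, of "sqrt 2"]]) (use le in auto)
  have g: "((\<lambda>k. a k * trig k \<xi>) has_sum g \<xi>) nz" for \<xi>
    unfolding g_def by (rule has_sum_infsum[OF abs_summable_summable[OF abs]])
  have tail: "\<bar>g \<xi> - (\<Sum>k\<in>F. a k * trig k \<xi>)\<bar> \<le> sqrt 2 * (A - (\<Sum>k\<in>F. \<bar>a k\<bar>))"
    if F: "finite F" "F \<subseteq> nz" for F \<xi>
  proof -
    have 1: "((\<lambda>k. a k * trig k \<xi>) has_sum (g \<xi> - (\<Sum>k\<in>F. a k * trig k \<xi>))) (nz - F)"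
      by (rule has_sum_Diff[OF g has_sum_finite[OF F(1)] F(2)])
    have 2: "((\<lambda>k. sqrt 2 * \<bar>a k\<bar>) has_sum (sqrt 2 * (A - (\<Sum>k\<in>F. \<bar>a k\<bar>)))) (nz - F)"
      by (intro has_sum_cmult_right has_sum_Diff[OF A has_sum_finite[OF F(1)] F(2)])
    have "g \<xi> - (\<Sum>k\<in>F. a k * trig k \<xi>) \<le> sqrt 2 * (A - (\<Sum>k\<in>F. \<bar>a k\<bar>))"
      using le by (intro has_sum_mono[OF 1 2]) (auto simp: abs_le_iff)
    moreover have "- (sqrt 2 * (A - (\<Sum>k\<in>F. \<bar>a k\<bar>))) \<le> g \<xi> - (\<Sum>k\<in>F. a k * trig k \<xi>)"
      using 2 le by (intro has_sum_mono[OF _ 1, of "\<lambda>k. - (sqrt 2 * \<bar>a k\<bar>)"])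
        (auto simp: has_sum_uminus abs_le_iff minus_le_iff)
    ultimately show ?thesis by linarith
  qed
  have tendsto: "((\<lambda>F. sqrt 2 * (A - (\<Sum>k\<in>F. \<bar>a k\<bar>))) \<longlongrightarrow> 0) (finite_subsets_at_top nz)"
  proof -
    have "((\<lambda>F. sqrt 2 * (A - (\<Sum>k\<in>F. \<bar>a k\<bar>))) \<longlongrightarrow> sqrt 2 * (A - A)) (finite_subsets_at_top nz)"
      using A unfolding has_sum_def by (intro tendsto_intros)
    then show ?thesis by simp
  qed
  \<comment> \<open>Measurability and dominated convergence ask for a sequence; these sets
    eventually contain every finite subset of \<open>nz\<close>, so the sequence has the same limit
    as the net.\<close>
  define Fn where "Fn n = {k::int. k \<noteq> 0 \<and> \<bar>k\<bar> \<le> int n}" for n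
  have Fn: "finite (Fn n)" "Fn n \<subseteq> nz" for n
    by (rule finite_subset[of _ "{- int n..int n}"], auto simp: Fn_def)
  have Fn_lim: "filterlim Fn (finite_subsets_at_top nz) sequentially"
    unfolding filterlim_finite_subsets_at_top
  proof safe
    fix X :: "int set" assume X: "finite X" "X \<subseteq> nz"
    then have "bdd_above (abs ` X)" by simp
    then obtain m where m: "\<And>k. k \<in> X \<Longrightarrow> \<bar>k\<bar> \<le> m"
      unfolding bdd_above_def by blast
    show "\<forall>\<^sub>F n in sequentially. finite (Fn n) \<and> X \<subseteq> Fn n \<and> Fn n \<subseteq> nz"
      using eventually_ge_at_top[of "nat m"]
    proof eventually_elim
      case (elim n)
      then show ?case
        using Fn[of n] X m by (force simp: Fn_def)
    qed
  qed
  have S_meas: "(\<lambda>\<xi>. \<Sum>k\<in>Fn n. a k * trig k \<xi>) \<in> borel_measurable torus" for n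
    by measurable
  have lim: "(\<lambda>n. \<Sum>k\<in>Fn n. a k * trig k \<xi>) \<longlonglongrightarrow> g \<xi>" for \<xi>
    using g[of \<xi>] Fn_lim unfolding has_sum_def by (rule filterlim_compose)
  have g_meas [measurable]: "g \<in> borel_measurable torus"
    by (rule borel_measurable_LIMSEQ_real[OF lim S_meas])
  have g_bound: "\<bar>g \<xi>\<bar> \<le> sqrt 2 * A" for \<xi>
    using tail[of "{}"] by simp
  have mean: "(LINT \<xi>|torus. g \<xi>) = 0"
  proof -
    have "(\<lambda>n. LINT \<xi>|torus. (\<Sum>k\<in>Fn n. a k * trig k \<xi>)) \<longlonglongrightarrow> (LINT \<xi>|torus. g \<xi>)"
    proof (rule integral_dominated_convergence[where w = "\<lambda>_. 2 * (sqrt 2 * A)"])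
      show "AE \<xi> in torus. norm (\<Sum>k\<in>Fn n. a k * trig k \<xi>) \<le> 2 * (sqrt 2 * A)" for n
      proof (rule AE_I2)
        fix \<xi>
        have "sqrt 2 * (A - (\<Sum>k\<in>Fn n. \<bar>a k\<bar>)) \<le> sqrt 2 * A"
          by (simp add: sum_nonneg)
        then show "norm (\<Sum>k\<in>Fn n. a k * trig k \<xi>) \<le> 2 * (sqrt 2 * A)"
          using tail[OF Fn, of \<xi> n] g_bound[of \<xi>] unfolding real_norm_def by linarith
      qed
    qed (use S_meas lim in auto)
    moreover have "(LINT \<xi>|torus. (\<Sum>k\<in>Fn n. a k * trig k \<xi>)) = 0" for n
    proof -
      have "(LINT \<xi>|torus. (\<Sum>k\<in>Fn n. a k * trig k \<xi>)) = (\<Sum>k\<in>Fn n. LINT \<xi>|torus. a k * trig k \<xi>)"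
        by (rule Bochner_Integration.integral_sum) (use L2_torus_integrable[OF trig_L2] in simp)
      also have "\<dots> = 0"
        by (rule sum.neutral) (simp add: Fn_def trig_mean_zero)
      finally show ?thesis .
    qed
    ultimately show ?thesis by (simp add: LIMSEQ_const_iff)
  qed
  have "g \<in> L2_mean_zero"
    unfolding L2_mean_zero_def using mean L2_torus_bounded[OF g_meas AE_I2[OF g_bound]] by simp
  then have rep: "AE \<xi> in torus. rep_H (abs_H g) \<xi> = g \<xi>"
    by (rule AE_rep_abs)
  have norm_le: "norm ((\<Sum>k\<in>F. a k *\<^sub>R real_basis k) - abs_H g) \<le> sqrt 2 * (A - (\<Sum>k\<in>F. \<bar>a k\<bar>))"
    if F: "finite F" "F \<subseteq> nz" for F
  proof (rule norm_H_le_AE)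
    have 1: "AE \<xi> in torus. \<forall>k\<in>F. rep_H (a k *\<^sub>R real_basis k) \<xi> = a k * trig k \<xi>"
    proof (rule AE_finite_allI[OF F(1)])
      fix k assume "k \<in> F"
      then have "k \<noteq> 0" using F by auto
      from AE_rep_scale[of "a k" "real_basis k"] AE_rep_real_basis[OF this]
      show "AE \<xi> in torus. rep_H (a k *\<^sub>R real_basis k) \<xi> = a k * trig k \<xi>"
        by eventually_elim simp
    qed
    from 1 AE_rep_sum[of "\<lambda>k. a k *\<^sub>R real_basis k" F]
      AE_rep_diff[of "\<Sum>k\<in>F. a k *\<^sub>R real_basis k" "abs_H g"] rep
    show "AE \<xi> in torus. \<bar>rep_H ((\<Sum>k\<in>F. a k *\<^sub>R real_basis k) - abs_H g) \<xi>\<bar> \<le> sqrt 2 * (A - (\<Sum>k\<in>F. \<bar>a k\<bar>))"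
    proof eventually_elim
      case (elim \<xi>)
      then show ?case
        using tail[OF F, of \<xi>] by (simp add: abs_minus_commute)
    qed
    show "0 \<le> sqrt 2 * (A - (\<Sum>k\<in>F. \<bar>a k\<bar>))"
      using tail[OF F, of 0] by linarith
  qed
  have "((\<lambda>k. a k *\<^sub>R real_basis k) has_sum abs_H g) nz"
    unfolding has_sum_def
  proof (rule Lim_null[THEN iffD2], rule Lim_null_comparison[OF _ tendsto])
    show "\<forall>\<^sub>F F in finite_subsets_at_top nz. norm ((\<Sum>k\<in>F. a k *\<^sub>R real_basis k) - abs_H g) \<le> sqrt 2 * (A - (\<Sum>k\<in>F. \<bar>a k\<bar>))"
      by (rule eventually_finite_subsets_at_top_weakI) (rule norm_le)
  qed
  moreover have "AE \<xi> in torus. \<bar>rep_H (abs_H g) \<xi>\<bar> \<le> sqrt 2 * A"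
    using rep by eventually_elim (simp add: g_bound)
  ultimately show ?thesis
    unfolding A_def by blast
qed

text \<open>The series has a sum with the same coefficients as x; completeness of the trigonometric
  system identifies it with x.\<close>

lemma abs_conv_has_sum:
  assumes "abs_conv x"
  shows "((\<lambda>k. rcoeff k x *\<^sub>R real_basis k) has_sum x) nz"
    and "AE \<xi> in torus. \<bar>rep_H x \<xi>\<bar> \<le> sqrt 2 * wiener_norm x"
proof -
  obtain y where y: "((\<lambda>k. rcoeff k x *\<^sub>R real_basis k) has_sum y) nz"
    "AE \<xi> in torus. \<bar>rep_H y \<xi>\<bar> \<le> sqrt 2 * wiener_norm x"
    using trig_series[of "\<lambda>k. rcoeff k x"] assms unfolding abs_conv_def wiener_norm_def by blast
  have "y = x"
    by (rule rcoeff_eqI) (rule rcoeff_expansion[OF y(1)])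
  with y show "((\<lambda>k. rcoeff k x *\<^sub>R real_basis k) has_sum x) nz"
    "AE \<xi> in torus. \<bar>rep_H x \<xi>\<bar> \<le> sqrt 2 * wiener_norm x" by simp_all
qed

lemma abs_conv_diff:
  assumes "abs_conv x" "abs_conv y"
  shows "abs_conv (x - y)"
  unfolding abs_conv_def
  by (rule summable_on_comparison_test[OF summable_on_add[OF assms[unfolded abs_conv_def]]])
     (auto simp: rcoeff_diff)

lemma wiener_norm_nonneg: "0 \<le> wiener_norm x"
  unfolding wiener_norm_def by (rule infsum_nonneg) simp


lemma abs_conv_parseval:
  assumes "abs_conv x"
  shows "((\<lambda>k. (rcoeff k x)\<^sup>2) has_sum (norm x)\<^sup>2) nz"
  using has_sum_bounded_linear[OF bounded_linear_inner_right abs_conv_has_sum(1)[OF assms], of x]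
  by (simp add: rcoeff_def power2_norm_eq_inner flip: power2_eq_square)

section \<open>The semigroup\<close>

lemma eigenval_minus [simp]: "eigenval (- k) = eigenval k"
  by (simp add: eigenval_def)

text \<open>The factor 2, far below 4 pi^2, is a sufficient spectral gap: in the energy estimate it
  yields - 4 |Y|^2, against which the nonlinearity costs at most 3 |Y|^2.\<close>

lemma eigenval_ge:
  assumes "k \<noteq> 0"
  shows "2 * (real_of_int k)\<^sup>2 \<le> eigenval k"
proof -
  have "1 \<le> pi\<^sup>2"
    using pi_gt3 by (intro one_le_power) linarith
  then show ?thesis
    unfolding eigenval_def by (intro mult_right_mono) auto
qed

lemma eigenval_ge_2: "k \<noteq> 0 \<Longrightarrow> 2 \<le> eigenval k"
proof -
  assume "k \<noteq> 0"
  then have "1 \<le> (real_of_int \<bar>k\<bar>)\<^sup>2"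
    by (intro one_le_power) linarith
  with eigenval_ge[OF \<open>k \<noteq> 0\<close>] show ?thesis by simp
qed

text \<open>\<open>semigroup_A\<close> is specified by complex coefficients, the estimates use real
  ones. A complex coefficient mixes the real ones at k and - k, so a multiplier carries over when it
  is real and even.\<close>

lemma fourier_multiplier_iff:
  fixes c :: "int \<Rightarrow> real"
  assumes c: "\<And>k. c (- k) = c k"
  shows "(\<forall>k. k \<noteq> 0 \<longrightarrow> fourier_coeff y k = of_real (c k) * fourier_coeff x k) \<longleftrightarrow>
    (\<forall>k. k \<noteq> 0 \<longrightarrow> rcoeff k y = c k * rcoeff k x)" (is "?L \<longleftrightarrow> ?R")
proof
  assume L: ?L
  have "rcoeff k y = c k * rcoeff k x \<and> rcoeff (- k) y = c k * rcoeff (- k) x" if "k > 0" for k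
    using L[rule_format, of k] that by (simp add: fourier_coeff_pos rcoeff_def complex_eq_iff)
  from this this[of "- _", unfolded c minus_minus] show ?R
    by (metis linorder_neqE_linordered_idom neg_0_less_iff_less)
next
  assume R: ?R
  show ?L
  proof (intro allI impI)
    fix k :: int assume "k \<noteq> 0"
    then consider "k > 0" | "k < 0" by linarith
    then show "fourier_coeff y k = of_real (c k) * fourier_coeff x k"
      using R[rule_format, of k] R[rule_format, of "-k"] c[of k]
      by cases (simp_all add: fourier_coeff_pos fourier_coeff_neg rcoeff_def complex_eq_iff)
  qed
qed

lemma summable_exp_eigenval:
  assumes "t > 0"
  shows "(\<lambda>k. exp (- eigenval k * t)) summable_on nz"
proof (rule summable_on_comparison_test)
  show "(\<lambda>k. (1 / t) * real_of_int \<bar>k\<bar> powr - 2) summable_on nz"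
    by (intro summable_on_cmult_right summable_int_powr) simp
  fix k :: int assume "k \<in> nz"
  then have k: "k \<noteq> 0" by simp
  have "(real_of_int k)\<^sup>2 * t \<le> exp (eigenval k * t)"
  proof -
    have "(real_of_int k)\<^sup>2 * t \<le> eigenval k * t"
      using eigenval_ge[OF k] zero_le_power2[of "real_of_int k"] assms by (intro mult_right_mono) linarith+
    also have "\<dots> \<le> exp (eigenval k * t)"
      using exp_ge_add_one_self[of "eigenval k * t"] by linarith
    finally show ?thesis .
  qed
  moreover have "0 < (real_of_int k)\<^sup>2 * t" using k assms by simp
  ultimately have "exp (- eigenval k * t) \<le> 1 / ((real_of_int k)\<^sup>2 * t)"
    by (simp add: exp_minus inverse_eq_divide frac_le)
  then show "exp (- eigenval k * t) \<le> (1 / t) * real_of_int \<bar>k\<bar> powr - 2"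
    using k by (simp add: powr_minus powr_numeral divide_simps mult.commute)
qed simp

text \<open>For t > 0 the exponential factor makes the coefficients absolutely summable; at t = 0
  there is no smoothing, but x itself is the witness.\<close>

lemma semigroup_A_exists:
  assumes "t \<ge> 0"
  shows "\<exists>y. \<forall>k. k \<noteq> 0 \<longrightarrow> rcoeff k y = exp (- eigenval k * t) * rcoeff k x"
proof (cases "t = 0")
  case False
  then have "t > 0" using assms by simp
  have "(\<lambda>k. \<bar>exp (- eigenval k * t) * rcoeff k x\<bar>) summable_on nz"
  proof (rule summable_on_comparison_test)
    show "(\<lambda>k. exp (- eigenval k * t) * norm x) summable_on nz"
      by (intro summable_on_cmult_left summable_exp_eigenval \<open>t > 0\<close>)
  qed (auto simp: abs_mult abs_rcoeff_le)
  from trig_series[OF this] obtain y where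
    "((\<lambda>k. (exp (- eigenval k * t) * rcoeff k x) *\<^sub>R real_basis k) has_sum y) nz"
    by blast
  from rcoeff_expansion[OF this] show ?thesis by blast
qed auto

text \<open>The definite description is meaningful: \<open>semigroup_A_exists\<close> gives a vector
  with these coefficients, completeness of the basis makes it unique.\<close>

lemma rcoeff_semigroup_A:
  assumes "t \<ge> 0" "k \<noteq> 0"
  shows "rcoeff k (semigroup_A t x) = exp (- eigenval k * t) * rcoeff k x"
proof -
  let ?P = "\<lambda>y. \<forall>k. k \<noteq> 0 \<longrightarrow> fourier_coeff y k = of_real (exp (- eigenval k * t)) * fourier_coeff x k"
  note iff = fourier_multiplier_iff[of "\<lambda>k. exp (- eigenval k * t)" _ x, simplified eigenval_minus, OF refl]
  have "\<exists>!y. ?P y"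
    unfolding iff
    using semigroup_A_exists[OF assms(1), of x] by (metis rcoeff_eqI)
  then have "?P (semigroup_A t x)"
    unfolding semigroup_A_def by (rule theI')
  then show ?thesis
    unfolding iff using assms(2) by simp
qed

lemma bounded_linear_semigroup_A_aux:
  assumes "t \<ge> 0"
  shows "semigroup_A t (x + y) = semigroup_A t x + semigroup_A t y"
    and "semigroup_A t (c *\<^sub>R x) = c *\<^sub>R semigroup_A t x"
  by (rule rcoeff_eqI; simp add: rcoeff_semigroup_A assms rcoeff_add rcoeff_scaleR distrib_left)+

lemma semigroup_A_0: "semigroup_A 0 x = x"
  by (rule rcoeff_eqI) (simp add: rcoeff_semigroup_A)

lemma semigroup_A_add:
  "s \<ge> 0 \<Longrightarrow> t \<ge> 0 \<Longrightarrow> semigroup_A (s + t) x = semigroup_A s (semigroup_A t x)"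
  by (rule rcoeff_eqI) (simp add: rcoeff_semigroup_A algebra_simps flip: exp_add)

lemma abs_conv_semigroup_A:
  assumes "t > 0"
  shows "abs_conv (semigroup_A t x)"
  unfolding abs_conv_def
proof (rule summable_on_comparison_test)
  show "(\<lambda>k. exp (- eigenval k * t) * norm x) summable_on nz"
    by (intro summable_on_cmult_left summable_exp_eigenval assms)
qed (use assms in \<open>auto simp: rcoeff_semigroup_A abs_mult abs_rcoeff_le\<close>)

lemma abs_conv_semigroup_A':
  assumes "t \<ge> 0" "abs_conv x"
  shows "abs_conv (semigroup_A t x)"
  using assms abs_conv_semigroup_A[of t x] by (cases "t = 0") (auto simp: semigroup_A_0)

text \<open>Parseval is needed for the smoothed vector only; on the side of x, whose coefficients
  need not be absolutely summable, Bessel's inequality suffices.\<close>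

lemma norm_semigroup_A_le:
  assumes "t \<ge> 0"
  shows "norm (semigroup_A t x) \<le> exp (- 2 * t) * norm x"
proof (cases "t = 0")
  case False
  then have t: "t > 0" using assms by simp
  have "(norm (semigroup_A t x))\<^sup>2 \<le> (exp (- 2 * t) * norm x)\<^sup>2"
  proof (rule has_sum_le_finite_sums[OF abs_conv_parseval[OF abs_conv_semigroup_A[OF t]]])
    fix F :: "int set" assume F: "finite F" "F \<subseteq> nz"
    have "(\<Sum>k\<in>F. (rcoeff k (semigroup_A t x))\<^sup>2) \<le> (\<Sum>k\<in>F. (exp (- 2 * t))\<^sup>2 * (rcoeff k x)\<^sup>2)"
    proof (rule sum_mono)
      fix k assume "k \<in> F"
      then have k: "k \<noteq> 0" using F by auto
      have "exp (- eigenval k * t) \<le> exp (- 2 * t)"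
        using eigenval_ge_2[OF k] t by simp
      then show "(rcoeff k (semigroup_A t x))\<^sup>2 \<le> (exp (- 2 * t))\<^sup>2 * (rcoeff k x)\<^sup>2"
        unfolding rcoeff_semigroup_A[OF assms k] power_mult_distrib
        by (intro mult_right_mono power_mono) auto
    qed
    also have "\<dots> \<le> (exp (- 2 * t) * norm x)\<^sup>2"
      unfolding power_mult_distrib sum_distrib_left[symmetric]
      by (intro mult_left_mono bessel F) simp
    finally show "(\<Sum>k\<in>F. (rcoeff k (semigroup_A t x))\<^sup>2) \<le> (exp (- 2 * t) * norm x)\<^sup>2" .
  qed
  then show ?thesis by (rule power2_le_imp_le) simp
qed (simp add: semigroup_A_0)

lemma norm_semigroup_A_le_norm:
  assumes "t \<ge> 0"
  shows "norm (semigroup_A t x) \<le> norm x"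
proof -
  have "exp (- 2 * t) * norm x \<le> 1 * norm x"
    using assms by (intro mult_right_mono) auto
  with norm_semigroup_A_le[OF assms, of x] show ?thesis by simp
qed

lemma bounded_linear_semigroup_A: "t \<ge> 0 \<Longrightarrow> bounded_linear (semigroup_A t)"
  by (rule bounded_linear_intro[where K = 1])
     (simp_all add: bounded_linear_semigroup_A_aux norm_semigroup_A_le_norm)

text \<open>Both sides are expanded along u; v enters through its coefficients alone and may be any
  element of H, later \<open>nonlin (X s)\<close>.\<close>

lemma semigroup_A_self_adjoint:
  assumes "t \<ge> 0" "abs_conv u"
  shows "inner (semigroup_A t u) v = inner u (semigroup_A t v)"
proof -
  have "((\<lambda>k. inner v (rcoeff k (semigroup_A t u) *\<^sub>R real_basis k)) has_sum inner v (semigroup_A t u)) nz"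
    by (intro has_sum_bounded_linear[OF bounded_linear_inner_right] abs_conv_has_sum abs_conv_semigroup_A' assms)
  moreover have "((\<lambda>k. inner (semigroup_A t v) (rcoeff k u *\<^sub>R real_basis k)) has_sum inner (semigroup_A t v) u) nz"
    by (intro has_sum_bounded_linear[OF bounded_linear_inner_right] abs_conv_has_sum assms)
  moreover have "inner v (rcoeff k (semigroup_A t u) *\<^sub>R real_basis k) =
      inner (semigroup_A t v) (rcoeff k u *\<^sub>R real_basis k)" if "k \<in> nz" for k
    using that rcoeff_semigroup_A[OF assms(1), of k v] by (simp add: rcoeff_semigroup_A assms(1) flip: rcoeff_def)
  ultimately have "inner v (semigroup_A t u) = inner (semigroup_A t v) u"
    using has_sum_cong has_sum_unique by (metis (no_types, lifting))
  then show ?thesis by (simp add: inner_commute)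
qed

text \<open>Three-epsilon argument: on a finite partial sum v of u the semigroup is continuous mode
  by mode, and contractivity controls its action on u - v.\<close>

lemma semigroup_A_tendsto:
  assumes "abs_conv u"
  shows "((\<lambda>t. semigroup_A t u) \<longlongrightarrow> u) (at_right 0)"
proof (rule tendstoI)
  fix e :: real assume "e > 0"
  have "eventually (\<lambda>F. dist (\<Sum>k\<in>F. rcoeff k u *\<^sub>R real_basis k) u < e / 3) (finite_subsets_at_top nz)"
    using abs_conv_has_sum(1)[OF assms] \<open>e > 0\<close> unfolding has_sum_def by (intro tendstoD) auto
  then obtain F where F: "finite F" "F \<subseteq> nz" "dist (\<Sum>k\<in>F. rcoeff k u *\<^sub>R real_basis k) u < e / 3"
    unfolding eventually_finite_subsets_at_top by blast
  define v where "v = (\<Sum>k\<in>F. rcoeff k u *\<^sub>R real_basis k)"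
  have v: "semigroup_A t v = (\<Sum>k\<in>F. exp (- eigenval k * t) *\<^sub>R rcoeff k u *\<^sub>R real_basis k)" if "t \<ge> 0" for t
  proof (rule rcoeff_eqI)
    fix j :: int assume "j \<noteq> 0"
    have "rcoeff j (\<Sum>k\<in>F. c k *\<^sub>R real_basis k) = (\<Sum>k\<in>F. c k * (if k = j then 1 else 0))" for c
      unfolding bounded_linear.linear[OF bounded_linear_rcoeff, THEN linear_sum]
      using F(2) \<open>j \<noteq> 0\<close> by (intro sum.cong refl) (auto simp: rcoeff_scaleR rcoeff_real_basis)
    then have *: "rcoeff j (\<Sum>k\<in>F. c k *\<^sub>R real_basis k) = (if j \<in> F then c j else 0)" for c
      using F(1) by (simp add: if_distrib cong: if_cong)
    show "rcoeff j (semigroup_A t v) = rcoeff j (\<Sum>k\<in>F. exp (- eigenval k * t) *\<^sub>R rcoeff k u *\<^sub>R real_basis k)"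
      using *[of "\<lambda>k. rcoeff k u"] *[of "\<lambda>k. exp (- eigenval k * t) * rcoeff k u"]
      by (simp add: rcoeff_semigroup_A[OF that \<open>j \<noteq> 0\<close>] v_def)
  qed
  have "((\<lambda>t. \<Sum>k\<in>F. exp (- eigenval k * t) *\<^sub>R rcoeff k u *\<^sub>R real_basis k) \<longlongrightarrow>
      (\<Sum>k\<in>F. exp (- eigenval k * 0) *\<^sub>R rcoeff k u *\<^sub>R real_basis k)) (at_right 0)"
    by (intro tendsto_intros)
  then have "((\<lambda>t. \<Sum>k\<in>F. exp (- eigenval k * t) *\<^sub>R rcoeff k u *\<^sub>R real_basis k) \<longlongrightarrow> v) (at_right 0)"
    by (simp add: v_def)
  then have "eventually (\<lambda>t. dist (\<Sum>k\<in>F. exp (- eigenval k * t) *\<^sub>R rcoeff k u *\<^sub>R real_basis k) v < e / 3) (at_right 0)"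
    using \<open>e > 0\<close> by (intro tendstoD) auto
  moreover have "eventually (\<lambda>t::real. t > 0) (at_right 0)"
    by (rule eventually_at_right_less)
  ultimately show "eventually (\<lambda>t. dist (semigroup_A t u) u < e) (at_right 0)"
  proof eventually_elim
    case (elim t)
    have "semigroup_A t (u - v) = semigroup_A t u - semigroup_A t v"
      using elim by (intro linear_diff bounded_linear.linear bounded_linear_semigroup_A) simp
    then have "dist (semigroup_A t u) (semigroup_A t v) \<le> dist u v"
      using norm_semigroup_A_le_norm[of t "u - v"] elim by (simp add: dist_norm)
    moreover have "dist (semigroup_A t v) v < e / 3"
      using elim by (simp add: v)
    moreover have "dist v u < e / 3"
      using F(3) by (simp add: v_def)
    ultimately show ?case
      using dist_triangle[of "semigroup_A t u" u "semigroup_A t v"] dist_triangle[of "semigroup_A t v" u v]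
      by (simp add: dist_commute[of u v])
  qed
qed


section \<open>The space $V$\<close>

lemma abs_rcoeff_le_fourier_coeff: "k \<noteq> 0 \<Longrightarrow> \<bar>rcoeff k x\<bar> \<le> sqrt 2 * cmod (fourier_coeff x k)"
proof -
  assume "k \<noteq> 0"
  then consider "k > 0" | "k < 0" by linarith
  then show ?thesis
  proof cases
    case 1
    have "\<bar>rcoeff k x\<bar> \<le> cmod (Complex (rcoeff k x) (- rcoeff (- k) x))"
      using abs_Re_le_cmod[of "Complex (rcoeff k x) (- rcoeff (- k) x)"] by simp
    then show ?thesis using 1 by (simp add: fourier_coeff_pos norm_divide rcoeff_def)
  next
    case 2
    have "\<bar>rcoeff k x\<bar> \<le> cmod (Complex (rcoeff (- k) x) (rcoeff k x))"
      using abs_Im_le_cmod[of "Complex (rcoeff (- k) x) (rcoeff k x)"] by simp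
    then show ?thesis using 2 by (simp add: fourier_coeff_neg norm_divide rcoeff_def)
  qed
qed

lemma fourier_coeff_diff: "k \<noteq> 0 \<Longrightarrow> fourier_coeff (x - y) k = fourier_coeff x k - fourier_coeff y k"
proof -
  assume "k \<noteq> 0"
  then consider "k > 0" | "k < 0" by linarith
  then show ?thesis
    by cases (simp_all add: fourier_coeff_pos fourier_coeff_neg inner_diff_left complex_eq_iff diff_divide_distrib)
qed

lemma V_space_diff:
  assumes "x \<in> V_space" "y \<in> V_space"
  shows "x - y \<in> V_space"
  unfolding V_space_def mem_Collect_eq
proof (rule summable_on_comparison_test)
  show "(\<lambda>k. 2 * (eigenval k * (cmod (fourier_coeff x k))\<^sup>2 + eigenval k * (cmod (fourier_coeff y k))\<^sup>2)) summable_on nz"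
    using assms unfolding V_space_def by (intro summable_on_cmult_right summable_on_add) auto
  fix k :: int assume "k \<in> nz"
  then have k: "k \<noteq> 0" by simp
  have "(cmod (a - b))\<^sup>2 \<le> 2 * ((cmod a)\<^sup>2 + (cmod b)\<^sup>2)" for a b :: complex
  proof -
    have "(cmod (a - b))\<^sup>2 \<le> (cmod a + cmod b)\<^sup>2"
      by (intro power_mono norm_triangle_ineq4) simp
    also have "\<dots> \<le> 2 * ((cmod a)\<^sup>2 + (cmod b)\<^sup>2)"
      using sum_squares_bound[of "cmod a" "cmod b"] by (simp add: power2_sum)
    finally show ?thesis .
  qed
  from mult_left_mono[OF this[of "fourier_coeff x k" "fourier_coeff y k"], of "eigenval k"]
  show "eigenval k * (cmod (fourier_coeff (x - y) k))\<^sup>2 \<le>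
      2 * (eigenval k * (cmod (fourier_coeff x k))\<^sup>2 + eigenval k * (cmod (fourier_coeff y k))\<^sup>2)"
    using eigenval_ge_2[OF k] by (simp add: fourier_coeff_diff k algebra_simps)
  show "0 \<le> eigenval k * (cmod (fourier_coeff (x - y) k))\<^sup>2"
    using eigenval_ge_2[OF k] by simp
qed

text \<open>The one-dimensional Sobolev embedding: Cauchy-Schwarz with \<open>eigenval k\<close> to
  the powers -1/2 and 1/2, since the reciprocals of the eigenvalues are summable. It supplies the
  supremum bounds for the cubic term.\<close>

lemma wiener_norm_le_V_norm:
  obtains K where "K \<ge> 0" "\<And>x. x \<in> V_space \<Longrightarrow> abs_conv x \<and> wiener_norm x \<le> K * V_norm x"
proof
  define S where "S = (\<Sum>\<^sub>\<infinity>k\<in>nz. 1 / eigenval k)"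
  have sum_inv: "(\<lambda>k. 1 / eigenval k) summable_on nz"
  proof (rule summable_on_comparison_test[OF summable_int_powr[of 2]])
    fix k :: int assume "k \<in> nz"
    then have k: "k \<noteq> 0" by simp
    have "1 / eigenval k \<le> 1 / (real_of_int k)\<^sup>2"
    proof (intro divide_left_mono mult_pos_pos)
      show "(real_of_int k)\<^sup>2 \<le> eigenval k" "0 < eigenval k"
        using eigenval_ge[OF k] eigenval_ge_2[OF k] zero_le_power2[of "real_of_int k"] by linarith+
    qed (use k in auto)
    then show "1 / eigenval k \<le> real_of_int \<bar>k\<bar> powr - 2"
      using k by (simp add: powr_minus powr_numeral divide_simps)
    show "0 \<le> 1 / eigenval k" using eigenval_ge_2[OF k] by simp
  qed simp
  show "0 \<le> sqrt 2 * sqrt S"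
    using eigenval_ge_2 unfolding S_def by (intro mult_nonneg_nonneg) (auto intro!: infsum_nonneg divide_nonneg_nonneg simp: eigenval_def)
  fix x assume x: "x \<in> V_space"
  have fin: "(\<Sum>k\<in>F. \<bar>rcoeff k x\<bar>) \<le> sqrt 2 * sqrt S * V_norm x" if F: "finite F" "F \<subseteq> nz" for F
  proof -
    have nn: "0 \<le> eigenval k" for k by (simp add: eigenval_def)
    have pos: "0 < eigenval k" if "k \<in> F" for k
      using that F eigenval_ge_2[of k] by force
    have "(\<Sum>k\<in>F. cmod (fourier_coeff x k)) =
        (\<Sum>k\<in>F. sqrt (1 / eigenval k) * sqrt (eigenval k * (cmod (fourier_coeff x k))\<^sup>2))"
      using pos by (intro sum.cong refl) (simp add: real_sqrt_mult real_sqrt_divide less_imp_neq[symmetric])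
    also have "\<dots> \<le> (\<Sum>k\<in>F. \<bar>sqrt (1 / eigenval k)\<bar> * \<bar>sqrt (eigenval k * (cmod (fourier_coeff x k))\<^sup>2)\<bar>)"
      by (rule sum_mono) (metis abs_ge_self abs_mult)
    also have "\<dots> \<le> L2_set (\<lambda>k. sqrt (1 / eigenval k)) F * L2_set (\<lambda>k. sqrt (eigenval k * (cmod (fourier_coeff x k))\<^sup>2)) F"
      by (rule L2_set_mult_ineq)
    also have "\<dots> = sqrt (\<Sum>k\<in>F. 1 / eigenval k) * sqrt (\<Sum>k\<in>F. eigenval k * (cmod (fourier_coeff x k))\<^sup>2)"
      unfolding L2_set_def using nn by simp
    also have "\<dots> \<le> sqrt S * V_norm x"
    proof (intro mult_mono)
      show "sqrt (\<Sum>k\<in>F. 1 / eigenval k) \<le> sqrt S"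
        unfolding S_def real_sqrt_le_iff
        by (rule finite_sum_le_infsum[OF sum_inv F]) (simp add: nn)
      show "sqrt (\<Sum>k\<in>F. eigenval k * (cmod (fourier_coeff x k))\<^sup>2) \<le> V_norm x"
        unfolding V_norm_def real_sqrt_le_iff
        using x by (intro finite_sum_le_infsum F) (auto simp: V_space_def nn)
    qed (auto simp: S_def nn intro!: infsum_nonneg sum_nonneg)
    finally have "(\<Sum>k\<in>F. cmod (fourier_coeff x k)) \<le> sqrt S * V_norm x" .
    moreover have "(\<Sum>k\<in>F. \<bar>rcoeff k x\<bar>) \<le> (\<Sum>k\<in>F. sqrt 2 * cmod (fourier_coeff x k))"
      using F by (intro sum_mono abs_rcoeff_le_fourier_coeff) auto
    ultimately show ?thesis
      by (simp add: sum_distrib_left[symmetric] mult.assoc) (meson mult_left_mono order_trans real_sqrt_ge_zero zero_le_numeral)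
  qed
  have conv: "abs_conv x"
    unfolding abs_conv_def
    by (rule nonneg_bounded_partial_sums_imp_summable_on[OF _ eventually_finite_subsets_at_top_weakI[OF fin]]) auto
  moreover have "wiener_norm x \<le> sqrt 2 * sqrt S * V_norm x"
    unfolding wiener_norm_def using conv[unfolded abs_conv_def] fin by (rule infsum_le_finite_sums)
  ultimately show "abs_conv x \<and> wiener_norm x \<le> sqrt 2 * sqrt S * V_norm x" by blast
qed

section \<open>The nonlinearity\<close>

text \<open>A bound on the essential supremum, stated as a relation so that no value has to be
  assigned to unbounded elements.\<close>

definition sup_bound :: "H \<Rightarrow> real \<Rightarrow> bool" where
  "sup_bound x B \<longleftrightarrow> (AE \<xi> in torus. \<bar>rep_H x \<xi>\<bar> \<le> B)"

lemma sup_bound_mono: "sup_bound x A \<Longrightarrow> A \<le> B \<Longrightarrow> sup_bound x B"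
  unfolding sup_bound_def by (auto elim: eventually_mono)

lemma AE_abs_le_imp_nonneg:
  assumes "AE \<xi> in torus. \<bar>f \<xi> :: real\<bar> \<le> B"
  shows "0 \<le> B"
proof -
  have "AE \<xi> in torus. 0 \<le> B"
    using assms by eventually_elim linarith
  then show ?thesis by simp
qed

lemma sup_bound_nonneg: "sup_bound x B \<Longrightarrow> 0 \<le> B"
  unfolding sup_bound_def by (rule AE_abs_le_imp_nonneg)

lemma sup_bound_add: "sup_bound x A \<Longrightarrow> sup_bound y B \<Longrightarrow> sup_bound (x + y) (A + B)"
  unfolding sup_bound_def
proof -
  assume "AE \<xi> in torus. \<bar>rep_H x \<xi>\<bar> \<le> A" "AE \<xi> in torus. \<bar>rep_H y \<xi>\<bar> \<le> B"
  then show "AE \<xi> in torus. \<bar>rep_H (x + y) \<xi>\<bar> \<le> A + B"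
    using AE_rep_add[of x y] by eventually_elim linarith
qed

lemma norm_le_sup_bound: "sup_bound x B \<Longrightarrow> norm x \<le> B"
  using norm_H_le_AE sup_bound_nonneg unfolding sup_bound_def by blast

text \<open>Subtracting the mean m lowers the squared L2 norm by m^2, so the projection costs no
  factor.\<close>

lemma norm_proj_H_le:
  assumes f: "f \<in> borel_measurable torus" and B: "AE \<xi> in torus. \<bar>f \<xi>\<bar> \<le> B"
  shows "norm (proj_H f) \<le> B"
proof -
  have fL: "f \<in> L2_torus" by (rule L2_torus_bounded[OF f B])
  have B0: "0 \<le> B" by (rule AE_abs_le_imp_nonneg[OF B])
  define m where "m = (LINT \<xi>|torus. f \<xi>)"
  have fi: "integrable torus f" "integrable torus (\<lambda>\<xi>. f \<xi> * f \<xi>)"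
    using L2_torus_integrable[OF fL] L2_torus_integrable_mult[OF fL fL] by auto
  have "(norm (proj_H f))\<^sup>2 = (LINT \<xi>|torus. rep_H (proj_H f) \<xi> * f \<xi>)"
    unfolding power2_norm_eq_inner by (rule inner_proj_H[OF fL])
  also have "\<dots> = (LINT \<xi>|torus. f \<xi> * f \<xi> - m * f \<xi>)"
  proof (rule integral_cong_AE)
    show "AE \<xi> in torus. rep_H (proj_H f) \<xi> * f \<xi> = f \<xi> * f \<xi> - m * f \<xi>"
      using AE_rep_proj_H[OF fL] by eventually_elim (simp add: m_def left_diff_distrib)
  qed (use f in measurable)
  also have "\<dots> = (LINT \<xi>|torus. f \<xi> * f \<xi>) - m\<^sup>2"
    using fi by (simp add: m_def power2_eq_square)
  also have "\<dots> \<le> (LINT \<xi>|torus. f \<xi> * f \<xi>)" by simp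
  also have "\<dots> \<le> (LINT \<xi>|torus. B\<^sup>2)"
  proof (rule integral_mono_AE[OF fi(2)])
    show "AE \<xi> in torus. f \<xi> * f \<xi> \<le> B\<^sup>2"
      using B by eventually_elim (use abs_le_square_iff B0 in \<open>simp add: power2_eq_square[symmetric] abs_le_square_iff[symmetric]\<close>)
  qed simp
  also have "\<dots> = B\<^sup>2" by (simp add: torus.prob_space)
  finally show ?thesis using B0 by (rule power2_le_imp_le)
qed

lemma proj_H_diff:
  assumes f: "f \<in> L2_torus" and g: "g \<in> L2_torus"
  shows "proj_H f - proj_H g = proj_H (\<lambda>\<xi>. f \<xi> - g \<xi>)"
proof (rule rcoeff_eqI)
  fix k :: int
  have fg: "(\<lambda>\<xi>. f \<xi> - g \<xi>) \<in> L2_torus"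
    using L2_torus_add[OF f L2_torus_scale[OF g, of "-1"]] by simp
  show "rcoeff k (proj_H f - proj_H g) = rcoeff k (proj_H (\<lambda>\<xi>. f \<xi> - g \<xi>))"
    using L2_torus_integrable_mult[OF rep_H_L2 f, of "real_basis k"] L2_torus_integrable_mult[OF rep_H_L2 g, of "real_basis k"]
    unfolding rcoeff_diff unfolding rcoeff_def inner_commute[of _ "real_basis k"] inner_proj_H[OF f] inner_proj_H[OF g] inner_proj_H[OF fg]
    by (simp add: right_diff_distrib)
qed

lemma cubic_L2:
  assumes "sup_bound u B"
  shows "(\<lambda>\<xi>. - (rep_H u \<xi> - (rep_H u \<xi>) ^ 3)) \<in> L2_torus"
    and "AE \<xi> in torus. \<bar>- (rep_H u \<xi> - (rep_H u \<xi>) ^ 3)\<bar> \<le> B + B ^ 3"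
proof -
  show *: "AE \<xi> in torus. \<bar>- (rep_H u \<xi> - (rep_H u \<xi>) ^ 3)\<bar> \<le> B + B ^ 3"
    using assms unfolding sup_bound_def
  proof eventually_elim
    case (elim \<xi>)
    have "\<bar>rep_H u \<xi> ^ 3\<bar> \<le> B ^ 3"
      unfolding power_abs by (rule power_mono[OF elim]) simp
    then show ?case using elim by linarith
  qed
  show "(\<lambda>\<xi>. - (rep_H u \<xi> - (rep_H u \<xi>) ^ 3)) \<in> L2_torus"
    by (rule L2_torus_bounded[OF _ *]) measurable
qed

lemma norm_nonlin_le: "sup_bound u B \<Longrightarrow> norm (nonlin u) \<le> B + B ^ 3"
  unfolding nonlin_def by (rule norm_proj_H_le[OF _ cubic_L2(2)]) measurable

lemma norm_nonlin_diff_le: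
  assumes u: "sup_bound u B" and v: "sup_bound v B" and uv: "sup_bound (u - v) c"
  shows "norm (nonlin u - nonlin v) \<le> (1 + 3 * B\<^sup>2) * c"
  unfolding nonlin_def proj_H_diff[OF cubic_L2(1)[OF u] cubic_L2(1)[OF v]]
proof (rule norm_proj_H_le)
  show "AE \<xi> in torus. \<bar>- (rep_H u \<xi> - rep_H u \<xi> ^ 3) - - (rep_H v \<xi> - rep_H v \<xi> ^ 3)\<bar> \<le> (1 + 3 * B\<^sup>2) * c"
    using u v uv AE_rep_diff[of u v] unfolding sup_bound_def
  proof eventually_elim
    case (elim \<xi>)
    define a b where "a = rep_H u \<xi>" and "b = rep_H v \<xi>"
    have ab: "\<bar>a\<bar> \<le> B" "\<bar>b\<bar> \<le> B" "\<bar>a - b\<bar> \<le> c" "0 \<le> B"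
      using elim by (auto simp: a_def b_def)
    have "\<bar>a * a\<bar> \<le> B\<^sup>2" "\<bar>a * b\<bar> \<le> B\<^sup>2" "\<bar>b * b\<bar> \<le> B\<^sup>2"
      unfolding abs_mult power2_eq_square using ab by (intro mult_mono; simp)+
    then have "\<bar>a * a + a * b + b * b - 1\<bar> \<le> 1 + 3 * B\<^sup>2" by linarith
    \<comment> \<open>The difference of cubes splits off a - b; the other factor is at most 1 + 3
      B^2, which makes the nonlinearity Lipschitz on sets bounded in supremum norm.\<close>
    moreover have "- (a - a ^ 3) - - (b - b ^ 3) = (a * a + a * b + b * b - 1) * (a - b)"
      by (simp add: algebra_simps power3_eq_cube)
    ultimately show ?case
      unfolding a_def[symmetric] b_def[symmetric] using ab(3)
      by (simp only: abs_mult) (intro mult_mono; simp)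
  qed
qed measurable

text \<open>A negative value needs y and y + z of opposite signs; then 0 lies between them, so both
  have absolute value at most |z|.\<close>

lemma mult_cube_ge:
  fixes y z d :: real
  assumes "\<bar>z\<bar> \<le> d"
  shows "- (d ^ 4) \<le> y * (y + z) ^ 3"
proof (cases "y * (y + z) \<ge> 0")
  case True
  then have "0 \<le> y * (y + z) * (y + z)\<^sup>2" by simp
  also have "\<dots> = y * (y + z) ^ 3" by (simp add: power2_eq_square power3_eq_cube)
  finally have "0 \<le> y * (y + z) ^ 3" .
  moreover have "0 \<le> d ^ 4" by simp
  ultimately show ?thesis by linarith
next
  case False
  then have "\<bar>y\<bar> \<le> d" "\<bar>y + z\<bar> \<le> d"
    using assms by (auto simp: mult_less_0_iff not_le)
  then have "\<bar>y\<bar> * \<bar>y + z\<bar> ^ 3 \<le> d * d ^ 3"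
    by (intro mult_mono power_mono) auto
  then have "\<bar>y * (y + z) ^ 3\<bar> \<le> d ^ 4"
    by (simp add: abs_mult power_abs eval_nat_numeral)
  then show ?thesis by linarith
qed

text \<open>The pointwise bound integrated over mass 1. The bound B makes the cubic term square
  integrable and leaves no trace in the estimate, so that \<delta> alone governs the decay.\<close>

lemma inner_nonlin_ge:
  assumes x: "sup_bound (y + z) B" and z: "sup_bound z d"
  shows "- inner y (y + z) - d ^ 4 \<le> inner y (nonlin (y + z))"
proof -
  let ?x = "rep_H (y + z)"
  have "(\<lambda>\<xi>. ?x \<xi> ^ 3) \<in> L2_torus"
  proof (rule L2_torus_bounded[where B = "B ^ 3"])
    show "AE \<xi> in torus. \<bar>?x \<xi> ^ 3\<bar> \<le> B ^ 3"
      using x unfolding sup_bound_def by eventually_elim (simp add: power_abs power_mono)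
  qed measurable
  then have int: "integrable torus (\<lambda>\<xi>. rep_H y \<xi> * ?x \<xi> ^ 3)" "integrable torus (\<lambda>\<xi>. rep_H y \<xi> * ?x \<xi>)"
    by (auto intro: L2_torus_integrable_mult rep_H_L2)
  have "inner y (nonlin (y + z)) = (LINT \<xi>|torus. rep_H y \<xi> * - (?x \<xi> - ?x \<xi> ^ 3))"
    unfolding nonlin_def by (rule inner_proj_H[OF cubic_L2(1)[OF x]])
  also have "\<dots> = (LINT \<xi>|torus. rep_H y \<xi> * ?x \<xi> ^ 3) - inner y (y + z)"
    unfolding inner_H_eq using int by (simp add: algebra_simps)
  finally have eq: "inner y (nonlin (y + z)) = (LINT \<xi>|torus. rep_H y \<xi> * ?x \<xi> ^ 3) - inner y (y + z)" .
  have "(LINT \<xi>|torus. - (d ^ 4)) \<le> (LINT \<xi>|torus. rep_H y \<xi> * ?x \<xi> ^ 3)"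
  proof (rule integral_mono_AE[OF _ int(1)])
    show "AE \<xi> in torus. - (d ^ 4) \<le> rep_H y \<xi> * ?x \<xi> ^ 3"
      using z AE_rep_add[of y z] unfolding sup_bound_def
      by eventually_elim (simp add: mult_cube_ge)
  qed simp
  then show ?thesis
    by (simp add: eq torus.prob_space)
qed

section \<open>The stochastic convolution\<close>

lemma stieltjes_sum_bound:
  fixes \<phi> g :: "real \<Rightarrow> real"
  assumes "0 \<le> t" and p: "p tagged_division_of {0..t}"
    and mono: "\<And>u v. 0 \<le> u \<Longrightarrow> u \<le> v \<Longrightarrow> v \<le> t \<Longrightarrow> \<phi> u \<le> \<phi> v"
    and R: "\<And>u. 0 \<le> u \<Longrightarrow> u \<le> t \<Longrightarrow> \<bar>g u\<bar> \<le> R"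
    and \<phi>0: "0 \<le> \<phi> 0"
  shows "\<bar>\<Sum>(s, K)\<in>p. \<phi> s * (g (Sup K) - g (Inf K))\<bar> \<le> 2 * \<phi> t * R"
proof -
  \<comment> \<open>Each summand is an increment of \<open>\<phi> * g\<close> up to \<open>R\<close> times an increment of \<open>\<phi>\<close>, and both kinds
    of increments telescope.\<close>
  have local: "\<bar>\<phi> s * (g (Sup K) - g (Inf K)) - (\<phi> (Sup K) * g (Sup K) - \<phi> (Inf K) * g (Inf K))\<bar>
      \<le> R * (\<phi> (Sup K) - \<phi> (Inf K))" if "(s, K) \<in> p" for s K
  proof -
    from tagged_division_ofD(2-4)[OF p that] obtain c d where K: "s \<in> K" "K \<subseteq> {0..t}" "K = {c..d}"
      by auto
    then have cd: "0 \<le> c" "c \<le> s" "s \<le> d" "d \<le> t" and "Sup K = d" "Inf K = c" by auto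
    have "\<phi> s * (g d - g c) - (\<phi> d * g d - \<phi> c * g c) = (\<phi> s - \<phi> d) * g d + (\<phi> c - \<phi> s) * g c"
      by (simp add: algebra_simps)
    also have "\<bar>\<dots>\<bar> \<le> (\<phi> d - \<phi> s) * \<bar>g d\<bar> + (\<phi> s - \<phi> c) * \<bar>g c\<bar>"
      using mono[of s d] mono[of c s] cd by (intro order_trans[OF abs_triangle_ineq]) (simp add: abs_mult)
    also have "\<dots> \<le> (\<phi> d - \<phi> s) * R + (\<phi> s - \<phi> c) * R"
      using mono[of s d] mono[of c s] cd by (intro add_mono mult_left_mono R) auto
    finally show ?thesis
      unfolding \<open>Sup K = d\<close> \<open>Inf K = c\<close> by (simp add: algebra_simps)
  qed
  have "\<bar>(\<Sum>(s, K)\<in>p. \<phi> s * (g (Sup K) - g (Inf K))) - (\<phi> t * g t - \<phi> 0 * g 0)\<bar> =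
      \<bar>\<Sum>(s, K)\<in>p. \<phi> s * (g (Sup K) - g (Inf K)) - (\<phi> (Sup K) * g (Sup K) - \<phi> (Inf K) * g (Inf K))\<bar>"
    using additive_tagged_division_1[OF \<open>0 \<le> t\<close> p, of "\<lambda>s. \<phi> s * g s"]
    by (simp add: case_prod_beta' sum_subtractf)
  also have "\<dots> \<le> (\<Sum>(s, K)\<in>p. R * (\<phi> (Sup K) - \<phi> (Inf K)))"
    by (intro order_trans[OF sum_abs] sum_mono) (use local in auto)
  also have "\<dots> = R * (\<phi> t - \<phi> 0)"
    using additive_tagged_division_1[OF \<open>0 \<le> t\<close> p, of \<phi>]
    by (simp add: case_prod_beta' sum_distrib_left[symmetric])
  finally have "\<bar>(\<Sum>(s, K)\<in>p. \<phi> s * (g (Sup K) - g (Inf K))) - (\<phi> t * g t - \<phi> 0 * g 0)\<bar> \<le> R * (\<phi> t - \<phi> 0)" .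
  \<comment> \<open>The boundary terms give R (\<open>\<phi> t\<close> + \<open>\<phi> 0\<close>),
    the sum R (\<open>\<phi> t\<close> - \<open>\<phi> 0\<close>); \<open>\<phi> 0\<close>
    cancels.\<close>
  moreover have "\<bar>\<phi> t * g t\<bar> \<le> \<phi> t * R" "\<bar>\<phi> 0 * g 0\<bar> \<le> \<phi> 0 * R"
    using \<phi>0 mono[of 0 t] \<open>0 \<le> t\<close> by (auto simp: abs_mult intro!: mult_left_mono R)
  ultimately show ?thesis by (simp add: algebra_simps)
qed

text \<open>In mode k the weight exp (- \<open>eigenval k\<close> (t - s)) increases in s and equals
  1 at s = t. The bound on the Stieltjes sums is therefore the same for all eigenvalues and survives
  the limit.\<close>

lemma abs_rcoeff_stochastic_convolution_le:
  assumes Z: "has_stieltjes_integral (\<lambda>s. semigroup_A (t - s)) g Z 0 t"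
    and "0 \<le> t" "k \<noteq> 0" and R: "\<And>s. 0 \<le> s \<Longrightarrow> s \<le> t \<Longrightarrow> \<bar>rcoeff k (g s)\<bar> \<le> R"
  shows "\<bar>rcoeff k Z\<bar> \<le> 2 * R"
proof (rule tendsto_upperbound)
  show "((\<lambda>p. \<bar>rcoeff k (\<Sum>(s, K)\<in>p. semigroup_A (t - s) (g (Sup K) - g (Inf K)))\<bar>) \<longlongrightarrow> \<bar>rcoeff k Z\<bar>)
      (division_filter (cbox 0 t))"
    using Z unfolding has_stieltjes_integral_def
    by (intro tendsto_intros bounded_linear.tendsto[OF bounded_linear_rcoeff])
  show "\<forall>\<^sub>F p in division_filter (cbox 0 t).
      \<bar>rcoeff k (\<Sum>(s, K)\<in>p. semigroup_A (t - s) (g (Sup K) - g (Inf K)))\<bar> \<le> 2 * R"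
    using eventually_division_filter_tagged_division[of "cbox 0 t"]
  proof eventually_elim
    case (elim p)
    then have p: "p tagged_division_of {0..t}" by simp
    define \<phi> where "\<phi> s = exp (- eigenval k * (t - s))" for s
    have "rcoeff k (\<Sum>(s, K)\<in>p. semigroup_A (t - s) (g (Sup K) - g (Inf K))) =
        (\<Sum>(s, K)\<in>p. \<phi> s * (rcoeff k (g (Sup K)) - rcoeff k (g (Inf K))))"
      unfolding bounded_linear.linear[OF bounded_linear_rcoeff, THEN linear_sum]
    proof (intro sum.cong refl, safe)
      fix s K assume "(s, K) \<in> p"
      with tagged_division_ofD(2,3)[OF p this] have "s \<le> t" by auto
      then show "rcoeff k (semigroup_A (t - s) (g (Sup K) - g (Inf K))) =
          \<phi> s * (rcoeff k (g (Sup K)) - rcoeff k (g (Inf K)))"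
        using \<open>k \<noteq> 0\<close> by (simp add: rcoeff_semigroup_A \<phi>_def rcoeff_diff)
    qed
    moreover have "\<bar>\<Sum>(s, K)\<in>p. \<phi> s * (rcoeff k (g (Sup K)) - rcoeff k (g (Inf K)))\<bar> \<le> 2 * \<phi> t * R"
    proof (rule stieltjes_sum_bound[OF \<open>0 \<le> t\<close> p _ R])
      fix u v :: real assume "u \<le> v"
      then show "\<phi> u \<le> \<phi> v"
        unfolding \<phi>_def by (simp add: mult_left_mono eigenval_def)
    qed (auto simp: \<phi>_def)
    ultimately show ?case by (simp add: \<phi>_def)
  qed
qed (rule division_filter_not_empty)

section \<open>A one-sided Gronwall inequality\<close>

text \<open>Neither continuity nor differentiability of r is assumed: the right condition propagates
  the bound a little forwards, the left one excludes upward jumps, so the bound is inherited at a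
  limit from the left.\<close>

lemma gronwall_one_sided:
  fixes r :: "real \<Rightarrow> real"
  assumes r0: "\<And>t. 0 \<le> r t" and "a \<le> b" and "K \<ge> 0"
    and right: "\<And>t \<eta>. a \<le> t \<Longrightarrow> t < b \<Longrightarrow> \<eta> > 0 \<Longrightarrow>
      \<exists>h0>0. \<forall>h. 0 < h \<and> h < h0 \<longrightarrow> (r (t + h))\<^sup>2 \<le> (1 - h) * (r t)\<^sup>2 + h * (K + \<eta>)"
    and left: "\<And>t. a < t \<Longrightarrow> t \<le> b \<Longrightarrow>
      \<exists>B. \<exists>h0>0. \<forall>h. 0 < h \<and> h < h0 \<longrightarrow> r t \<le> r (t - h) + B * h"
  shows "(r b)\<^sup>2 \<le> K + (r a)\<^sup>2 * exp (- (b - a))"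
proof (rule field_le_epsilon)
  fix e :: real assume "e > 0"
  \<comment> \<open>Solution of g' = K + e - g; the slack e is the error that the right condition
    will be applied with.\<close>
  define g where "g t = K + e + (r a)\<^sup>2 * exp (- (t - a))" for t
  have g0: "0 \<le> g t" for t
    using \<open>K \<ge> 0\<close> \<open>e > 0\<close> by (simp add: g_def)
  have gc: "continuous_on UNIV g"
    unfolding g_def by (intro continuous_intros)
  have g_step: "(1 - h) * g t + h * (K + e) \<le> g (t + h)" for t h
  proof -
    have "1 - h \<le> exp (- h)" using exp_ge_add_one_self[of "- h"] by simp
    then have "(r a)\<^sup>2 * exp (- (t - a)) * (1 - h) \<le> (r a)\<^sup>2 * exp (- (t - a)) * exp (- h)"
      by (intro mult_left_mono) auto
    also have "\<dots> = (r a)\<^sup>2 * exp (- (t + h - a))"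
      by (simp add: exp_add[symmetric] algebra_simps)
    finally show ?thesis by (simp add: g_def algebra_simps)
  qed
  \<comment> \<open>The times up to which the bound has held throughout. It still holds at the
    supremum c by the left condition, and for c < b the right condition would carry it beyond
    c.\<close>
  define S where "S = {t\<in>{a..b}. \<forall>s\<in>{a..t}. (r s)\<^sup>2 \<le> g s}"
  have aS: "a \<in> S"
    using \<open>a \<le> b\<close> \<open>K \<ge> 0\<close> \<open>e > 0\<close> by (auto simp: S_def g_def)
  have bdd: "bdd_above S" by (rule bdd_aboveI[of _ b]) (auto simp: S_def)
  define c where "c = Sup S"
  have ac: "a \<le> c" unfolding c_def by (rule cSup_upper[OF aS bdd])
  have cb: "c \<le> b" unfolding c_def using aS by (intro cSup_least) (auto simp: S_def)
  have below: "(r s)\<^sup>2 \<le> g s" if "a \<le> s" "s < c" for s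
  proof -
    obtain t where "t \<in> S" "s < t"
      using \<open>s < c\<close> aS bdd unfolding c_def by (metis empty_iff less_cSup_iff)
    then show ?thesis using that by (auto simp: S_def)
  qed
  have at_c: "(r c)\<^sup>2 \<le> g c"
  proof (cases "a = c")
    case True
    then show ?thesis using aS by (auto simp: S_def)
  next
    case False
    then have "a < c" using ac by simp
    from left[OF this cb] obtain B h0 where h0: "h0 > 0"
      "\<And>h. 0 < h \<Longrightarrow> h < h0 \<Longrightarrow> r c \<le> r (c - h) + B * h" by blast
    have "((\<lambda>h. sqrt (g (c - h)) + B * h) \<longlongrightarrow> sqrt (g (c - 0)) + B * 0) (at_right 0)"
    proof (intro tendsto_intros)
      have "isCont g (c - 0)" using gc by (simp add: continuous_on_eq_continuous_at)
      then show "((\<lambda>h. g (c - h)) \<longlongrightarrow> g (c - 0)) (at_right 0)"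
        by (rule isCont_tendsto_compose) (intro tendsto_intros)
    qed
    moreover have "eventually (\<lambda>h. r c \<le> sqrt (g (c - h)) + B * h) (at_right 0)"
      unfolding eventually_at_right_field
    proof (intro exI[of _ "min h0 (c - a)"] conjI allI impI)
      fix h assume h: "0 < h" "h < min h0 (c - a)"
      have "r (c - h) \<le> sqrt (g (c - h))"
        using below[of "c - h"] h by (intro real_le_rsqrt) auto
      then show "r c \<le> sqrt (g (c - h)) + B * h"
        using h0(2)[of h] h by simp
    qed (use h0(1) \<open>a < c\<close> in auto)
    ultimately have "r c \<le> sqrt (g (c - 0)) + B * 0"
      by (intro tendsto_lowerbound) auto
    then have "(r c)\<^sup>2 \<le> (sqrt (g c))\<^sup>2"
      using r0 by (intro power_mono) auto
    then show ?thesis using g0 by simp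
  qed
  have "c = b"
  proof (rule ccontr)
    assume "c \<noteq> b"
    then have "c < b" using cb by simp
    from right[OF ac this \<open>e > 0\<close>] obtain h0 where h0: "h0 > 0"
      "\<And>h. 0 < h \<Longrightarrow> h < h0 \<Longrightarrow> (r (c + h))\<^sup>2 \<le> (1 - h) * (r c)\<^sup>2 + h * (K + e)" by blast
    \<comment> \<open>Half of h0 turns the strict condition h < h0 into one valid up to h = m; m at
      most 1 keeps the weight 1 - h nonnegative.\<close>
    define m where "m = min (min (h0 / 2) 1) (b - c)"
    have m: "0 < m" "m < h0" "m \<le> 1" "c + m \<le> b"
      using h0(1) \<open>c < b\<close> by (auto simp: m_def)
    have step: "(r (c + h))\<^sup>2 \<le> g (c + h)" if "0 < h" "h \<le> m" for h
    proof -
      have "(r (c + h))\<^sup>2 \<le> (1 - h) * (r c)\<^sup>2 + h * (K + e)"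
        using h0(2)[of h] that m by simp
      also have "\<dots> \<le> (1 - h) * g c + h * (K + e)"
        using at_c that m by (intro add_right_mono mult_left_mono) auto
      also have "\<dots> \<le> g (c + h)" by (rule g_step)
      finally show ?thesis .
    qed
    have "c + m \<in> S"
      unfolding S_def
    proof (intro CollectI conjI ballI)
      fix s assume s: "s \<in> {a..c + m}"
      then consider "s < c" | "s = c" | "s > c" by linarith
      then show "(r s)\<^sup>2 \<le> g s"
        by cases (use s below at_c step[of "s - c"] in auto)
    qed (use ac m in auto)
    then have "c + m \<le> c" unfolding c_def by (rule cSup_upper[OF _ bdd])
    then show False using m by simp
  qed
  then show "(r b)\<^sup>2 \<le> K + (r a)\<^sup>2 * exp (- (b - a)) + e"
    using at_c by (simp add: g_def)
qed

section \<open>Energy estimate along one path\<close>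

text \<open>A deterministic setting: one path with its drift integral D and stochastic convolution
  Z, the latter controlled up to the horizon T. Convergence to x at 0 is assumed separately because
  \<open>rcll_V\<close> concerns positive times only.\<close>

locale small_noise_path =
  fixes x :: H and X D Z :: "real \<Rightarrow> H" and \<delta> T :: real
  assumes has_integral_D: "\<And>t. 0 \<le> t \<Longrightarrow>
      ((\<lambda>s. semigroup_A (t - s) (nonlin (X s))) has_integral D t) {0..t}"
    and X_eq: "\<And>t. 0 \<le> t \<Longrightarrow> X t = semigroup_A t x - D t + Z t"
    and rcll_V: "rcll_V X"
    and X_0: "(X \<longlongrightarrow> x) (at_right 0)"
    and Z: "\<And>t. 0 \<le> t \<Longrightarrow> t < T \<Longrightarrow> abs_conv (Z t) \<and> sup_bound (Z t) \<delta>"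
    and \<delta>: "0 \<le> \<delta>" "\<delta> \<le> 1"
begin

definition Y :: "real \<Rightarrow> H" where "Y t = X t - Z t"

lemma Y_eq: "0 \<le> t \<Longrightarrow> Y t = semigroup_A t x - D t"
  by (simp add: Y_def X_eq)

lemma X_in_V: "0 < t \<Longrightarrow> X t \<in> V_space"
  using rcll_V by (simp add: rcll_V_def)

lemma V_sup_bound:
  obtains K where "K \<ge> 0" "\<And>u. u \<in> V_space \<Longrightarrow> abs_conv u \<and> sup_bound u (K * V_norm u)"
proof -
  obtain K where K: "K \<ge> 0" "\<And>u. u \<in> V_space \<Longrightarrow> abs_conv u \<and> wiener_norm u \<le> K * V_norm u"
    by (rule wiener_norm_le_V_norm) blast
  show ?thesis
  proof (rule that[of "sqrt 2 * K"])
    fix u assume u: "u \<in> V_space"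
    then have "sup_bound u (sqrt 2 * wiener_norm u)"
      using K(2) abs_conv_has_sum(2) unfolding sup_bound_def by blast
    then have "sup_bound u (sqrt 2 * K * V_norm u)"
      using K(2)[OF u] by (elim sup_bound_mono) (simp add: mult.assoc)
    then show "abs_conv u \<and> sup_bound u (sqrt 2 * K * V_norm u)"
      using K(2)[OF u] by simp
  qed (use K in simp)
qed

lemma abs_conv_Y: "0 < t \<Longrightarrow> t < T \<Longrightarrow> abs_conv (Y t)"
  unfolding Y_def using Z[of t] X_in_V[of t] V_sup_bound
  by (metis abs_conv_diff less_imp_le)

text \<open>Duhamel's formula is tested against a vector \<open>J\<close>: restricting an integral to a subinterval is
  available for Banach-valued integrands, and the completeness of \<^typ>\<open>H\<close> is not needed otherwise.\<close>

lemma duhamel: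
  assumes "0 \<le> t" "0 \<le> h"
  shows "((\<lambda>s. inner J (semigroup_A (t + h - s) (nonlin (X s)))) has_integral
    inner J (semigroup_A h (Y t) - Y (t + h))) {t..t + h}"
proof -
  let ?f = "\<lambda>s. inner J (semigroup_A (t + h - s) (nonlin (X s)))"
  have all: "(?f has_integral inner J (D (t + h))) {0..t + h}"
    using has_integral_linear[OF has_integral_D[of "t + h"] bounded_linear_inner_right[of J]] assms
    by (simp add: o_def)
  have 1: "((\<lambda>s. inner J (semigroup_A h (semigroup_A (t - s) (nonlin (X s))))) has_integral
      inner J (semigroup_A h (D t))) {0..t}"
    using has_integral_linear[OF has_integral_linear[OF has_integral_D[of t] bounded_linear_semigroup_A[of h]]
        bounded_linear_inner_right[of J]] assms
    by (simp add: o_def)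
  have 2: "semigroup_A h (semigroup_A (t - s) v) = semigroup_A (t + h - s) v" if "s \<in> {0..t}" for s v
    using semigroup_A_add[of h "t - s" v] that assms by (simp add: algebra_simps)
  have first: "(?f has_integral inner J (semigroup_A h (D t))) {0..t}"
    by (rule has_integral_eq[OF _ 1]) (simp add: 2)
  have "?f integrable_on {t..t + h}"
    by (rule integrable_subinterval_real[OF has_integral_integrable[OF all]]) (use assms in auto)
  then obtain j where j: "(?f has_integral j) {t..t + h}" by blast
  have "(?f has_integral (inner J (semigroup_A h (D t)) + j)) {0..t + h}"
    by (rule has_integral_combine[OF _ _ first j]) (use assms in auto)
  then have "inner J (semigroup_A h (D t)) + j = inner J (D (t + h))"
    using all by (rule has_integral_unique)
  moreover have "semigroup_A h (Y t) - Y (t + h) = D (t + h) - semigroup_A h (D t)"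
    using assms linear_diff[OF bounded_linear.linear[OF bounded_linear_semigroup_A[of h]]]
    by (simp add: Y_eq add.commute[of t] semigroup_A_add)
  ultimately have "j = inner J (semigroup_A h (Y t) - Y (t + h))"
    by (simp add: inner_diff_right)
  then show ?thesis using j by simp
qed

text \<open>Duality: J is taken to be the vector itself, and its norm is divided out.\<close>

lemma norm_duhamel_le:
  assumes "0 \<le> t" "0 \<le> h" "0 \<le> B" and B: "\<And>s. s \<in> {t..t + h} \<Longrightarrow> norm (nonlin (X s)) \<le> B"
  shows "norm (semigroup_A h (Y t) - Y (t + h)) \<le> B * h"
proof -
  let ?I = "semigroup_A h (Y t) - Y (t + h)"
  have "norm (inner ?I ?I) \<le> (norm ?I * B) * measure lborel (cbox t (t + h))"
  proof (rule has_integral_bound)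
    show "((\<lambda>s. inner ?I (semigroup_A (t + h - s) (nonlin (X s)))) has_integral inner ?I ?I) (cbox t (t + h))"
      using duhamel[OF assms(1,2), of ?I] by simp
    fix s assume "s \<in> cbox t (t + h)"
    then have s: "s \<in> {t..t + h}" by simp
    have "norm (inner ?I (semigroup_A (t + h - s) (nonlin (X s)))) \<le> norm ?I * norm (semigroup_A (t + h - s) (nonlin (X s)))"
      by (simp add: Cauchy_Schwarz_ineq2)
    also have "\<dots> \<le> norm ?I * B"
      using norm_semigroup_A_le_norm[of "t + h - s" "nonlin (X s)"] B[OF s] s
      by (intro mult_left_mono) auto
    finally show "norm (inner ?I (semigroup_A (t + h - s) (nonlin (X s)))) \<le> norm ?I * B" .
  qed (use assms in auto)
  then have "norm ?I * norm ?I \<le> norm ?I * (B * h)"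
    using assms by (simp add: norm_eq_sqrt_inner mult.assoc)
  then show ?thesis
    using assms(2,3) mult_le_cancel_left_pos[of "norm ?I" "norm ?I" "B * h"]
    by (cases "norm ?I = 0") simp_all
qed

section \<open>Local bounds along the path from its one-sided limits in V\<close>

lemma locally_bounded_right:
  assumes "0 < t"
  obtains B h0 where "h0 > 0" "\<And>s. t \<le> s \<Longrightarrow> s < t + h0 \<Longrightarrow> sup_bound (X s) B"
proof -
  obtain K where K: "K \<ge> 0" "\<And>u. u \<in> V_space \<Longrightarrow> abs_conv u \<and> sup_bound u (K * V_norm u)"
    by (rule V_sup_bound) blast
  have "((\<lambda>s. V_norm (X s - X t)) \<longlongrightarrow> 0) (at_right t)"
    using rcll_V assms by (simp add: rcll_V_def)
  then have "eventually (\<lambda>s. V_norm (X s - X t) < 1) (at_right t)"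
    by (rule order_tendstoD) simp
  then obtain u where u: "t < u" "\<And>s. t < s \<Longrightarrow> s < u \<Longrightarrow> V_norm (X s - X t) < 1"
    unfolding eventually_at_right_field by blast
  show ?thesis
  proof (rule that[of "u - t" "K + K * V_norm (X t)"])
    fix s assume s: "t \<le> s" "s < t + (u - t)"
    have t: "sup_bound (X t) (K * V_norm (X t))" using K(2)[OF X_in_V[OF assms]] by simp
    show "sup_bound (X s) (K + K * V_norm (X t))"
    proof (cases "s = t")
      case True
      then show ?thesis using K(1) by (intro sup_bound_mono[OF t[folded True]]) auto
    next
      case False
      then have "V_norm (X s - X t) < 1" using s u by auto
      moreover have "X s - X t \<in> V_space" using s assms by (intro V_space_diff X_in_V) auto
      ultimately have "sup_bound (X s - X t) K"
        using K(2) mult_left_mono[of "V_norm (X s - X t)" 1 K] K(1) by (intro sup_bound_mono[of _ "K * V_norm (X s - X t)" K]) simp_all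
      from sup_bound_add[OF this t] show ?thesis by simp
    qed
  qed (use u in simp)
qed

text \<open>The left limit y in V may differ from X t when the path jumps, so the constant has to
  cover both.\<close>

lemma locally_bounded_left:
  assumes "0 < t"
  obtains B h0 where "h0 > 0" "\<And>s. t - h0 < s \<Longrightarrow> s \<le> t \<Longrightarrow> sup_bound (X s) B"
proof -
  obtain K where K: "K \<ge> 0" "\<And>u. u \<in> V_space \<Longrightarrow> abs_conv u \<and> sup_bound u (K * V_norm u)"
    by (rule V_sup_bound) blast
  obtain y where y: "y \<in> V_space" "((\<lambda>s. V_norm (X s - y)) \<longlongrightarrow> 0) (at_left t)"
    using rcll_V assms unfolding rcll_V_def by blast
  then have "eventually (\<lambda>s. V_norm (X s - y) < 1) (at_left t)"
    by (intro order_tendstoD) auto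
  then obtain u where u: "u < t" "\<And>s. u < s \<Longrightarrow> s < t \<Longrightarrow> V_norm (X s - y) < 1"
    unfolding eventually_at_left_field by blast
  let ?B = "max (K + K * V_norm y) (K * V_norm (X t))"
  show ?thesis
  proof (rule that[of "min (t - u) t" ?B])
    \<comment> \<open>The minimum with t keeps s positive, where X s lies in V.\<close>
    fix s assume s: "t - min (t - u) t < s" "s \<le> t"
    show "sup_bound (X s) ?B"
    proof (cases "s = t")
      case True
      have "sup_bound (X t) (K * V_norm (X t))" using K(2)[OF X_in_V[OF assms]] by simp
      then show ?thesis unfolding True by (rule sup_bound_mono) simp
    next
      case False
      then have "V_norm (X s - y) < 1" using s u by auto
      moreover have "X s - y \<in> V_space" using s by (intro V_space_diff X_in_V y) auto
      ultimately have "sup_bound (X s - y) K"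
        using K(2) mult_left_mono[of "V_norm (X s - y)" 1 K] K(1) by (intro sup_bound_mono[of _ "K * V_norm (X s - y)" K]) simp_all
      from sup_bound_add[OF this K(2)[OF y(1), THEN conjunct2]] have "sup_bound (X s) (K + K * V_norm y)"
        by simp
      then show ?thesis by (rule sup_bound_mono) simp
    qed
  qed (use u assms in simp)
qed

lemma nonlin_tendsto_right:
  assumes "0 < t"
  shows "((\<lambda>s. nonlin (X s)) \<longlongrightarrow> nonlin (X t)) (at_right t)"
proof -
  obtain K where K: "K \<ge> 0" "\<And>u. u \<in> V_space \<Longrightarrow> abs_conv u \<and> sup_bound u (K * V_norm u)"
    by (rule V_sup_bound) blast
  obtain B h0 where B: "h0 > 0" "\<And>s. t \<le> s \<Longrightarrow> s < t + h0 \<Longrightarrow> sup_bound (X s) B"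
    by (rule locally_bounded_right[OF assms]) blast
  show ?thesis
  proof (rule Lim_null[THEN iffD2], rule Lim_null_comparison)
    show "eventually (\<lambda>s. norm (nonlin (X s) - nonlin (X t)) \<le> (1 + 3 * B\<^sup>2) * (K * V_norm (X s - X t))) (at_right t)"
      unfolding eventually_at_right_field
    proof (intro exI[of _ "t + h0"] conjI allI impI)
      fix s assume s: "t < s" "s < t + h0"
      then have "X s - X t \<in> V_space" using assms by (intro V_space_diff X_in_V) auto
      then show "norm (nonlin (X s) - nonlin (X t)) \<le> (1 + 3 * B\<^sup>2) * (K * V_norm (X s - X t))"
        using s B K by (intro norm_nonlin_diff_le) auto
    qed (use B in simp)
    have "((\<lambda>s. V_norm (X s - X t)) \<longlongrightarrow> 0) (at_right t)"
      using rcll_V assms by (simp add: rcll_V_def)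
    then have "((\<lambda>s. (1 + 3 * B\<^sup>2) * (K * V_norm (X s - X t))) \<longlongrightarrow> (1 + 3 * B\<^sup>2) * (K * 0)) (at_right t)"
      by (intro tendsto_intros)
    then show "((\<lambda>s. (1 + 3 * B\<^sup>2) * (K * V_norm (X s - X t))) \<longlongrightarrow> 0) (at_right t)"
      by simp
  qed
qed

section \<open>One-step inequalities for the norm of Y\<close>

text \<open>X may jump at t, but |Y| may not jump upwards: a Duhamel step from t - h to t is a
  contraction plus an integral of order h.\<close>

lemma norm_Y_left:
  assumes "0 < t"
  shows "\<exists>B. \<exists>h0>0. \<forall>h. 0 < h \<and> h < h0 \<longrightarrow> norm (Y t) \<le> norm (Y (t - h)) + B * h"
proof -
  obtain B h0 where B: "h0 > 0" "\<And>s. t - h0 < s \<Longrightarrow> s \<le> t \<Longrightarrow> sup_bound (X s) B"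
    by (rule locally_bounded_left[OF assms]) blast
  have "0 \<le> B" using sup_bound_nonneg[OF B(2)[of t]] B(1) by simp
  have "norm (Y t) \<le> norm (Y (t - h)) + (B + B ^ 3) * h" if h: "0 < h" "h < min h0 t" for h
  proof -
    have "norm (semigroup_A h (Y (t - h)) - Y (t - h + h)) \<le> (B + B ^ 3) * h"
      using h B(2) \<open>0 \<le> B\<close> by (intro norm_duhamel_le norm_nonlin_le) auto
    moreover have "norm (semigroup_A h (Y (t - h))) \<le> norm (Y (t - h))"
      using h by (intro norm_semigroup_A_le_norm) simp
    ultimately show ?thesis
      using norm_triangle_sub[of "Y t" "semigroup_A h (Y (t - h))"] by (simp add: norm_minus_commute)
  qed
  moreover have "min h0 t > 0" using B assms by simp
  ultimately show ?thesis by blast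
qed


text \<open>The energy inequality in difference form. With a the semigroup applied to Y t and I the
  Duhamel integral, |Y (t + h)|^2 = |a|^2 - 2 <a, I> + |I|^2: the first term decays at rate 4, <a,
  I> is at least h <Y t, nonlin (X t)> up to a small multiple of h, and the last term is of order
  h^2.\<close>

lemma norm_Y_right:
  assumes t: "0 < t" "t < T" and "\<eta> > 0"
  shows "\<exists>h0>0. \<forall>h. 0 < h \<and> h < h0 \<longrightarrow>
    (norm (Y (t + h)))\<^sup>2 \<le> (1 - h) * (norm (Y t))\<^sup>2 + h * (\<delta>\<^sup>2 + 2 * \<delta> ^ 4 + \<eta>)"
proof -
  define r where "r = norm (Y t)"
  obtain B h1 where B: "h1 > 0" "\<And>s. t \<le> s \<Longrightarrow> s < t + h1 \<Longrightarrow> sup_bound (X s) B"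
    by (rule locally_bounded_right[OF t(1)]) blast
  have B0: "0 \<le> B" using sup_bound_nonneg[OF B(2)[of t]] B(1) by simp
  define N where "N = B + B ^ 3"
  have N0: "0 \<le> N" using B0 by (simp add: N_def)
  have N: "norm (nonlin (X s)) \<le> N" if "t \<le> s" "s < t + h1" for s
    unfolding N_def by (rule norm_nonlin_le[OF B(2)[OF that]])
  \<comment> \<open>The cross term counts twice, so 2 \<epsilon> spends half of \<eta>; the other
    half pays for the terms quadratic in h.\<close>
  define \<epsilon> where "\<epsilon> = \<eta> / 4"
  have \<epsilon>: "\<epsilon> > 0" using \<open>\<eta> > 0\<close> by (simp add: \<epsilon>_def)
  have "eventually (\<lambda>u. dist (semigroup_A u (Y t)) (Y t) < \<epsilon> / (2 * (N + 1))) (at_right 0)"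
    using \<epsilon> N0 by (intro tendstoD[OF semigroup_A_tendsto[OF abs_conv_Y[OF t]]]) simp
  then obtain h2 where h2: "h2 > 0"
    "\<And>u. 0 < u \<Longrightarrow> u < h2 \<Longrightarrow> norm (semigroup_A u (Y t) - Y t) < \<epsilon> / (2 * (N + 1))"
    unfolding eventually_at_right_field dist_norm by blast
  have "eventually (\<lambda>s. dist (nonlin (X s)) (nonlin (X t)) < \<epsilon> / (2 * (r + 1))) (at_right t)"
    using \<epsilon> by (intro tendstoD[OF nonlin_tendsto_right[OF t(1)]]) (simp add: r_def add_nonneg_pos)
  then obtain h3 where h3: "h3 > t"
    "\<And>s. t < s \<Longrightarrow> s < h3 \<Longrightarrow> norm (nonlin (X s) - nonlin (X t)) < \<epsilon> / (2 * (r + 1))"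
    unfolding eventually_at_right_field dist_norm by blast
  \<comment> \<open>16 r^2 stems from the expansion of exp (- 4 h), N^2 from |I|^2; the 1 makes C
    positive.\<close>
  define C where "C = 16 * r\<^sup>2 + N\<^sup>2 + 1"
  have C: "C > 0" by (simp add: C_def add_nonneg_pos)
  \<comment> \<open>Half of h2, because the semigroup will act on Y t for times up to 2 h.\<close>
  define h0 where "h0 = min (min (min h1 (h2 / 2)) (h3 - t)) (\<eta> / (2 * C))"
  have "h0 > 0" using B(1) h2(1) h3(1) \<open>\<eta> > 0\<close> C by (simp add: h0_def)
  moreover have "(norm (Y (t + h)))\<^sup>2 \<le> (1 - h) * (norm (Y t))\<^sup>2 + h * (\<delta>\<^sup>2 + 2 * \<delta> ^ 4 + \<eta>)"
    if h: "0 < h" "h < h0" for h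
  proof -
    have hs: "h < h1" "2 * h < h2" "t + h < h3" "h < \<eta> / (2 * C)"
      using h by (auto simp: h0_def)
    define a where "a = semigroup_A h (Y t)"
    define I where "I = a - Y (t + h)"
    have I: "norm I \<le> N * h"
      unfolding I_def a_def using t h hs N N0 by (intro norm_duhamel_le) auto
    have a: "(norm a)\<^sup>2 \<le> (1 - 4 * h + 16 * h\<^sup>2) * r\<^sup>2"
    proof -
      have "norm a \<le> exp (- 2 * h) * r"
        unfolding a_def r_def using h by (intro norm_semigroup_A_le) simp
      then have "(norm a)\<^sup>2 \<le> (exp (- 2 * h) * r)\<^sup>2"
        by (intro power_mono) auto
      also have "\<dots> = exp (- (4 * h)) * r\<^sup>2"
        by (simp add: power_mult_distrib exp_double[symmetric])
      also have "exp (- (4 * h)) \<le> 1 - 4 * h + 16 * h\<^sup>2"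
      proof -
        \<comment> \<open>A second-order upper bound without Taylor expansion: exp (4 h) >= 1 + 4 h,
          and (1 + 4 h) (1 - 4 h + 16 h^2) = 1 + 64 h^3.\<close>
        have "exp (- (4 * h)) \<le> 1 / (1 + 4 * h)"
          using exp_ge_add_one_self[of "4 * h"] h by (simp add: exp_minus inverse_eq_divide frac_le)
        also have "\<dots> \<le> 1 - 4 * h + 16 * h\<^sup>2"
        proof -
          have "1 \<le> 1 + 64 * h ^ 3" using h by simp
          also have "\<dots> = (1 - 4 * h + 16 * h\<^sup>2) * (1 + 4 * h)"
            by (simp add: algebra_simps power2_eq_square power3_eq_cube)
          finally show ?thesis using h by (simp add: pos_divide_le_eq)
        qed
        finally show ?thesis .
      qed
      then have "exp (- (4 * h)) * r\<^sup>2 \<le> (1 - 4 * h + 16 * h\<^sup>2) * r\<^sup>2"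
        by (intro mult_right_mono) auto
      finally show ?thesis .
    qed
    \<comment> \<open>Self-adjointness moves the semigroup from the nonlinearity onto Y t, where
      \<open>semigroup_A_tendsto\<close> applies since Y t has an absolutely convergent expansion;
      \<open>nonlin (X s)\<close> then only has to be right continuous in H.\<close>
    have aI: "h * (inner (Y t) (nonlin (X t)) - \<epsilon>) \<le> inner a I"
    proof -
      have 1: "((\<lambda>s. inner a (semigroup_A (t + h - s) (nonlin (X s)))) has_integral inner a I) {t..t + h}"
        unfolding I_def a_def using t h by (intro duhamel) auto
      have 2: "((\<lambda>s. inner (Y t) (nonlin (X t)) - \<epsilon>) has_integral
          h * (inner (Y t) (nonlin (X t)) - \<epsilon>)) {t..t + h}"
        using has_integral_const_real[of "inner (Y t) (nonlin (X t)) - \<epsilon>" t "t + h"] h by simp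
      have 3: "inner (Y t) (nonlin (X t)) - \<epsilon> \<le> inner a (semigroup_A (t + h - s) (nonlin (X s)))"
        if s: "s \<in> {t..t + h}" for s
      proof -
        \<comment> \<open>Total smoothing time h + (t + h - s), between h and 2 h.\<close>
        define u where "u = 2 * h + t - s"
        have u: "0 < u" "u < h2" using s h hs by (auto simp: u_def)
        have "abs_conv a" unfolding a_def using h by (intro abs_conv_semigroup_A) simp
        then have "inner a (semigroup_A (t + h - s) (nonlin (X s))) =
            inner (semigroup_A (t + h - s) a) (nonlin (X s))"
          using s by (intro semigroup_A_self_adjoint[symmetric]) auto
        also have "semigroup_A (t + h - s) a = semigroup_A u (Y t)"
        proof -
          have "t + h - s + h = u" by (simp add: u_def)
          then show ?thesis
            unfolding a_def using semigroup_A_add[of "t + h - s" h "Y t"] s h by simp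
        qed
        finally have eq: "inner a (semigroup_A (t + h - s) (nonlin (X s))) = inner (semigroup_A u (Y t)) (nonlin (X s))" .
        have 1: "\<bar>inner (semigroup_A u (Y t) - Y t) (nonlin (X s))\<bar> \<le> \<epsilon> / 2"
        proof -
          have "\<bar>inner (semigroup_A u (Y t) - Y t) (nonlin (X s))\<bar> \<le>
              norm (semigroup_A u (Y t) - Y t) * norm (nonlin (X s))"
            by (rule Cauchy_Schwarz_ineq2)
          also have "\<dots> \<le> \<epsilon> / (2 * (N + 1)) * (N + 1)"
            using h2(2)[OF u] N[of s] s hs N0 \<epsilon> by (intro mult_mono) auto
          also have "\<dots> = \<epsilon> / 2" using N0 by (simp add: field_simps)
          finally show ?thesis .
        qed
        have 2: "\<bar>inner (Y t) (nonlin (X s) - nonlin (X t))\<bar> \<le> \<epsilon> / 2"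
        proof -
          have "\<bar>inner (Y t) (nonlin (X s) - nonlin (X t))\<bar> \<le> r * norm (nonlin (X s) - nonlin (X t))"
            unfolding r_def by (rule Cauchy_Schwarz_ineq2)
          also have "\<dots> \<le> (r + 1) * (\<epsilon> / (2 * (r + 1)))"
          proof (intro mult_mono)
            show "norm (nonlin (X s) - nonlin (X t)) \<le> \<epsilon> / (2 * (r + 1))"
              using h3(2)[of s] s hs \<epsilon> by (cases "s = t") (auto simp: r_def)
          qed (auto simp: r_def)
          also have "\<dots> = \<epsilon> / 2" by (simp add: field_simps r_def add_nonneg_eq_0_iff)
          finally show ?thesis .
        qed
        have "inner (semigroup_A u (Y t)) (nonlin (X s)) = inner (Y t) (nonlin (X t)) +
            inner (semigroup_A u (Y t) - Y t) (nonlin (X s)) + inner (Y t) (nonlin (X s) - nonlin (X t))"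
          by (simp add: inner_diff_left inner_diff_right)
        then show ?thesis
          using 1 2 unfolding eq by linarith
      qed
      show ?thesis by (rule has_integral_le[OF 2 1 3])
    qed
    \<comment> \<open>r^2 comes from the linear part of the nonlinearity, r^2 / 2 and \<delta>^2 / 2
      from Young's inequality for <Y t, Z t>, and \<delta>^4 from the cubic part. Doubling 3/2 and
      subtracting from 4 leaves the decay rate 1.\<close>
    have energy: "- inner (Y t) (nonlin (X t)) \<le> 3 / 2 * r\<^sup>2 + \<delta>\<^sup>2 / 2 + \<delta> ^ 4"
    proof -
      have X: "X t = Y t + Z t" by (simp add: Y_def)
      have Zt: "sup_bound (Z t) \<delta>" using Z t by simp
      have "- inner (Y t) (X t) - \<delta> ^ 4 \<le> inner (Y t) (nonlin (X t))"
        unfolding X by (rule inner_nonlin_ge[OF B(2)[of t, unfolded X] Zt]) (use B(1) in auto)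
      moreover have "inner (Y t) (X t) = r\<^sup>2 + inner (Y t) (Z t)"
        by (simp add: X inner_add_right r_def power2_norm_eq_inner)
      moreover have "inner (Y t) (Z t) \<le> r * \<delta>"
      proof -
        have "inner (Y t) (Z t) \<le> norm (Y t) * norm (Z t)" by (rule norm_cauchy_schwarz)
        also have "\<dots> \<le> r * \<delta>" unfolding r_def by (intro mult_left_mono norm_le_sup_bound Zt) simp
        finally show ?thesis .
      qed
      moreover have "r * \<delta> \<le> r\<^sup>2 / 2 + \<delta>\<^sup>2 / 2"
        using sum_squares_bound[of r \<delta>] by simp
      ultimately show ?thesis by linarith
    qed
    have "(norm (Y (t + h)))\<^sup>2 = (norm a)\<^sup>2 - 2 * inner a I + (norm I)\<^sup>2"
    proof -
      have "Y (t + h) = a - I" by (simp add: I_def)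
      then show ?thesis
        by (simp add: power2_norm_eq_inner inner_diff_left inner_diff_right inner_commute[of I a])
    qed
    moreover have "(norm I)\<^sup>2 \<le> h\<^sup>2 * N\<^sup>2"
      using power_mono[OF I, of 2] by (simp add: power_mult_distrib mult.commute)
    moreover have "- inner a I \<le> h * (3 / 2 * r\<^sup>2 + \<delta>\<^sup>2 / 2 + \<delta> ^ 4 + \<epsilon>)"
    proof -
      have "- inner a I \<le> h * (- inner (Y t) (nonlin (X t)) + \<epsilon>)"
        using aI by (simp add: algebra_simps)
      also have "\<dots> \<le> h * (3 / 2 * r\<^sup>2 + \<delta>\<^sup>2 / 2 + \<delta> ^ 4 + \<epsilon>)"
        using energy h by (intro mult_left_mono) auto
      finally show ?thesis .
    qed
    ultimately have "(norm (Y (t + h)))\<^sup>2 \<le> (1 - 4 * h + 16 * h\<^sup>2) * r\<^sup>2 +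
        2 * (h * (3 / 2 * r\<^sup>2 + \<delta>\<^sup>2 / 2 + \<delta> ^ 4 + \<epsilon>)) + h\<^sup>2 * N\<^sup>2"
      using a by linarith
    also have "\<dots> = (1 - h) * r\<^sup>2 + h * (\<delta>\<^sup>2 + 2 * \<delta> ^ 4 + \<eta> / 2) + h * (h * (16 * r\<^sup>2 + N\<^sup>2))"
      unfolding \<epsilon>_def by (simp add: algebra_simps power2_eq_square)
    also have "h * (16 * r\<^sup>2 + N\<^sup>2) \<le> \<eta> / 2"
    proof -
      have "h * (16 * r\<^sup>2 + N\<^sup>2) \<le> h * C" using h by (simp add: C_def)
      also have "\<dots> \<le> \<eta> / 2" using hs(4) C by (simp add: field_simps)
      finally show ?thesis .
    qed
    then have "h * (h * (16 * r\<^sup>2 + N\<^sup>2)) \<le> h * (\<eta> / 2)"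
      using h by (intro mult_left_mono) auto
    finally show ?thesis by (simp add: r_def algebra_simps)
  qed
  ultimately show ?thesis by blast
qed

text \<open>Gronwall starts at some \<tau> > 0, since x need not lie in V. Right continuity in H
  keeps |X \<tau>| below |x| + 1 and Z adds at most \<delta> <= 1, whence |x| + 2; \<tau> <= 1 gives
  exp (1 - t).\<close>

lemma norm_X_le:
  assumes t: "1 \<le> t" "t < T"
  shows "norm (X t) \<le> sqrt (3 * \<delta>\<^sup>2 + (norm x + 2)\<^sup>2 * exp (1 - t)) + \<delta>"
proof -
  have "eventually (\<lambda>s. dist (X s) x < 1) (at_right 0)"
    by (rule tendstoD[OF X_0]) simp
  then obtain h where h: "h > 0" "\<And>s. 0 < s \<Longrightarrow> s < h \<Longrightarrow> dist (X s) x < 1"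
    unfolding eventually_at_right_field by blast
  define \<tau> where "\<tau> = min (h / 2) 1"
  have \<tau>: "0 < \<tau>" "\<tau> < h" "\<tau> \<le> 1" using h(1) by (auto simp: \<tau>_def)
  have Z_le: "norm (Z s) \<le> \<delta>" if "0 \<le> s" "s < T" for s
    using Z[OF that] by (simp add: norm_le_sup_bound)
  have "norm (X \<tau>) \<le> norm x + 1"
    using h(2)[OF \<tau>(1,2)] norm_triangle_ineq2[of "X \<tau>" x] by (simp add: dist_norm)
  then have Y\<tau>: "norm (Y \<tau>) \<le> norm x + 2"
    using Z_le[of \<tau>] \<tau> t \<delta> norm_triangle_ineq4[of "X \<tau>" "Z \<tau>"] by (simp add: Y_def)
  have "(norm (Y t))\<^sup>2 \<le> (\<delta>\<^sup>2 + 2 * \<delta> ^ 4) + (norm (Y \<tau>))\<^sup>2 * exp (- (t - \<tau>))"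
  proof (rule gronwall_one_sided)
    fix s \<eta> :: real assume "\<tau> \<le> s" "s < t" "\<eta> > 0"
    then show "\<exists>h0>0. \<forall>h. 0 < h \<and> h < h0 \<longrightarrow>
        (norm (Y (s + h)))\<^sup>2 \<le> (1 - h) * (norm (Y s))\<^sup>2 + h * (\<delta>\<^sup>2 + 2 * \<delta> ^ 4 + \<eta>)"
      using \<tau> t by (intro norm_Y_right) auto
  next
    fix s assume "\<tau> < s"
    then show "\<exists>B. \<exists>h0>0. \<forall>h. 0 < h \<and> h < h0 \<longrightarrow> norm (Y s) \<le> norm (Y (s - h)) + B * h"
      using \<tau> by (intro norm_Y_left) auto
  qed (use \<tau> t in auto)
  also have "\<dots> \<le> 3 * \<delta>\<^sup>2 + (norm x + 2)\<^sup>2 * exp (1 - t)"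
  proof (intro add_mono mult_mono)
    have "\<delta> ^ 4 \<le> \<delta>\<^sup>2" using \<delta> by (intro power_decreasing) auto
    then show "\<delta>\<^sup>2 + 2 * \<delta> ^ 4 \<le> 3 * \<delta>\<^sup>2" by simp
  qed (use Y\<tau> \<tau> in \<open>auto intro!: power_mono\<close>)
  finally have "norm (Y t) \<le> sqrt (3 * \<delta>\<^sup>2 + (norm x + 2)\<^sup>2 * exp (1 - t))"
    by (rule real_le_rsqrt)
  moreover have "norm (X t) \<le> norm (Y t) + norm (Z t)"
    using norm_triangle_ineq[of "Y t" "Z t"] by (simp add: Y_def)
  ultimately show ?thesis
    using Z_le[of t] t by simp
qed

end

section \<open>Symmetric stable marginals\<close>

text \<open>The classical truncation inequality: the mean of 1 - cos (s x) over [0, u] is 1 - sin (u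
  x) / (u x), at least 1/2 once u |x| >= 2.\<close>

lemma nn_integral_one_minus_cos:
  assumes "u > 0"
  shows "ennreal (u / 2) * indicator {x. 2 / u \<le> \<bar>x\<bar>} x \<le>
    (\<integral>\<^sup>+s. ennreal (1 - cos (s * x)) * indicator {0..u} s \<partial>lborel)"
proof (cases "2 / u \<le> \<bar>x\<bar>")
  case True
  then have x0: "x \<noteq> 0" using assms by auto
  define F where "F s = s - sin (s * x) / x" for s
  have "((\<lambda>s. 1 - cos (s * x)) has_integral (F u - F 0)) {0..u}"
    unfolding F_def using assms x0
    by (intro fundamental_theorem_of_calculus)
       (auto intro!: derivative_eq_intros simp: field_simps simp flip: has_real_derivative_iff_has_vector_derivative)
  then have int: "((\<lambda>s. if s \<in> {0..u} then 1 - cos (s * x) else 0) has_integral (F u - F 0)) UNIV"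
    by (simp only: has_integral_restrict_UNIV)
  have "(\<integral>\<^sup>+s. ennreal (1 - cos (s * x)) * indicator {0..u} s \<partial>lborel) =
      (\<integral>\<^sup>+s. ennreal (if s \<in> {0..u} then 1 - cos (s * x) else 0) \<partial>lborel)"
    by (intro nn_integral_cong) (auto simp: indicator_def)
  also have "\<dots> = ennreal (F u - F 0)"
  proof (rule nn_integral_has_integral_lborel[OF _ _ int])
    show "(\<lambda>s. if s \<in> {0..u} then 1 - cos (s * x) else 0) \<in> borel_measurable borel"
      by measurable
  qed auto
  finally have eq: "(\<integral>\<^sup>+s. ennreal (1 - cos (s * x)) * indicator {0..u} s \<partial>lborel) = ennreal (F u - F 0)" .
  have "\<bar>sin (u * x) / x\<bar> \<le> 1 / \<bar>x\<bar>"
    using abs_sin_le_one[of "u * x"] by (simp add: divide_right_mono)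
  also have "\<dots> \<le> u / 2"
    using True assms x0 by (simp add: field_simps)
  finally have "\<bar>sin (u * x) / x\<bar> \<le> u / 2" .
  then have "u / 2 \<le> F u - F 0"
    using abs_ge_self[of "sin (u * x) / x"] unfolding F_def mult_zero_left sin_zero by linarith
  then show ?thesis
    using True by (simp add: eq ennreal_leI)
qed simp

text \<open>The truncation inequality is integrated over the law of X and the integrals are
  exchanged; the characteristic function gives 1 - exp (- c s^\<alpha>) <= c u^\<alpha>. With u = 2
  / v the threshold 2 / u is v.\<close>

lemma stable_tail:
  assumes "prob_space M" and X [measurable]: "X \<in> borel_measurable M"
    and char: "\<And>\<xi>. char (distr M borel X) \<xi> = of_real (exp (- c * \<bar>\<xi>\<bar> powr \<alpha>))"
    and "c \<ge> 0" "\<alpha> > 0" "v > 0"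
  shows "measure M {\<omega>\<in>space M. v \<le> \<bar>X \<omega>\<bar>} \<le> 2 * c * (2 / v) powr \<alpha>"
proof -
  interpret prob_space M by fact
  define u where "u = 2 / v"
  have u: "u > 0" using assms by (simp add: u_def)
  have cos_int: "integrable M (\<lambda>\<omega>. cos (s * X \<omega>))" for s
    by (rule integrable_const_bound[where B = 1]) auto
  have iexp: "integrable M (\<lambda>\<omega>. iexp (s * X \<omega>))" for s
    by (rule integrable_const_bound[where B = 1]) auto
  have E: "expectation (\<lambda>\<omega>. cos (s * X \<omega>)) = exp (- c * \<bar>s\<bar> powr \<alpha>)" for s
  proof -
    have "char (distr M borel X) s = expectation (\<lambda>\<omega>. iexp (s * X \<omega>))"
      unfolding char_def by (subst integral_distr) auto
    then have "expectation (\<lambda>\<omega>. iexp (s * X \<omega>)) = of_real (exp (- c * \<bar>s\<bar> powr \<alpha>))"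
      by (simp only: char)
    then have "Re (expectation (\<lambda>\<omega>. iexp (s * X \<omega>))) = exp (- c * \<bar>s\<bar> powr \<alpha>)"
      by (simp only: Re_complex_of_real)
    then show ?thesis
      using integral_Re[OF iexp[of s]] by (simp add: Re_exp)
  qed
  have bound: "(\<integral>\<^sup>+\<omega>. ennreal (1 - cos (s * X \<omega>)) \<partial>M) \<le> ennreal (c * u powr \<alpha>)" if "s \<in> {0..u}" for s
  proof -
    have "(\<integral>\<^sup>+\<omega>. ennreal (1 - cos (s * X \<omega>)) \<partial>M) = ennreal (expectation (\<lambda>\<omega>. 1 - cos (s * X \<omega>)))"
      by (intro nn_integral_eq_integral) (auto simp: cos_int)
    also have "expectation (\<lambda>\<omega>. 1 - cos (s * X \<omega>)) = 1 - exp (- c * \<bar>s\<bar> powr \<alpha>)"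
      using cos_int[of s] by (simp add: E prob_space)
    also have "\<dots> \<le> c * \<bar>s\<bar> powr \<alpha>"
      using exp_ge_add_one_self[of "- c * \<bar>s\<bar> powr \<alpha>"] by simp
    also have "\<dots> \<le> c * u powr \<alpha>"
      using that assms by (intro mult_left_mono powr_mono2) auto
    finally show ?thesis by (simp add: ennreal_leI)
  qed
  have "ennreal (u / 2) * emeasure M {\<omega>\<in>space M. v \<le> \<bar>X \<omega>\<bar>} =
      (\<integral>\<^sup>+\<omega>. ennreal (u / 2) * indicator {x. 2 / u \<le> \<bar>x\<bar>} (X \<omega>) \<partial>M)"
  proof -
    have "(\<integral>\<^sup>+\<omega>. indicator {x. 2 / u \<le> \<bar>x\<bar>} (X \<omega>) \<partial>M) = (\<integral>\<^sup>+\<omega>. indicator {\<omega>\<in>space M. v \<le> \<bar>X \<omega>\<bar>} \<omega> \<partial>M)"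
      by (intro nn_integral_cong) (auto simp: indicator_def u_def)
    then show ?thesis by (simp add: nn_integral_cmult)
  qed
  also have "\<dots> \<le> (\<integral>\<^sup>+\<omega>. (\<integral>\<^sup>+s. ennreal (1 - cos (s * X \<omega>)) * indicator {0..u} s \<partial>lborel) \<partial>M)"
    by (intro nn_integral_mono nn_integral_one_minus_cos u)
  also have "\<dots> = (\<integral>\<^sup>+s. (\<integral>\<^sup>+\<omega>. ennreal (1 - cos (s * X \<omega>)) * indicator {0..u} s \<partial>M) \<partial>lborel)"
  proof -
    interpret pair_sigma_finite M lborel ..
    have "(\<lambda>(\<omega>, s). ennreal (1 - cos (s * X \<omega>)) * indicator {0..u} s) \<in> borel_measurable (M \<Otimes>\<^sub>M lborel)"
      by measurable
    from Fubini'[OF this] show ?thesis by simp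
  qed
  also have "\<dots> = (\<integral>\<^sup>+s. (\<integral>\<^sup>+\<omega>. ennreal (1 - cos (s * X \<omega>)) \<partial>M) * indicator {0..u} s \<partial>lborel)"
    by (intro nn_integral_cong nn_integral_multc) simp
  also have "\<dots> \<le> (\<integral>\<^sup>+s. ennreal (c * u powr \<alpha>) * indicator {0..u} s \<partial>lborel)"
    using bound by (intro nn_integral_mono) (auto simp: indicator_def)
  also have "\<dots> = ennreal (c * u powr \<alpha>) * ennreal u"
    using u by (simp add: nn_integral_cmult)
  finally have "ennreal (u / 2 * prob {\<omega>\<in>space M. v \<le> \<bar>X \<omega>\<bar>}) \<le> ennreal (c * u powr \<alpha> * u)"
    using u assms by (simp only: emeasure_eq_measure ennreal_mult measure_nonneg divide_nonneg_pos
        mult_nonneg_nonneg powr_ge_zero less_imp_le zero_less_numeral)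
  then have "u / 2 * prob {\<omega>\<in>space M. v \<le> \<bar>X \<omega>\<bar>} \<le> c * u powr \<alpha> * u"
    using u assms by (subst (asm) ennreal_le_iff) auto
  then have "u * prob {\<omega>\<in>space M. v \<le> \<bar>X \<omega>\<bar>} \<le> u * (2 * c * u powr \<alpha>)"
    by (simp add: mult_ac)
  then have "prob {\<omega>\<in>space M. v \<le> \<bar>X \<omega>\<bar>} \<le> 2 * c * u powr \<alpha>"
    by (rule mult_left_le_imp_le[OF _ u])
  then show ?thesis by (simp only: u_def)
qed

text \<open>A real characteristic function is also that of - X, so the law is symmetric by Levy
  uniqueness; an atom at 0 counts for both halves.\<close>

lemma real_char_half:
  assumes "prob_space M" and X [measurable]: "X \<in> borel_measurable M"
    and char: "\<And>\<xi>. char (distr M borel X) \<xi> \<in> \<real>"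
  shows "1 / 2 \<le> measure M {\<omega>\<in>space M. 0 \<le> X \<omega>}" and "1 / 2 \<le> measure M {\<omega>\<in>space M. X \<omega> \<le> 0}"
proof -
  interpret prob_space M by fact
  have iexp: "integrable M (\<lambda>\<omega>. iexp (s * X \<omega>))" for s
    by (rule integrable_const_bound[where B = 1]) auto
  have "char (distr M borel (\<lambda>\<omega>. - X \<omega>)) s = cnj (char (distr M borel X) s)" for s
  proof -
    have "char (distr M borel (\<lambda>\<omega>. - X \<omega>)) s = expectation (\<lambda>\<omega>. cnj (iexp (s * X \<omega>)))"
      unfolding char_def by (subst integral_distr) (auto simp: exp_cnj)
    also have "\<dots> = cnj (expectation (\<lambda>\<omega>. iexp (s * X \<omega>)))"
      by simp
    also have "expectation (\<lambda>\<omega>. iexp (s * X \<omega>)) = char (distr M borel X) s"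
      unfolding char_def by (subst integral_distr) auto
    finally show ?thesis .
  qed
  then have "char (distr M borel (\<lambda>\<omega>. - X \<omega>)) = char (distr M borel X)"
    using char by (auto simp: fun_eq_iff Reals_cnj_iff)
  then have "distr M borel (\<lambda>\<omega>. - X \<omega>) = distr M borel X"
    by (intro Levy_uniqueness) auto
  then have "measure (distr M borel (\<lambda>\<omega>. - X \<omega>)) {0..} = measure (distr M borel X) {0..}"
    by simp
  then have eq: "prob {\<omega>\<in>space M. X \<omega> \<le> 0} = prob {\<omega>\<in>space M. 0 \<le> X \<omega>}"
    by (simp add: measure_distr vimage_def Int_def conj_commute)
  have "1 \<le> prob ({\<omega>\<in>space M. X \<omega> \<le> 0} \<union> {\<omega>\<in>space M. 0 \<le> X \<omega>})"
  proof -
    have "{\<omega>\<in>space M. X \<omega> \<le> 0} \<union> {\<omega>\<in>space M. 0 \<le> X \<omega>} = space M" by auto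
    then show ?thesis by (simp add: prob_space)
  qed
  also have "\<dots> \<le> prob {\<omega>\<in>space M. X \<omega> \<le> 0} + prob {\<omega>\<in>space M. 0 \<le> X \<omega>}"
    by (intro measure_Un_le) auto
  finally show "1 / 2 \<le> prob {\<omega>\<in>space M. 0 \<le> X \<omega>}" "1 / 2 \<le> prob {\<omega>\<in>space M. X \<omega> \<le> 0}"
    using eq by auto
qed

text \<open>By right continuity an excess at t persists on an interval to its right, which meets D;
  hence t strictly below T.\<close>

lemma abs_le_of_dense:
  fixes f :: "real \<Rightarrow> real"
  assumes f: "rcll f" and dense: "\<And>s s'. 0 \<le> s \<Longrightarrow> s < s' \<Longrightarrow> s' \<le> T \<Longrightarrow> \<exists>u\<in>D. s < u \<and> u < s'"
    and D: "\<And>u. u \<in> D \<Longrightarrow> \<bar>f u\<bar> \<le> r" and t: "0 \<le> t" "t < T"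
  shows "\<bar>f t\<bar> \<le> r"
proof (rule ccontr)
  assume "\<not> \<bar>f t\<bar> \<le> r"
  moreover have "((\<lambda>s. \<bar>f s\<bar>) \<longlongrightarrow> \<bar>f t\<bar>) (at_right t)"
    using f t unfolding rcll_def by (intro tendsto_intros) auto
  ultimately have "eventually (\<lambda>s. r < \<bar>f s\<bar>) (at_right t)"
    by (intro order_tendstoD) auto
  then obtain s' where s': "t < s'" "\<And>s. t < s \<Longrightarrow> s < s' \<Longrightarrow> r < \<bar>f s\<bar>"
    unfolding eventually_at_right_field by blast
  obtain u where "u \<in> D" "t < u" "u < min s' T"
    using dense[of t "min s' T"] t s'(1) by auto
  then show False using s'(2)[of u] D[of u] by auto
qed

section \<open>Sums of independent increments\<close>

lemma sets_Collect_ball_abs_le: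
  fixes f :: "'i \<Rightarrow> 'b \<Rightarrow> real"
  assumes "finite J" "\<And>i. i \<in> J \<Longrightarrow> f i \<in> borel_measurable N"
  shows "{x\<in>space N. \<forall>i\<in>J. \<bar>f i x\<bar> \<le> c} \<in> sets N"
  using assms by (intro sets.sets_Collect_finite_All borel_measurable_le borel_measurable_abs) auto

lemma sets_confined:
  fixes f :: "'b \<Rightarrow> nat \<Rightarrow> real"
  assumes "\<And>i. i \<le> n \<Longrightarrow> (\<lambda>x. \<Sum>k<i. f x k) \<in> borel_measurable N"
  shows "{x\<in>space N. (\<forall>i\<in>{..n}. \<bar>\<Sum>k<i. f x k\<bar> \<le> c) \<and> \<bar>\<Sum>k<n. f x k\<bar> \<le> d} \<in> sets N"
proof -
  have "{x\<in>space N. (\<forall>i\<in>{..n}. \<bar>\<Sum>k<i. f x k\<bar> \<le> c) \<and> \<bar>\<Sum>k<n. f x k\<bar> \<le> d} =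
      {x\<in>space N. \<forall>i\<in>{..n}. \<bar>\<Sum>k<i. f x k\<bar> \<le> c} \<inter> {x\<in>space N. \<forall>i\<in>{n}. \<bar>\<Sum>k<i. f x k\<bar> \<le> d}"
    by auto
  also have "\<dots> \<in> sets N"
    using assms by (intro sets.Int sets_Collect_ball_abs_le) auto
  finally show ?thesis .
qed

context prob_space
begin

lemma indep_vars_prob_split:
  assumes ind: "indep_vars (\<lambda>_. borel) \<xi> I" and AB: "A \<inter> B = {}" "A \<subseteq> I" "B \<subseteq> I"
    and P: "{x\<in>space (PiM A (\<lambda>_. borel)). P x} \<in> sets (PiM A (\<lambda>_. borel))"
    and Q: "{x\<in>space (PiM B (\<lambda>_. borel)). Q x} \<in> sets (PiM B (\<lambda>_. borel))"
  shows "prob {\<omega>\<in>space M. P (\<lambda>i\<in>A. \<xi> i \<omega>) \<and> Q (\<lambda>i\<in>B. \<xi> i \<omega>)} =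
    prob {\<omega>\<in>space M. P (\<lambda>i\<in>A. \<xi> i \<omega>)} * prob {\<omega>\<in>space M. Q (\<lambda>i\<in>B. \<xi> i \<omega>)}"
proof -
  let ?PA = "{x\<in>space (PiM A (\<lambda>_. borel)). P x}" and ?QB = "{x\<in>space (PiM B (\<lambda>_. borel)). Q x}"
  have 1: "{\<omega>\<in>space M. P (\<lambda>i\<in>A. \<xi> i \<omega>) \<and> Q (\<lambda>i\<in>B. \<xi> i \<omega>)} =
      (\<lambda>\<omega>. (\<lambda>i\<in>A. \<xi> i \<omega>, \<lambda>i\<in>B. \<xi> i \<omega>)) -` (?PA \<times> ?QB) \<inter> space M"
    and 2: "{\<omega>\<in>space M. P (\<lambda>i\<in>A. \<xi> i \<omega>)} = (\<lambda>\<omega>. \<lambda>i\<in>A. \<xi> i \<omega>) -` ?PA \<inter> space M"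
    and 3: "{\<omega>\<in>space M. Q (\<lambda>i\<in>B. \<xi> i \<omega>)} = (\<lambda>\<omega>. \<lambda>i\<in>B. \<xi> i \<omega>) -` ?QB \<inter> space M"
    by (auto simp: space_PiM)
  show ?thesis
    unfolding 1 2 3 by (rule indep_varD[OF indep_var_restrict[OF ind AB] P Q])
qed

text \<open>Decompose by the first index at which 2 u is exceeded. The remaining increment is
  independent of that event and at most u with probability at least 1/2, which leaves |S n| above
  u.\<close>

lemma ottaviani:
  fixes \<xi> :: "nat \<Rightarrow> 'a \<Rightarrow> real" and n :: nat
  defines "S \<equiv> \<lambda>i \<omega>. \<Sum>j<i. \<xi> j \<omega>"
  assumes ind: "indep_vars (\<lambda>_. borel) \<xi> {..<n}"
    and half: "\<And>i. i \<le> n \<Longrightarrow> prob {\<omega>\<in>space M. u < \<bar>S n \<omega> - S i \<omega>\<bar>} \<le> 1 / 2"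
  shows "prob {\<omega>\<in>space M. \<exists>i\<le>n. 2 * u < \<bar>S i \<omega>\<bar>} \<le> 2 * prob {\<omega>\<in>space M. u < \<bar>S n \<omega>\<bar>}"
proof -
  have \<xi> [measurable]: "random_variable borel (\<xi> j)" if "j < n" for j
    using ind that by (auto simp: indep_vars_def)
  have S [measurable]: "random_variable borel (S i)" if "i \<le> n" for i
    unfolding S_def using that by (intro borel_measurable_sum \<xi>) auto
  define A where "A i = {\<omega>\<in>space M. 2 * u < \<bar>S i \<omega>\<bar> \<and> (\<forall>j<i. \<bar>S j \<omega>\<bar> \<le> 2 * u)}" for i
  define B where "B i = {\<omega>\<in>space M. \<bar>S n \<omega> - S i \<omega>\<bar> \<le> u}" for i
  have A [measurable]: "A i \<in> events" if "i \<le> n" for i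
  proof -
    have S': "(\<lambda>\<omega>. \<bar>S j \<omega>\<bar>) \<in> borel_measurable M" if "j \<le> i" for j
      using S[of j] that \<open>i \<le> n\<close> by (intro borel_measurable_abs) simp
    have "A i = {\<omega>\<in>space M. 2 * u < \<bar>S i \<omega>\<bar>} \<inter> {\<omega>\<in>space M. \<forall>j\<in>{..<i}. \<bar>S j \<omega>\<bar> \<le> 2 * u}"
      by (auto simp: A_def)
    also have "\<dots> \<in> events"
      by (intro sets.Int sets.sets_Collect_finite_All borel_measurable_less borel_measurable_le S') auto
    finally show ?thesis .
  qed
  have B [measurable]: "B i \<in> events" if "i \<le> n" for i
    unfolding B_def using that S[OF that] S[of n] by measurable
  have AB: "prob (A i) \<le> 2 * prob (A i \<inter> B i)" if i: "i \<le> n" for i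
  proof -
    have "prob {\<omega>\<in>space M. (\<lambda>x. 2 * u < \<bar>\<Sum>k<i. x k\<bar> \<and> (\<forall>j<i. \<bar>\<Sum>k<j. x k\<bar> \<le> 2 * u)) (\<lambda>k\<in>{..<i}. \<xi> k \<omega>) \<and>
          (\<lambda>x. \<bar>\<Sum>k=i..<n. x k\<bar> \<le> u) (\<lambda>k\<in>{i..<n}. \<xi> k \<omega>)} =
        prob {\<omega>\<in>space M. (\<lambda>x. 2 * u < \<bar>\<Sum>k<i. x k\<bar> \<and> (\<forall>j<i. \<bar>\<Sum>k<j. x k\<bar> \<le> 2 * u)) (\<lambda>k\<in>{..<i}. \<xi> k \<omega>)} *
        prob {\<omega>\<in>space M. (\<lambda>x. \<bar>\<Sum>k=i..<n. x k\<bar> \<le> u) (\<lambda>k\<in>{i..<n}. \<xi> k \<omega>)}"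
    proof (rule indep_vars_prob_split[OF ind])
      have m: "(\<lambda>x. \<Sum>k<j. x k) \<in> borel_measurable (PiM {..<i} (\<lambda>_. borel :: real measure))" if "j \<le> i" for j
        using that by (intro borel_measurable_sum measurable_component_singleton) auto
      have "{x \<in> space (PiM {..<i} (\<lambda>_. borel)). 2 * u < \<bar>\<Sum>k<i. x k\<bar>} \<inter>
          {x \<in> space (PiM {..<i} (\<lambda>_. borel)). \<forall>j\<in>{..<i}. \<bar>\<Sum>k<j. x k\<bar> \<le> 2 * u} \<in> sets (PiM {..<i} (\<lambda>_. borel))"
        by (intro sets.Int sets.sets_Collect_finite_All borel_measurable_less borel_measurable_le borel_measurable_abs m) auto
      also have "{x \<in> space (PiM {..<i} (\<lambda>_. borel)). 2 * u < \<bar>\<Sum>k<i. x k\<bar>} \<inter>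
          {x \<in> space (PiM {..<i} (\<lambda>_. borel)). \<forall>j\<in>{..<i}. \<bar>\<Sum>k<j. x k\<bar> \<le> 2 * u} =
          {x \<in> space (PiM {..<i} (\<lambda>_. borel)). 2 * u < \<bar>\<Sum>k<i. x k\<bar> \<and> (\<forall>j<i. \<bar>\<Sum>k<j. x k\<bar> \<le> 2 * u)}"
        by auto
      finally show "\<dots> \<in> sets (PiM {..<i} (\<lambda>_. borel))" .
      show "{x \<in> space (PiM {i..<n} (\<lambda>_. borel)). \<bar>\<Sum>k=i..<n. x k\<bar> \<le> u} \<in> sets (PiM {i..<n} (\<lambda>_. borel))"
        by measurable
    qed (use i in auto)
    moreover have "S n \<omega> - S i \<omega> = (\<Sum>k=i..<n. \<xi> k \<omega>)" for \<omega>
      unfolding S_def using i by (simp add: sum_diff_nat_ivl lessThan_atLeast0)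
    ultimately have "prob (A i \<inter> B i) = prob (A i) * prob (B i)"
      by (simp add: A_def B_def S_def Int_def conj_ac cong: conj_cong)
    moreover have "1 / 2 \<le> prob (B i)"
    proof -
      have "prob (space M - B i) \<le> 1 / 2"
        using half[OF i] by (simp add: B_def set_diff_eq not_le cong: conj_cong)
      then show ?thesis using prob_compl[OF B[OF i]] by simp
    qed
    ultimately show ?thesis
      using mult_left_mono[of "1 / 2" "prob (B i)" "prob (A i)"] by simp
  qed
  have disj: "disjoint_family_on A {..n}"
    unfolding disjoint_family_on_def
  proof safe
    fix i j \<omega> assume "i \<noteq> j" "\<omega> \<in> A i" "\<omega> \<in> A j"
    then show "\<omega> \<in> {}" unfolding A_def by (cases i j rule: linorder_cases) force+
  qed
  have "{\<omega>\<in>space M. \<exists>i\<le>n. 2 * u < \<bar>S i \<omega>\<bar>} = (\<Union>i\<in>{..n}. A i)"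
  proof safe
    fix \<omega> i assume \<omega>: "\<omega> \<in> space M" "i \<le> n" "2 * u < \<bar>S i \<omega>\<bar>"
    define m where "m = (LEAST i. 2 * u < \<bar>S i \<omega>\<bar>)"
    have "2 * u < \<bar>S m \<omega>\<bar>" unfolding m_def using \<omega>(3) by (rule LeastI)
    moreover have "m \<le> n" using \<omega>(2,3) unfolding m_def by (meson Least_le order_trans)
    moreover have "\<bar>S j \<omega>\<bar> \<le> 2 * u" if "j < m" for j
      using not_less_Least[OF that[unfolded m_def]] by simp
    ultimately show "\<omega> \<in> (\<Union>i\<in>{..n}. A i)" using \<omega>(1) by (auto simp: A_def)
  qed (auto simp: A_def)
  moreover have "A ` {..n} \<subseteq> events" using A by blast
  ultimately have "prob {\<omega>\<in>space M. \<exists>i\<le>n. 2 * u < \<bar>S i \<omega>\<bar>} = (\<Sum>i\<le>n. prob (A i))"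
    using finite_measure_finite_Union[OF _ _ disj] by simp
  also have "\<dots> \<le> (\<Sum>i\<le>n. 2 * prob (A i \<inter> B i))"
    by (intro sum_mono AB) simp
  also have "\<dots> = 2 * prob (\<Union>i\<in>{..n}. A i \<inter> B i)"
  proof -
    have "disjoint_family_on (\<lambda>i. A i \<inter> B i) {..n}"
      using disj by (auto simp: disjoint_family_on_def)
    moreover have "(\<lambda>i. A i \<inter> B i) ` {..n} \<subseteq> events" using A B by blast
    ultimately have "prob (\<Union>i\<in>{..n}. A i \<inter> B i) = (\<Sum>i\<le>n. prob (A i \<inter> B i))"
      by (intro finite_measure_finite_Union) auto
    then show ?thesis by (simp add: sum_distrib_left)
  qed
  also have "prob (\<Union>i\<in>{..n}. A i \<inter> B i) \<le> prob {\<omega>\<in>space M. u < \<bar>S n \<omega>\<bar>}"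
  proof (rule finite_measure_mono)
    show "(\<Union>i\<in>{..n}. A i \<inter> B i) \<subseteq> {\<omega>\<in>space M. u < \<bar>S n \<omega>\<bar>}"
    proof safe
      fix \<omega> i assume "\<omega> \<in> A i" "\<omega> \<in> B i"
      then show "\<omega> \<in> space M" "u < \<bar>S n \<omega>\<bar>"
        unfolding A_def B_def mem_Collect_eq by (blast, linarith)
    qed
    show "{\<omega>\<in>space M. u < \<bar>S n \<omega>\<bar>} \<in> events" using S[of n] by measurable
  qed
  finally show ?thesis by simp
qed


lemma prob_Int_ge:
  assumes [measurable]: "A \<in> events" "B \<in> events"
  shows "prob A + prob B - 1 \<le> prob (A \<inter> B)"
proof -
  have "prob (A \<union> B) = prob A + prob B - prob (A \<inter> B)"
    by (rule measure_Un3) (auto simp: fmeasurable_eq_sets)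
  with prob_le_1[of "A \<union> B"] show ?thesis by linarith
qed

text \<open>A random walk stays in a strip with probability at least $4^{-m}$ after \<open>m\<close> blocks: oscillations
  within a block are small, and the increment over each block is required to point back to the
  origin.\<close>

lemma confinement:
  fixes \<xi> :: "nat \<Rightarrow> 'a \<Rightarrow> real" and q m :: nat
  assumes ind: "indep_vars (\<lambda>_. borel) \<xi> {..<m * q}" and "u \<ge> 0"
    and osc: "\<And>b. b < m \<Longrightarrow> 3 / 4 \<le> prob {\<omega>\<in>space M. \<forall>i\<in>{..q}. \<bar>\<Sum>k=b * q..<b * q + i. \<xi> k \<omega>\<bar> \<le> u}"
    and nonneg: "\<And>b. b < m \<Longrightarrow> 1 / 2 \<le> prob {\<omega>\<in>space M. 0 \<le> (\<Sum>k=b * q..<b * q + q. \<xi> k \<omega>)}"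
    and nonpos: "\<And>b. b < m \<Longrightarrow> 1 / 2 \<le> prob {\<omega>\<in>space M. (\<Sum>k=b * q..<b * q + q. \<xi> k \<omega>) \<le> 0}"
    and "b \<le> m"
  shows "(1 / 4) ^ b \<le> prob {\<omega>\<in>space M. (\<forall>i\<in>{..b * q}. \<bar>\<Sum>k<i. \<xi> k \<omega>\<bar> \<le> 2 * u) \<and> \<bar>\<Sum>k<b * q. \<xi> k \<omega>\<bar> \<le> u}"
  using \<open>b \<le> m\<close>
proof (induction b)
  case 0
  then show ?case using \<open>u \<ge> 0\<close> by (simp add: prob_space)
next
  case (Suc b)
  then have b: "b < m" by simp
  let ?A = "{..<b * q}" and ?B = "{b * q..<b * q + q}"
  let ?G = "\<lambda>x :: nat \<Rightarrow> real. (\<forall>i\<in>{..b * q}. \<bar>\<Sum>k<i. x k\<bar> \<le> 2 * u) \<and> \<bar>\<Sum>k<b * q. x k\<bar> \<le> u"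
  let ?O = "\<lambda>x :: nat \<Rightarrow> real. \<forall>i\<in>{..q}. \<bar>\<Sum>k=b * q..<b * q + i. x k\<bar> \<le> u"
  let ?D = "\<lambda>x :: nat \<Rightarrow> real. \<Sum>k<b * q. x k"
  let ?E = "\<lambda>x :: nat \<Rightarrow> real. \<Sum>k=b * q..<b * q + q. x k"
  have "Suc b * q \<le> m * q"
    using Suc.prems by (rule mult_le_mono1)
  then have le: "b * q + q \<le> m * q" by simp
  have sub: "?A \<subseteq> {..<m * q}" "?B \<subseteq> {..<m * q}"
    by (rule subsetI; use le in \<open>simp only: lessThan_iff atLeastLessThan_iff; linarith\<close>)+
  have \<xi>: "random_variable borel (\<xi> j)" if "j < m * q" for j
    using ind that by (auto simp: indep_vars_def)
  have Am: "(\<lambda>x. \<Sum>k<i. x k) \<in> borel_measurable (PiM ?A (\<lambda>_. borel :: real measure))" if "i \<in> {..b * q}" for i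
    using that by (intro borel_measurable_sum measurable_component_singleton) auto
  have Bm: "(\<lambda>x. \<Sum>k=b * q..<b * q + i. x k) \<in> borel_measurable (PiM ?B (\<lambda>_. borel :: real measure))" if "i \<in> {..q}" for i
    using that by (intro borel_measurable_sum measurable_component_singleton) auto
  have Mm: "(\<lambda>\<omega>. \<Sum>k\<in>J. \<xi> k \<omega>) \<in> borel_measurable M" if "J \<subseteq> {..<m * q}" for J
    using that by (intro borel_measurable_sum \<xi>) auto
  have resA: "(\<Sum>k<i. (\<lambda>k\<in>?A. \<xi> k \<omega>) k) = (\<Sum>k<i. \<xi> k \<omega>)" if "i \<le> b * q" for i \<omega>
    using that by (intro sum.cong) auto
  have resB: "(\<Sum>k=b * q..<b * q + i. (\<lambda>k\<in>?B. \<xi> k \<omega>) k) = (\<Sum>k=b * q..<b * q + i. \<xi> k \<omega>)" if "i \<le> q" for i \<omega>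
    using that by (intro sum.cong) auto
  have GA: "{x\<in>space (PiM ?A (\<lambda>_. borel)). ?G x} \<in> sets (PiM ?A (\<lambda>_. borel))"
    by (rule sets_confined) (use Am in auto)
  have OB: "{x\<in>space (PiM ?B (\<lambda>_. borel)). ?O x} \<in> sets (PiM ?B (\<lambda>_. borel))"
    by (rule sets_Collect_ball_abs_le) (use Bm in auto)
  have G_ev: "{\<omega>\<in>space M. ?G (\<lambda>k. \<xi> k \<omega>)} \<in> events"
  proof (intro sets_confined Mm)
    fix i assume "i \<le> b * q"
    then have "i \<le> m * q" using le by linarith
    then show "{..<i} \<subseteq> {..<m * q}" by auto
  qed
  have O_ev: "{\<omega>\<in>space M. ?O (\<lambda>k. \<xi> k \<omega>)} \<in> events"
  proof (intro sets_Collect_ball_abs_le Mm)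
    fix i assume "i \<in> {..q}"
    then have "b * q + i \<le> m * q" using le by simp
    then show "{b * q..<b * q + i} \<subseteq> {..<m * q}" by auto
  qed simp
  have D_meas: "(\<lambda>\<omega>. ?D (\<lambda>k. \<xi> k \<omega>)) \<in> borel_measurable M"
    and E_meas: "(\<lambda>\<omega>. ?E (\<lambda>k. \<xi> k \<omega>)) \<in> borel_measurable M"
    using sub by (auto intro!: Mm)
  have step: "prob {\<omega>\<in>space M. ?G (\<lambda>k. \<xi> k \<omega>) \<and> P (?D (\<lambda>k. \<xi> k \<omega>))} * (1 / 4) \<le>
      prob {\<omega>\<in>space M. (?G (\<lambda>k. \<xi> k \<omega>) \<and> P (?D (\<lambda>k. \<xi> k \<omega>))) \<and> (?O (\<lambda>k. \<xi> k \<omega>) \<and> Q (?E (\<lambda>k. \<xi> k \<omega>)))}"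
    if P: "{y. P y} \<in> sets borel" and Q: "{y. Q y} \<in> sets borel"
      and half: "1 / 2 \<le> prob {\<omega>\<in>space M. Q (?E (\<lambda>k. \<xi> k \<omega>))}" for P Q
  proof -
    have "prob {\<omega>\<in>space M. (?G (\<lambda>k\<in>?A. \<xi> k \<omega>) \<and> P (?D (\<lambda>k\<in>?A. \<xi> k \<omega>))) \<and>
          (?O (\<lambda>k\<in>?B. \<xi> k \<omega>) \<and> Q (?E (\<lambda>k\<in>?B. \<xi> k \<omega>)))} =
        prob {\<omega>\<in>space M. ?G (\<lambda>k\<in>?A. \<xi> k \<omega>) \<and> P (?D (\<lambda>k\<in>?A. \<xi> k \<omega>))} *
        prob {\<omega>\<in>space M. ?O (\<lambda>k\<in>?B. \<xi> k \<omega>) \<and> Q (?E (\<lambda>k\<in>?B. \<xi> k \<omega>))}"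
    proof (rule indep_vars_prob_split[OF ind _ sub(1,2), where P = "\<lambda>x. ?G x \<and> P (?D x)" and Q = "\<lambda>x. ?O x \<and> Q (?E x)"])
      have "{x\<in>space (PiM ?A (\<lambda>_. borel)). P (?D x)} \<in> sets (PiM ?A (\<lambda>_. borel))"
        using measurable_sets[OF Am[of "b * q"] P] by (simp add: vimage_def Int_def conj_commute)
      from sets.Int[OF GA this]
      show "{x\<in>space (PiM ?A (\<lambda>_. borel)). ?G x \<and> P (?D x)} \<in> sets (PiM ?A (\<lambda>_. borel))"
        by (rule back_subst[of "\<lambda>S. S \<in> _"]) blast
      have "{x\<in>space (PiM ?B (\<lambda>_. borel)). Q (?E x)} \<in> sets (PiM ?B (\<lambda>_. borel))"
        using measurable_sets[OF Bm[of q] Q] by (simp add: vimage_def Int_def conj_commute)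
      from sets.Int[OF OB this]
      show "{x\<in>space (PiM ?B (\<lambda>_. borel)). ?O x \<and> Q (?E x)} \<in> sets (PiM ?B (\<lambda>_. borel))"
        by (rule back_subst[of "\<lambda>S. S \<in> _"]) blast
    qed auto
    moreover have "?G (\<lambda>k\<in>?A. \<xi> k \<omega>) \<longleftrightarrow> ?G (\<lambda>k. \<xi> k \<omega>)" for \<omega>
      using resA[of _ \<omega>] by auto
    moreover have "?O (\<lambda>k\<in>?B. \<xi> k \<omega>) \<longleftrightarrow> ?O (\<lambda>k. \<xi> k \<omega>)" for \<omega>
      using resB[of _ \<omega>] by auto
    moreover have "?D (\<lambda>k\<in>?A. \<xi> k \<omega>) = ?D (\<lambda>k. \<xi> k \<omega>)" "?E (\<lambda>k\<in>?B. \<xi> k \<omega>) = ?E (\<lambda>k. \<xi> k \<omega>)" for \<omega>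
      using resA[of "b * q" \<omega>] resB[of q \<omega>] by simp_all
    ultimately have "prob {\<omega>\<in>space M. (?G (\<lambda>k. \<xi> k \<omega>) \<and> P (?D (\<lambda>k. \<xi> k \<omega>))) \<and> (?O (\<lambda>k. \<xi> k \<omega>) \<and> Q (?E (\<lambda>k. \<xi> k \<omega>)))} =
        prob {\<omega>\<in>space M. ?G (\<lambda>k. \<xi> k \<omega>) \<and> P (?D (\<lambda>k. \<xi> k \<omega>))} *
        prob {\<omega>\<in>space M. ?O (\<lambda>k. \<xi> k \<omega>) \<and> Q (?E (\<lambda>k. \<xi> k \<omega>))}"
      by (simp only:)
    \<comment> \<open>3/4 + 1/2 - 1: small oscillation and the sign of the block increment concern
      the same block and are not independent, so their intersection is bounded by
      inclusion-exclusion.\<close>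
    moreover have "1 / 4 \<le> prob {\<omega>\<in>space M. ?O (\<lambda>k. \<xi> k \<omega>) \<and> Q (?E (\<lambda>k. \<xi> k \<omega>))}"
    proof -
      have "{\<omega>\<in>space M. Q (?E (\<lambda>k. \<xi> k \<omega>))} \<in> events"
        using measurable_sets[OF E_meas Q] by (simp add: vimage_def Int_def conj_commute)
      from prob_Int_ge[OF O_ev this] osc[OF b] half
      have "1 / 4 \<le> prob ({\<omega>\<in>space M. ?O (\<lambda>k. \<xi> k \<omega>)} \<inter> {\<omega>\<in>space M. Q (?E (\<lambda>k. \<xi> k \<omega>))})"
        by linarith
      also have "{\<omega>\<in>space M. ?O (\<lambda>k. \<xi> k \<omega>)} \<inter> {\<omega>\<in>space M. Q (?E (\<lambda>k. \<xi> k \<omega>))} =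
          {\<omega>\<in>space M. ?O (\<lambda>k. \<xi> k \<omega>) \<and> Q (?E (\<lambda>k. \<xi> k \<omega>))}" by blast
      finally show ?thesis .
    qed
    ultimately show ?thesis
      by (simp only:) (intro mult_left_mono measure_nonneg)
  qed
  \<comment> \<open>Split by the sign of the present position. The next block increment is required
    to have the opposite sign (or be 0), and such numbers bounded by u add up to one bounded by
    u.\<close>
  define G1 where "G1 = {\<omega>\<in>space M. ?G (\<lambda>k. \<xi> k \<omega>) \<and> 0 \<le> ?D (\<lambda>k. \<xi> k \<omega>)}"
  define G2 where "G2 = {\<omega>\<in>space M. ?G (\<lambda>k. \<xi> k \<omega>) \<and> ?D (\<lambda>k. \<xi> k \<omega>) < 0}"
  define H1 where "H1 = {\<omega>\<in>space M. (?G (\<lambda>k. \<xi> k \<omega>) \<and> 0 \<le> ?D (\<lambda>k. \<xi> k \<omega>)) \<and> (?O (\<lambda>k. \<xi> k \<omega>) \<and> ?E (\<lambda>k. \<xi> k \<omega>) \<le> 0)}"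
  define H2 where "H2 = {\<omega>\<in>space M. (?G (\<lambda>k. \<xi> k \<omega>) \<and> ?D (\<lambda>k. \<xi> k \<omega>) < 0) \<and> (?O (\<lambda>k. \<xi> k \<omega>) \<and> 0 \<le> ?E (\<lambda>k. \<xi> k \<omega>))}"
  have DE: "{\<omega>\<in>space M. 0 \<le> ?D (\<lambda>k. \<xi> k \<omega>)} \<in> events" "{\<omega>\<in>space M. ?D (\<lambda>k. \<xi> k \<omega>) < 0} \<in> events"
    "{\<omega>\<in>space M. 0 \<le> ?E (\<lambda>k. \<xi> k \<omega>)} \<in> events" "{\<omega>\<in>space M. ?E (\<lambda>k. \<xi> k \<omega>) \<le> 0} \<in> events"
    using D_meas E_meas by measurable
  have G1: "G1 \<in> events" and G2: "G2 \<in> events"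
    using sets.Int[OF G_ev DE(1)] sets.Int[OF G_ev DE(2)]
    by (auto simp: G1_def G2_def Int_def conj_ac elim!: back_subst[of "\<lambda>S. S \<in> _"])
  have H1: "H1 \<in> events" and H2: "H2 \<in> events"
  proof -
    have "H1 = G1 \<inter> ({\<omega>\<in>space M. ?O (\<lambda>k. \<xi> k \<omega>)} \<inter> {\<omega>\<in>space M. ?E (\<lambda>k. \<xi> k \<omega>) \<le> 0})"
      "H2 = G2 \<inter> ({\<omega>\<in>space M. ?O (\<lambda>k. \<xi> k \<omega>)} \<inter> {\<omega>\<in>space M. 0 \<le> ?E (\<lambda>k. \<xi> k \<omega>)})"
      unfolding H1_def H2_def G1_def G2_def by blast+
    with sets.Int[OF G1 sets.Int[OF O_ev DE(4)]] sets.Int[OF G2 sets.Int[OF O_ev DE(3)]]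
    show "H1 \<in> events" "H2 \<in> events" by (simp_all only:)
  qed
  have "(1 / 4) ^ Suc b \<le> prob {\<omega>\<in>space M. ?G (\<lambda>k. \<xi> k \<omega>)} * (1 / 4)"
    using Suc.IH b by simp
  also have "{\<omega>\<in>space M. ?G (\<lambda>k. \<xi> k \<omega>)} = G1 \<union> G2"
    unfolding G1_def G2_def by (auto simp del: atMost_iff)
  also have "prob (G1 \<union> G2) * (1 / 4) \<le> prob G1 * (1 / 4) + prob G2 * (1 / 4)"
    using measure_Un_le[OF G1 G2] by simp
  also have "\<dots> \<le> prob H1 + prob H2"
    unfolding G1_def G2_def H1_def H2_def
    by (intro add_mono step nonneg nonpos b) auto
  also have "\<dots> = prob (H1 \<union> H2)"
    by (intro finite_measure_Union[symmetric] H1 H2) (auto simp: H1_def H2_def)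
  also have "\<dots> \<le> prob {\<omega>\<in>space M. (\<forall>i\<in>{..Suc b * q}. \<bar>\<Sum>k<i. \<xi> k \<omega>\<bar> \<le> 2 * u) \<and> \<bar>\<Sum>k<Suc b * q. \<xi> k \<omega>\<bar> \<le> u}"
  proof (rule finite_measure_mono)
    show "{\<omega>\<in>space M. (\<forall>i\<in>{..Suc b * q}. \<bar>\<Sum>k<i. \<xi> k \<omega>\<bar> \<le> 2 * u) \<and> \<bar>\<Sum>k<Suc b * q. \<xi> k \<omega>\<bar> \<le> u} \<in> events"
      using \<open>Suc b * q \<le> m * q\<close> by (intro sets_confined Mm) auto
    show "H1 \<union> H2 \<subseteq> {\<omega>\<in>space M. (\<forall>i\<in>{..Suc b * q}. \<bar>\<Sum>k<i. \<xi> k \<omega>\<bar> \<le> 2 * u) \<and> \<bar>\<Sum>k<Suc b * q. \<xi> k \<omega>\<bar> \<le> u}"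
    proof
      fix \<omega> assume \<omega>: "\<omega> \<in> H1 \<union> H2"
      let ?S = "\<lambda>i. \<Sum>k<i. \<xi> k \<omega>" and ?R = "\<lambda>i. \<Sum>k=b * q..<b * q + i. \<xi> k \<omega>"
      have split: "?S (b * q + i) = ?S (b * q) + ?R i" for i
        using sum.atLeastLessThan_concat[of 0 "b * q" "b * q + i" "\<lambda>k. \<xi> k \<omega>"] by (simp add: lessThan_atLeast0)
      have G: "\<And>i. i \<le> b * q \<Longrightarrow> \<bar>?S i\<bar> \<le> 2 * u" "\<bar>?S (b * q)\<bar> \<le> u" and O: "\<And>i. i \<le> q \<Longrightarrow> \<bar>?R i\<bar> \<le> u"
        and sgn: "0 \<le> ?S (b * q) \<and> ?R q \<le> 0 \<or> ?S (b * q) < 0 \<and> 0 \<le> ?R q" and "\<omega> \<in> space M"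
        using \<omega> by (auto simp: H1_def H2_def)
      have all: "\<bar>?S i\<bar> \<le> 2 * u" if "i \<le> Suc b * q" for i
      proof (cases "i \<le> b * q")
        case False
        then obtain j where j: "i = b * q + j"
          by (metis le_add_diff_inverse nat_le_linear)
        then have "j \<le> q" using that by simp
        have "\<bar>?S (b * q) + ?R j\<bar> \<le> 2 * u"
          using G(2) O[OF \<open>j \<le> q\<close>] by linarith
        then show ?thesis by (simp only: j split)
      qed (rule G)
      have "Suc b * q = b * q + q" by simp
      moreover have "\<bar>?S (b * q) + ?R q\<bar> \<le> u"
        using G(2) O[OF order_refl] sgn by linarith
      ultimately have "\<bar>?S (Suc b * q)\<bar> \<le> u"
        by (simp only: split)
      with all \<open>\<omega> \<in> space M\<close> show "\<omega> \<in> {\<omega>\<in>space M. (\<forall>i\<in>{..Suc b * q}. \<bar>\<Sum>k<i. \<xi> k \<omega>\<bar> \<le> 2 * u) \<and> \<bar>\<Sum>k<Suc b * q. \<xi> k \<omega>\<bar> \<le> u}"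
        by simp
    qed
  qed
  finally show ?case .
qed


section \<open>Small ball and tail estimates for the running supremum\<close>

lemma stable_process_measurable:
  "symmetric_stable_process M \<alpha> l \<Longrightarrow> 0 \<le> t \<Longrightarrow> l t \<in> borel_measurable M"
  by (simp add: symmetric_stable_process_def)

lemma stable_increment_char:
  assumes l: "symmetric_stable_process M \<alpha> l" and "0 \<le> s" "s \<le> t"
  shows "char (distr M borel (\<lambda>\<omega>. l t \<omega> - l s \<omega>)) \<xi> = of_real (exp (- (t - s) * \<bar>\<xi>\<bar> powr \<alpha>))"
proof -
  have "distr M borel (\<lambda>\<omega>. l t \<omega> - l s \<omega>) = distr M borel (l (t - s))"
    using l assms(2,3) unfolding symmetric_stable_process_def by blast
  then show ?thesis
    using l assms(2,3) unfolding symmetric_stable_process_def by (simp add: algebra_simps)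
qed

lemma stable_increment_tail:
  assumes l: "symmetric_stable_process M \<alpha> l" and "0 \<le> s" "s \<le> t" "0 < \<alpha>" "0 < u"
  shows "prob {\<omega>\<in>space M. u < \<bar>l t \<omega> - l s \<omega>\<bar>} \<le> 2 * (t - s) * (2 / u) powr \<alpha>"
proof -
  have m: "(\<lambda>\<omega>. l t \<omega> - l s \<omega>) \<in> borel_measurable M"
    using assms by (intro borel_measurable_diff stable_process_measurable) auto
  have "prob {\<omega>\<in>space M. u < \<bar>l t \<omega> - l s \<omega>\<bar>} \<le> prob {\<omega>\<in>space M. u \<le> \<bar>l t \<omega> - l s \<omega>\<bar>}"
    using m by (intro finite_measure_mono) (auto, measurable)
  also have "\<dots> \<le> 2 * (t - s) * (2 / u) powr \<alpha>"
    using assms by (intro stable_tail[OF prob_space_axioms m stable_increment_char[OF l]]) auto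
  finally show ?thesis .
qed

lemma stable_grid_indep:
  assumes l: "symmetric_stable_process M \<alpha> l" and "0 \<le> \<delta>"
  shows "indep_vars (\<lambda>_. borel) (\<lambda>i \<omega>. l (real (p + Suc i) * \<delta>) \<omega> - l (real (p + i) * \<delta>) \<omega>) {..<n}"
proof -
  have "0 \<le> real (p + 0) * \<delta>" "mono (\<lambda>i. real (p + i) * \<delta>)"
    using \<open>0 \<le> \<delta>\<close> by (auto intro!: monoI mult_right_mono)
  then show ?thesis
    using l[unfolded symmetric_stable_process_def, THEN conjunct2, THEN conjunct2, THEN conjunct2,
        THEN conjunct1, THEN spec, THEN spec, of "\<lambda>i. real (p + i) * \<delta>" n] by simp
qed

text \<open>Ottaviani's inequality with the stable tail. The bound depends on the time length q
  \<delta>, not on the number of grid points, so it survives refinement.\<close>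

lemma stable_grid_max:
  assumes l: "symmetric_stable_process M \<alpha> l" and "0 < \<alpha>" "0 \<le> \<delta>" "0 < u"
    and small: "2 * (real q * \<delta>) * (2 / u) powr \<alpha> \<le> 1 / 2"
  shows "1 - 4 * (real q * \<delta>) * (2 / u) powr \<alpha> \<le>
    prob {\<omega>\<in>space M. \<forall>i\<in>{..q}. \<bar>l (real (p + i) * \<delta>) \<omega> - l (real p * \<delta>) \<omega>\<bar> \<le> 2 * u}"
proof -
  let ?\<xi> = "\<lambda>i \<omega>. l (real (p + Suc i) * \<delta>) \<omega> - l (real (p + i) * \<delta>) \<omega>"
  have S: "(\<Sum>j<i. ?\<xi> j \<omega>) = l (real (p + i) * \<delta>) \<omega> - l (real p * \<delta>) \<omega>" for i \<omega>
    using sum_lessThan_telescope[of "\<lambda>i. l (real (p + i) * \<delta>) \<omega>" i] by simp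
  have tail: "prob {\<omega>\<in>space M. u < \<bar>l (real (p + q) * \<delta>) \<omega> - l (real (p + i) * \<delta>) \<omega>\<bar>} \<le>
      2 * (real q * \<delta>) * (2 / u) powr \<alpha>" if "i \<le> q" for i
  proof -
    have "prob {\<omega>\<in>space M. u < \<bar>l (real (p + q) * \<delta>) \<omega> - l (real (p + i) * \<delta>) \<omega>\<bar>} \<le>
        2 * (real (p + q) * \<delta> - real (p + i) * \<delta>) * (2 / u) powr \<alpha>"
      using assms that by (intro stable_increment_tail[OF l]) (auto intro!: mult_right_mono)
    also have "\<dots> \<le> 2 * (real q * \<delta>) * (2 / u) powr \<alpha>"
      using assms by (intro mult_right_mono mult_left_mono) (auto simp: algebra_simps)
    finally show ?thesis .
  qed
  have "prob {\<omega>\<in>space M. \<exists>i\<le>q. 2 * u < \<bar>\<Sum>j<i. ?\<xi> j \<omega>\<bar>} \<le> 2 * prob {\<omega>\<in>space M. u < \<bar>\<Sum>j<q. ?\<xi> j \<omega>\<bar>}"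
  proof (rule ottaviani[OF stable_grid_indep[OF l \<open>0 \<le> \<delta>\<close>]])
    fix i assume "i \<le> q"
    from tail[OF this] small
    show "prob {\<omega>\<in>space M. u < \<bar>(\<Sum>j<q. ?\<xi> j \<omega>) - (\<Sum>j<i. ?\<xi> j \<omega>)\<bar>} \<le> 1 / 2"
      unfolding S by simp
  qed
  also have "\<dots> \<le> 4 * (real q * \<delta>) * (2 / u) powr \<alpha>"
    using tail[of 0] unfolding S by (simp add: mult_ac)
  finally have le: "prob {\<omega>\<in>space M. \<exists>i\<le>q. 2 * u < \<bar>l (real (p + i) * \<delta>) \<omega> - l (real p * \<delta>) \<omega>\<bar>} \<le>
      4 * (real q * \<delta>) * (2 / u) powr \<alpha>"
    unfolding S .
  have ev: "{\<omega>\<in>space M. \<forall>i\<in>{..q}. \<bar>l (real (p + i) * \<delta>) \<omega> - l (real p * \<delta>) \<omega>\<bar> \<le> 2 * u} \<in> events"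
    using l \<open>0 \<le> \<delta>\<close> by (intro sets_Collect_ball_abs_le borel_measurable_diff stable_process_measurable[OF l]) auto
  have "space M - {\<omega>\<in>space M. \<forall>i\<in>{..q}. \<bar>l (real (p + i) * \<delta>) \<omega> - l (real p * \<delta>) \<omega>\<bar> \<le> 2 * u} =
      {\<omega>\<in>space M. \<exists>i\<le>q. 2 * u < \<bar>l (real (p + i) * \<delta>) \<omega> - l (real p * \<delta>) \<omega>\<bar>}"
    by (simp only: set_eq_iff Diff_iff mem_Collect_eq Ball_def atMost_iff not_le[symmetric]) blast
  then show ?thesis
    using prob_compl[OF ev] le by simp
qed

text \<open>The bound depends on the number m of blocks, whatever the mesh. Symmetry of the
  increments supplies the halves; the strip is 4 u because the oscillation within a block is bounded
  by 2 u.\<close>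

lemma stable_grid_confined:
  assumes l: "symmetric_stable_process M \<alpha> l" and "0 < \<alpha>" "0 \<le> \<delta>" "0 < u"
    and small: "4 * (real q * \<delta>) * (2 / u) powr \<alpha> \<le> 1 / 4"
  shows "(1 / 4) ^ m \<le> prob {\<omega>\<in>space M. \<forall>i\<in>{..m * q}. \<bar>l (real i * \<delta>) \<omega>\<bar> \<le> 4 * u}"
proof -
  let ?\<xi> = "\<lambda>i \<omega>. l (real (Suc i) * \<delta>) \<omega> - l (real i * \<delta>) \<omega>"
  have block: "(\<Sum>k=a..<a + i. ?\<xi> k \<omega>) = l (real (a + i) * \<delta>) \<omega> - l (real a * \<delta>) \<omega>" for a i \<omega>
    using sum_Suc_diff'[where m = a and n = "a + i" and f = "\<lambda>i. l (real i * \<delta>) \<omega>"] by simp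
  have S: "(\<Sum>k<i. ?\<xi> k \<omega>) = l (real i * \<delta>) \<omega> - l 0 \<omega>" for i \<omega>
    using sum_lessThan_telescope[of "\<lambda>i. l (real i * \<delta>) \<omega>" i] by simp
  have half: "1 / 2 \<le> prob {\<omega>\<in>space M. 0 \<le> l (real (a + q) * \<delta>) \<omega> - l (real a * \<delta>) \<omega>}"
    "1 / 2 \<le> prob {\<omega>\<in>space M. l (real (a + q) * \<delta>) \<omega> - l (real a * \<delta>) \<omega> \<le> 0}" for a
  proof -
    have "(\<lambda>\<omega>. l (real (a + q) * \<delta>) \<omega> - l (real a * \<delta>) \<omega>) \<in> borel_measurable M"
      using \<open>0 \<le> \<delta>\<close> by (intro borel_measurable_diff stable_process_measurable[OF l]) auto
    moreover have "char (distr M borel (\<lambda>\<omega>. l (real (a + q) * \<delta>) \<omega> - l (real a * \<delta>) \<omega>)) \<xi> \<in> \<real>" for \<xi>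
      using \<open>0 \<le> \<delta>\<close> by (subst stable_increment_char[OF l]) (auto intro!: mult_right_mono)
    ultimately show "1 / 2 \<le> prob {\<omega>\<in>space M. 0 \<le> l (real (a + q) * \<delta>) \<omega> - l (real a * \<delta>) \<omega>}"
      "1 / 2 \<le> prob {\<omega>\<in>space M. l (real (a + q) * \<delta>) \<omega> - l (real a * \<delta>) \<omega> \<le> 0}"
      by (rule real_char_half[OF prob_space_axioms])+
  qed
  have "(1 / 4) ^ m \<le> prob {\<omega>\<in>space M. (\<forall>i\<in>{..m * q}. \<bar>\<Sum>k<i. ?\<xi> k \<omega>\<bar> \<le> 2 * (2 * u)) \<and> \<bar>\<Sum>k<m * q. ?\<xi> k \<omega>\<bar> \<le> 2 * u}"
  proof (rule confinement)
    show "indep_vars (\<lambda>_. borel) ?\<xi> {..<m * q}"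
      using stable_grid_indep[OF l \<open>0 \<le> \<delta>\<close>, of 0] by simp
    fix b :: nat
    have "2 * (real q * \<delta>) * (2 / u) powr \<alpha> \<le> 1 / 2"
      using small by simp
    from stable_grid_max[OF l \<open>0 < \<alpha>\<close> \<open>0 \<le> \<delta>\<close> \<open>0 < u\<close> this, of "b * q"] small
    show "3 / 4 \<le> prob {\<omega>\<in>space M. \<forall>i\<in>{..q}. \<bar>\<Sum>k=b * q..<b * q + i. ?\<xi> k \<omega>\<bar> \<le> 2 * u}"
      unfolding block by linarith
    show "1 / 2 \<le> prob {\<omega>\<in>space M. 0 \<le> (\<Sum>k=b * q..<b * q + q. ?\<xi> k \<omega>)}"
      "1 / 2 \<le> prob {\<omega>\<in>space M. (\<Sum>k=b * q..<b * q + q. ?\<xi> k \<omega>) \<le> 0}"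
      unfolding block by (rule half)+
  qed (use \<open>0 < u\<close> in auto)
  also have "\<dots> \<le> prob {\<omega>\<in>space M. \<forall>i\<in>{..m * q}. \<bar>l (real i * \<delta>) \<omega>\<bar> \<le> 4 * u}"
  proof (rule finite_measure_mono_AE)
    have "AE \<omega> in M. l 0 \<omega> = 0"
      using l unfolding symmetric_stable_process_def by blast
    then show "AE \<omega> in M. \<omega> \<in> {\<omega>\<in>space M. (\<forall>i\<in>{..m * q}. \<bar>\<Sum>k<i. ?\<xi> k \<omega>\<bar> \<le> 2 * (2 * u)) \<and> \<bar>\<Sum>k<m * q. ?\<xi> k \<omega>\<bar> \<le> 2 * u} \<longrightarrow>
        \<omega> \<in> {\<omega>\<in>space M. \<forall>i\<in>{..m * q}. \<bar>l (real i * \<delta>) \<omega>\<bar> \<le> 4 * u}"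
      unfolding S by eventually_elim auto
    show "{\<omega>\<in>space M. \<forall>i\<in>{..m * q}. \<bar>l (real i * \<delta>) \<omega>\<bar> \<le> 4 * u} \<in> events"
      using \<open>0 \<le> \<delta>\<close> by (intro sets_Collect_ball_abs_le stable_process_measurable[OF l]) auto
  qed
  finally show ?thesis .
qed

text \<open>Restriction to rational times makes this a countable intersection; for right continuous
  paths it loses nothing.\<close>

lemma running_sup_event:
  assumes "\<And>t. 0 \<le> t \<Longrightarrow> l t \<in> borel_measurable M"
  shows "{\<omega>\<in>space M. \<forall>t\<in>\<rat> \<inter> {0..<T}. \<bar>l t \<omega> :: real\<bar> \<le> r} \<in> events"
  using assms by (intro sets.sets_Collect_countable_All' borel_measurable_le borel_measurable_abs)
    (auto intro: countable_Int1 countable_rat)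

text \<open>Continuity from above along dyadic refinement: the grids are nested, so the events
  decrease, and on their intersection the bound holds on a dense set, hence everywhere by right
  continuity.\<close>

lemma running_sup_prob_ge:
  assumes l: "symmetric_stable_process M \<alpha> l" and "0 < h"
    and grid: "\<And>j. p \<le> prob {\<omega>\<in>space M. \<forall>i\<in>{..m * 2 ^ j}. \<bar>l (real i * (h / 2 ^ j)) \<omega>\<bar> \<le> r}"
  shows "p \<le> prob {\<omega>\<in>space M. \<forall>t\<in>\<rat> \<inter> {0..<real m * h}. \<bar>l t \<omega>\<bar> \<le> r}"
proof -
  define F where "F j = {\<omega>\<in>space M. \<forall>i\<in>{..m * 2 ^ j}. \<bar>l (real i * (h / 2 ^ j)) \<omega>\<bar> \<le> r}" for j :: nat
  have F: "F j \<in> events" for j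
    unfolding F_def using \<open>0 < h\<close> by (intro sets_Collect_ball_abs_le stable_process_measurable[OF l]) auto
  have "decseq F"
  proof (rule decseq_SucI, rule subsetI)
    fix j \<omega> assume "\<omega> \<in> F (Suc j)"
    then have \<omega>: "\<omega> \<in> space M" "\<And>i. i \<le> m * 2 ^ Suc j \<Longrightarrow> \<bar>l (real i * (h / 2 ^ Suc j)) \<omega>\<bar> \<le> r"
      by (auto simp: F_def)
    have "\<bar>l (real i * (h / 2 ^ j)) \<omega>\<bar> \<le> r" if "i \<le> m * 2 ^ j" for i
      using \<omega>(2)[of "2 * i"] that by simp
    then show "\<omega> \<in> F j" using \<omega>(1) by (simp add: F_def)
  qed
  then have "(\<lambda>j. prob (F j)) \<longlonglongrightarrow> prob (\<Inter>j. F j)"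
    using F by (intro finite_Lim_measure_decseq) auto
  then have "p \<le> prob (\<Inter>j. F j)"
    by (rule LIMSEQ_le_const) (use grid in \<open>auto simp: F_def\<close>)
  also have "\<dots> \<le> prob {\<omega>\<in>space M. \<forall>t\<in>\<rat> \<inter> {0..<real m * h}. \<bar>l t \<omega>\<bar> \<le> r}"
  proof (rule finite_measure_mono_AE)
    show "{\<omega>\<in>space M. \<forall>t\<in>\<rat> \<inter> {0..<real m * h}. \<bar>l t \<omega>\<bar> \<le> r} \<in> events"
      by (rule running_sup_event) (rule stable_process_measurable[OF l])
    have "AE \<omega> in M. rcll (\<lambda>t. l t \<omega>)"
      using l unfolding symmetric_stable_process_def by blast
    then show "AE \<omega> in M. \<omega> \<in> (\<Inter>j. F j) \<longrightarrow> \<omega> \<in> {\<omega>\<in>space M. \<forall>t\<in>\<rat> \<inter> {0..<real m * h}. \<bar>l t \<omega>\<bar> \<le> r}"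
    proof eventually_elim
      case (elim \<omega>)
      show ?case
      proof
        assume \<omega>: "\<omega> \<in> (\<Inter>j. F j)"
        define D where "D = (\<Union>j. (\<lambda>i. real i * (h / 2 ^ j)) ` {..m * 2 ^ j})"
        have "\<bar>l t \<omega>\<bar> \<le> r" if "0 \<le> t" "t < real m * h" for t
        proof (rule abs_le_of_dense[OF elim _ _ that])
          show "\<bar>l u \<omega>\<bar> \<le> r" if "u \<in> D" for u
            using \<omega> that by (auto simp: D_def F_def)
          fix s s' :: real assume s: "0 \<le> s" "s < s'" "s' \<le> real m * h"
          obtain j :: nat where j: "h / 2 ^ j < s' - s"
          proof -
            have "(\<lambda>j. h * (1 / 2) ^ j) \<longlonglongrightarrow> h * 0"
              by (intro tendsto_intros) auto
            then have "eventually (\<lambda>j. h * (1 / 2) ^ j < s' - s) sequentially"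
              using s by (intro order_tendstoD) auto
            then obtain j where "h * (1 / 2) ^ j < s' - s"
              by (auto simp: eventually_sequentially)
            then show ?thesis using that[of j] by (simp add: power_one_over)
          qed
          define d where "d = h / 2 ^ j"
          have d: "0 < d" "d < s' - s" using \<open>0 < h\<close> j by (auto simp: d_def)
          \<comment> \<open>The first grid index strictly to the right of s.\<close>
          define i where "i = nat (\<lfloor>s / d\<rfloor> + 1)"
          have i: "real i = of_int \<lfloor>s / d\<rfloor> + 1"
            using s(1) d by (simp add: i_def)
          have "s / d < real i" "real i \<le> s / d + 1"
            unfolding i by linarith+
          then have id: "s < real i * d" "real i * d \<le> s + d"
            using d by (simp_all add: pos_divide_less_eq field_simps)
          then have "real i * d < real m * h" using d s by linarith
          also have "\<dots> = real (m * 2 ^ j) * d" by (simp add: d_def)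
          finally have "i \<le> m * 2 ^ j"
            using d by (simp only: mult_less_cancel_right_pos of_nat_less_iff less_imp_le)
          then have "real i * d \<in> D" unfolding D_def d_def by blast
          then show "\<exists>u\<in>D. s < u \<and> u < s'"
            using id d by (intro bexI[of _ "real i * d"]) auto
        qed
        then show "\<omega> \<in> {\<omega>\<in>space M. \<forall>t\<in>\<rat> \<inter> {0..<real m * h}. \<bar>l t \<omega>\<bar> \<le> r}"
          using \<omega> by (auto simp: F_def)
      qed
    qed
  qed
  finally show ?thesis .
qed

lemma stable_small_ball:
  assumes l: "symmetric_stable_process M \<alpha> l" and "0 < \<alpha>" "0 < T" "0 < r"
  shows "0 < prob {\<omega>\<in>space M. \<forall>t\<in>\<rat> \<inter> {0..<T}. \<bar>l t \<omega>\<bar> \<le> r}"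
proof -
  define u where "u = r / 4"
  \<comment> \<open>For m > c blocks of length T / m meet the smallness condition of
    \<open>stable_grid_confined\<close>, 4 (T / m) (2 / u)^\<alpha> <= 1/4.\<close>
  define c where "c = 16 * T * (2 / u) powr \<alpha>"
  obtain m :: nat where m: "c < real m" "0 < m"
  proof -
    obtain m :: nat where "max c 0 < real m" using reals_Archimedean2 by blast
    then have "c < real m" "0 < m" by simp_all
    then show ?thesis by (rule that)
  qed
  have u: "0 < u" using assms by (simp add: u_def)
  have "(1 / 4) ^ m \<le> prob {\<omega>\<in>space M. \<forall>i\<in>{..m * 2 ^ j}. \<bar>l (real i * (T / real m / 2 ^ j)) \<omega>\<bar> \<le> r}" for j
  proof -
    have "4 * (real (2 ^ j) * (T / real m / 2 ^ j)) * (2 / u) powr \<alpha> = c / (4 * real m)"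
      by (simp add: c_def)
    also have "\<dots> \<le> 1 / 4"
      using m by (simp add: field_simps)
    finally have "(1 / 4) ^ m \<le> prob {\<omega>\<in>space M. \<forall>i\<in>{..m * 2 ^ j}. \<bar>l (real i * (T / real m / 2 ^ j)) \<omega>\<bar> \<le> 4 * u}"
      using assms u by (intro stable_grid_confined[OF l]) auto
    then show ?thesis by (simp add: u_def)
  qed
  from running_sup_prob_ge[OF l _ this] m assms
  have "(1 / 4) ^ m \<le> prob {\<omega>\<in>space M. \<forall>t\<in>\<rat> \<inter> {0..<T}. \<bar>l t \<omega>\<bar> \<le> r}"
    by simp
  moreover have "0 < (1 / 4 :: real) ^ m" by simp
  ultimately show ?thesis by linarith
qed

text \<open>A single block of length T, with level r / 2 in the maximal inequality. Unlike the small
  ball estimate it yields a probability near 1 for large r, as infinitely many modes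
  require.\<close>

lemma stable_running_sup_tail:
  assumes l: "symmetric_stable_process M \<alpha> l" and "0 < \<alpha>" "0 < T" "0 < r"
    and small: "2 * T * (4 / r) powr \<alpha> \<le> 1 / 2"
  shows "1 - 4 * T * (4 / r) powr \<alpha> \<le> prob {\<omega>\<in>space M. \<forall>t\<in>\<rat> \<inter> {0..<T}. \<bar>l t \<omega>\<bar> \<le> r}"
proof -
  have "1 - 4 * T * (4 / r) powr \<alpha> \<le> prob {\<omega>\<in>space M. \<forall>i\<in>{..1 * 2 ^ j}. \<bar>l (real i * (T / 2 ^ j)) \<omega>\<bar> \<le> r}" for j
  proof -
    have "1 - 4 * (real (2 ^ j) * (T / 2 ^ j)) * (2 / (r / 2)) powr \<alpha> \<le>
        prob {\<omega>\<in>space M. \<forall>i\<in>{..2 ^ j}. \<bar>l (real (0 + i) * (T / 2 ^ j)) \<omega> - l (real 0 * (T / 2 ^ j)) \<omega>\<bar> \<le> 2 * (r / 2)}"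
      using assms by (intro stable_grid_max[OF l]) auto
    also have "\<dots> \<le> prob {\<omega>\<in>space M. \<forall>i\<in>{..1 * 2 ^ j}. \<bar>l (real i * (T / 2 ^ j)) \<omega>\<bar> \<le> r}"
    proof (rule finite_measure_mono_AE)
      have "AE \<omega> in M. l 0 \<omega> = 0"
        using l unfolding symmetric_stable_process_def by blast
      then show "AE \<omega> in M. \<omega> \<in> {\<omega>\<in>space M. \<forall>i\<in>{..2 ^ j}. \<bar>l (real (0 + i) * (T / 2 ^ j)) \<omega> - l (real 0 * (T / 2 ^ j)) \<omega>\<bar> \<le> 2 * (r / 2)} \<longrightarrow>
          \<omega> \<in> {\<omega>\<in>space M. \<forall>i\<in>{..1 * 2 ^ j}. \<bar>l (real i * (T / 2 ^ j)) \<omega>\<bar> \<le> r}"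
        by eventually_elim simp
      show "{\<omega>\<in>space M. \<forall>i\<in>{..1 * 2 ^ j}. \<bar>l (real i * (T / 2 ^ j)) \<omega>\<bar> \<le> r} \<in> events"
        using \<open>0 < T\<close> by (intro sets_Collect_ball_abs_le stable_process_measurable[OF l]) auto
    qed
    finally show ?thesis by simp
  qed
  from running_sup_prob_ge[OF l _ this] assms show ?thesis by simp
qed

end

section \<open>Small noise has positive probability\<close>

text \<open>Weierstrass' product inequality: summable failure probabilities bound the product from
  below independently of the number of factors.\<close>

lemma prod_ge_one_minus_sum:
  fixes x :: "'i \<Rightarrow> real"
  assumes "finite J" "\<And>k. k \<in> J \<Longrightarrow> 0 \<le> x k \<and> x k \<le> 1"
  shows "1 - (\<Sum>k\<in>J. 1 - x k) \<le> (\<Prod>k\<in>J. x k)"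
  using assms
proof (induction J rule: finite_induct)
  case (insert k J)
  then have IH: "1 - (\<Sum>k\<in>J. 1 - x k) \<le> (\<Prod>k\<in>J. x k)" and xk: "0 \<le> x k" "x k \<le> 1" by auto
  have "(\<Prod>k\<in>J. x k) \<le> 1"
    using insert.prems by (intro prod_le_1) auto
  then have "(1 - x k) * (\<Prod>k\<in>J. x k) \<le> (1 - x k) * 1"
    using xk by (intro mult_left_mono) auto
  then show ?case using insert.hyps IH by (simp add: algebra_simps)
qed simp

lemma summable_on_small_tails:
  fixes f g :: "'i \<Rightarrow> real"
  assumes f: "f summable_on A" and g: "g summable_on A" and "0 < e"
  obtains F where "finite F" "F \<subseteq> A" "infsum f (A - F) < e" "infsum g (A - F) < e"
proof -
  have ev: "eventually (\<lambda>F. infsum h (A - F) < e) (finite_subsets_at_top A)" if h: "h summable_on A" for h :: "'i \<Rightarrow> real"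
  proof -
    have "eventually (\<lambda>F. dist (sum h F) (infsum h A) < e) (finite_subsets_at_top A)"
      using has_sum_infsum[OF h] \<open>0 < e\<close> unfolding has_sum_def by (rule tendstoD)
    moreover have "eventually (\<lambda>F. finite F \<and> F \<subseteq> A) (finite_subsets_at_top A)"
      by (rule eventually_finite_subsets_at_top_weakI) auto
    ultimately show ?thesis
    proof eventually_elim
      case (elim F)
      then have "infsum h (A - F) = infsum h A - sum h F"
        using h by (subst infsum_Diff) auto
      then show ?case using elim by (simp add: dist_real_def)
    qed
  qed
  from eventually_conj[OF ev[OF f] ev[OF g]] obtain F where
    "finite F" "F \<subseteq> A" "infsum f (A - F) < e \<and> infsum g (A - F) < e"
    unfolding eventually_finite_subsets_at_top by blast
  then show ?thesis using that by blast
qed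

context prob_space
begin

lemma iid_stable_prob_Inter:
  assumes l: "iid_stable_processes M \<alpha> l" and J: "finite J" "J \<noteq> {}" "J \<subseteq> nz"
  shows "prob (\<Inter>k\<in>J. {\<omega>\<in>space M. \<forall>t\<in>\<rat> \<inter> {0..<T}. \<bar>l k t \<omega>\<bar> \<le> \<eta> k}) =
    (\<Prod>k\<in>J. prob {\<omega>\<in>space M. \<forall>t\<in>\<rat> \<inter> {0..<T}. \<bar>l k t \<omega>\<bar> \<le> \<eta> k})"
proof -
  let ?P = "PiM {0::real..} (\<lambda>_. borel :: real measure)"
  let ?B = "\<lambda>k. {x\<in>space ?P. \<forall>t\<in>\<rat> \<inter> {0..<T}. \<bar>x t\<bar> \<le> \<eta> k}"
  have B: "?B k \<in> sets ?P" for k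
    by (intro sets.sets_Collect_countable_All' borel_measurable_le borel_measurable_abs
        measurable_component_singleton) (auto intro: countable_Int1 countable_rat)
  have "(\<lambda>\<omega>. \<lambda>t\<in>{0..}. l k t \<omega>) -` ?B k \<inter> space M = {\<omega>\<in>space M. \<forall>t\<in>\<rat> \<inter> {0..<T}. \<bar>l k t \<omega>\<bar> \<le> \<eta> k}" for k
    by (auto simp: space_PiM)
  moreover have "prob (\<Inter>k\<in>J. (\<lambda>\<omega>. \<lambda>t\<in>{0..}. l k t \<omega>) -` ?B k \<inter> space M) =
      (\<Prod>k\<in>J. prob ((\<lambda>\<omega>. \<lambda>t\<in>{0..}. l k t \<omega>) -` ?B k \<inter> space M))"
    using l J B unfolding iid_stable_processes_def by (intro indep_varsD) auto
  ultimately show ?thesis by simp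
qed

lemma small_noise_event:
  assumes l: "iid_stable_processes M \<alpha> l" and "0 < \<alpha>" "1 / 2 + 1 / (2 * \<alpha>) < \<beta>" "0 \<le> C" "0 < T" "0 < \<delta>"
    and b: "\<forall>k. k \<noteq> 0 \<longrightarrow> \<bar>b k\<bar> \<le> C * eigenval k powr (- \<beta>)"
  shows "\<exists>\<eta> :: int \<Rightarrow> real. \<exists>E. E \<in> events \<and> 0 < prob E \<and>
    (\<lambda>k. \<bar>b k\<bar> * \<eta> k) summable_on nz \<and> (\<Sum>\<^sub>\<infinity>k\<in>nz. \<bar>b k\<bar> * \<eta> k) \<le> \<delta> \<and>
    (\<forall>\<omega>\<in>E. \<forall>k. k \<noteq> 0 \<longrightarrow> (\<forall>t\<in>\<rat> \<inter> {0..<T}. \<bar>l k t \<omega>\<bar> \<le> \<eta> k))"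
proof -
  have stable: "symmetric_stable_process M \<alpha> (l k)" if "k \<noteq> 0" for k
    using l that by (simp add: iid_stable_processes_def)
  \<comment> \<open>The midpoint of the interval from 1 / \<alpha> to 2 \<beta> - 1.\<close>
  define \<kappa> where "\<kappa> = (2 * \<beta> - 1 + 1 / \<alpha>) / 2"
  have \<beta>: "1 / \<alpha> < 2 * \<beta> - 1" using assms(2,3) by (simp add: field_simps)
  have \<kappa>: "1 / \<alpha> < \<kappa>" "\<kappa> < 2 * \<beta> - 1" using \<beta> by (simp_all add: \<kappa>_def)
  have "1 < \<kappa> * \<alpha>" using \<kappa>(1) \<open>0 < \<alpha>\<close> by (simp add: field_simps)
  have "0 < \<beta>" using \<beta> \<open>0 < \<alpha>\<close> by (smt (verit) divide_pos_pos)
  define q where "q k = 4 * T * (4 / real_of_int \<bar>k\<bar> powr \<kappa>) powr \<alpha>" for k :: int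
  define c where "c k = \<bar>b k\<bar> * real_of_int \<bar>k\<bar> powr \<kappa>" for k
  have q: "q summable_on nz"
  proof -
    have 1: "(\<lambda>k::int. (4 * T * 4 powr \<alpha>) * real_of_int \<bar>k\<bar> powr - (\<kappa> * \<alpha>)) summable_on nz"
      using \<open>1 < \<kappa> * \<alpha>\<close> by (intro summable_on_cmult_right summable_int_powr)
    have 2: "(4 * T * 4 powr \<alpha>) * real_of_int \<bar>k\<bar> powr - (\<kappa> * \<alpha>) = q k" if "k \<in> nz" for k
      using that by (simp add: q_def powr_divide powr_powr powr_minus_divide)
    show ?thesis using 1 summable_on_cong[of nz _ q, OF 2] by blast
  qed
  have q0: "0 \<le> q k" for k using \<open>0 < T\<close> by (simp add: q_def)
  have c: "c summable_on nz"
  proof (rule summable_on_comparison_test)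
    show "(\<lambda>k::int. C * real_of_int \<bar>k\<bar> powr - (2 * \<beta> - \<kappa>)) summable_on nz"
      using \<kappa> by (intro summable_on_cmult_right summable_int_powr) simp
    fix k assume "k \<in> nz"
    then have k: "k \<noteq> 0" by simp
    have "eigenval k powr (- \<beta>) \<le> ((real_of_int \<bar>k\<bar>)\<^sup>2) powr (- \<beta>)"
    proof (intro powr_mono2')
      show "(real_of_int \<bar>k\<bar>)\<^sup>2 \<le> eigenval k"
        using eigenval_ge[OF k] zero_le_power2[of "real_of_int k"] unfolding of_int_abs power2_abs by linarith
    qed (use k \<open>0 < \<beta>\<close> in auto)
    also have "\<dots> = real_of_int \<bar>k\<bar> powr - (2 * \<beta>)"
    proof -
      have "(real_of_int \<bar>k\<bar>)\<^sup>2 = real_of_int \<bar>k\<bar> powr 2"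
        using k by simp
      then show ?thesis by (simp only: powr_powr) simp
    qed
    finally have "\<bar>b k\<bar> \<le> C * real_of_int \<bar>k\<bar> powr - (2 * \<beta>)"
      using b[rule_format, OF k] \<open>0 \<le> C\<close> by (meson mult_left_mono order_trans)
    then have "c k \<le> C * real_of_int \<bar>k\<bar> powr - (2 * \<beta>) * real_of_int \<bar>k\<bar> powr \<kappa>"
      unfolding c_def by (intro mult_right_mono) auto
    also have "\<dots> = C * real_of_int \<bar>k\<bar> powr - (2 * \<beta> - \<kappa>)"
      by (simp add: mult.assoc powr_add[symmetric])
    finally show "c k \<le> C * real_of_int \<bar>k\<bar> powr - (2 * \<beta> - \<kappa>)" .
  qed (simp add: c_def)
  \<comment> \<open>1/2 serves the product over the modes outside F and the smallness condition of
    \<open>stable_running_sup_tail\<close>; \<delta> / 2 is the share of these modes in the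
    sum.\<close>
  define e where "e = min (1 / 2) (\<delta> / 2)"
  have e: "0 < e" "e \<le> 1 / 2" "e \<le> \<delta> / 2" using \<open>0 < \<delta>\<close> by (auto simp: e_def)
  obtain F where F: "finite F" "F \<subseteq> nz" "infsum q (nz - F) < e" "infsum c (nz - F) < e"
    by (rule summable_on_small_tails[OF q c e(1)])
  define s where "s = (\<Sum>k\<in>F. \<bar>b k\<bar>)"
  have s: "0 \<le> s" by (simp add: s_def sum_nonneg)
  \<comment> \<open>Common level for the modes in F, which then contribute s * \<rho> <= \<delta> /
    2; 1 + s avoids a zero denominator.\<close>
  define \<rho> where "\<rho> = \<delta> / (2 * (1 + s))"
  have \<rho>: "0 < \<rho>" "s * \<rho> \<le> \<delta> / 2"
    using s \<open>0 < \<delta>\<close> by (auto simp: \<rho>_def field_simps)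
  define \<eta> where "\<eta> k = (if k \<in> F then \<rho> else real_of_int \<bar>k\<bar> powr \<kappa>)" for k
  define A where "A k = {\<omega>\<in>space M. \<forall>t\<in>\<rat> \<inter> {0..<T}. \<bar>l k t \<omega>\<bar> \<le> \<eta> k}" for k
  have A: "A k \<in> events" if "k \<in> nz" for k
    unfolding A_def using stable_process_measurable[OF stable] that by (intro running_sup_event) auto
  have AF: "0 < prob (A k)" if "k \<in> F" for k
  proof -
    have "k \<noteq> 0" "\<eta> k = \<rho>" using that F(2) by (auto simp: \<eta>_def)
    then show ?thesis
      unfolding A_def using stable_small_ball[OF stable \<open>0 < \<alpha>\<close> \<open>0 < T\<close> \<rho>(1)] by simp
  qed
  have Aq: "1 - prob (A k) \<le> q k" if "k \<in> nz - F" for k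
  proof -
    have k: "k \<noteq> 0" "\<eta> k = real_of_int \<bar>k\<bar> powr \<kappa>" using that by (auto simp: \<eta>_def)
    have "(\<Sum>k\<in>{k}. q k) \<le> infsum q (nz - F)"
      using that q q0 by (intro finite_sum_le_infsum) (auto intro: summable_on_subset)
    then have "q k \<le> 1 / 2" using F(3) e(2) by simp
    then have "2 * T * (4 / \<eta> k) powr \<alpha> \<le> 1 / 2"
      using q0[of k] by (simp add: q_def k)
    moreover have "0 < \<eta> k" using k by simp
    ultimately have "1 - 4 * T * (4 / \<eta> k) powr \<alpha> \<le> prob (A k)"
      unfolding A_def using stable[OF k(1)] \<open>0 < \<alpha>\<close> \<open>0 < T\<close> by (intro stable_running_sup_tail)
    then show ?thesis by (simp add: q_def k)
  qed
  \<comment> \<open>\<open>Suc n\<close> makes already J 0 nonempty, as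
    \<open>iid_stable_prob_Inter\<close> demands.\<close>
  define J where "J n = {k::int. k \<noteq> 0 \<and> \<bar>k\<bar> \<le> int (Suc n)}" for n
  have J: "finite (J n)" "J n \<noteq> {}" "J n \<subseteq> nz" for n
  proof -
    show "finite (J n)" by (rule finite_subset[of _ "{- int (Suc n)..int (Suc n)}"]) (auto simp: J_def)
    have "1 \<in> J n" by (simp add: J_def)
    then show "J n \<noteq> {}" by blast
    show "J n \<subseteq> nz" by (auto simp: J_def)
  qed
  define p where "p = (\<Prod>k\<in>F. prob (A k))"
  have p: "0 < p" unfolding p_def by (intro prod_pos AF)
  \<comment> \<open>Factors from F that are missing in J n are at most 1, so those present have
    product at least p; the factors outside F have product at least 1/2.\<close>
  have partial: "p / 2 \<le> prob (\<Inter>k\<in>J n. A k)" for n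
  proof -
    have "p \<le> (\<Prod>k\<in>J n \<inter> F. prob (A k))"
    proof -
      have "p = (\<Prod>k\<in>J n \<inter> F. prob (A k)) * (\<Prod>k\<in>F - J n. prob (A k))"
        unfolding p_def using F(1) by (subst prod.Int_Diff[of F _ "J n"]) (simp_all add: Int_commute)
      also have "\<dots> \<le> (\<Prod>k\<in>J n \<inter> F. prob (A k)) * 1"
        by (intro mult_left_mono prod_le_1 prod_nonneg) auto
      finally show ?thesis by simp
    qed
    moreover have "1 / 2 \<le> (\<Prod>k\<in>J n - F. prob (A k))"
    proof -
      have "(\<Sum>k\<in>J n - F. 1 - prob (A k)) \<le> (\<Sum>k\<in>J n - F. q k)"
        using J(3) by (intro sum_mono Aq) auto
      also have "\<dots> \<le> infsum q (nz - F)"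
        using J q q0 by (intro finite_sum_le_infsum) (auto intro: summable_on_subset)
      finally have "1 / 2 \<le> 1 - (\<Sum>k\<in>J n - F. 1 - prob (A k))"
        using F(3) e(2) by linarith
      also have "\<dots> \<le> (\<Prod>k\<in>J n - F. prob (A k))"
        using J by (intro prod_ge_one_minus_sum) auto
      finally show ?thesis .
    qed
    ultimately have "p * (1 / 2) \<le> (\<Prod>k\<in>J n \<inter> F. prob (A k)) * (\<Prod>k\<in>J n - F. prob (A k))"
      using p by (intro mult_mono) (auto intro: prod_nonneg)
    also have "\<dots> = (\<Prod>k\<in>J n. prob (A k))"
      using J by (subst prod.Int_Diff[of "J n" _ F]) simp_all
    also have "\<dots> = prob (\<Inter>k\<in>J n. A k)"
      unfolding A_def by (rule iid_stable_prob_Inter[OF l J, symmetric])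
    finally show ?thesis by simp
  qed
  define E where "E = (\<Inter>n. \<Inter>k\<in>J n. A k)"
  have EJ: "(\<Inter>k\<in>J n. A k) \<in> events" for n
    by (intro sets.finite_INT J A) (rule subsetD[OF J(3)])
  have "(\<lambda>n. prob (\<Inter>k\<in>J n. A k)) \<longlonglongrightarrow> prob E"
    unfolding E_def
  proof (rule finite_Lim_measure_decseq)
    show "decseq (\<lambda>n. \<Inter>k\<in>J n. A k)"
      by (intro decseq_SucI INF_superset_mono) (auto simp: J_def)
  qed (use EJ in auto)
  then have "p / 2 \<le> prob E"
    by (rule LIMSEQ_le_const) (use partial in auto)
  show ?thesis
  proof (intro exI[of _ \<eta>] exI[of _ E] conjI ballI allI impI)
    show "E \<in> events" unfolding E_def using EJ by auto
    show "0 < prob E" using p \<open>p / 2 \<le> prob E\<close> by linarith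
    have split: "nz = F \<union> (nz - F)" using F(2) by blast
    have 1: "(\<lambda>k. \<bar>b k\<bar> * \<eta> k) summable_on (nz - F)" and 2: "(\<Sum>\<^sub>\<infinity>k\<in>nz - F. \<bar>b k\<bar> * \<eta> k) < e"
    proof -
      have eq: "\<bar>b k\<bar> * \<eta> k = c k" if "k \<in> nz - F" for k using that by (simp add: c_def \<eta>_def)
      have "c summable_on (nz - F)" using c by (rule summable_on_subset) auto
      then show "(\<lambda>k. \<bar>b k\<bar> * \<eta> k) summable_on (nz - F)"
        by (rule summable_on_cong[THEN iffD2, rotated]) (rule eq)
      show "(\<Sum>\<^sub>\<infinity>k\<in>nz - F. \<bar>b k\<bar> * \<eta> k) < e"
        using F(4) by (subst infsum_cong[OF eq]) auto
    qed
    show "(\<lambda>k. \<bar>b k\<bar> * \<eta> k) summable_on nz"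
      by (subst split) (intro summable_on_union summable_on_finite F(1) 1)
    have "(\<Sum>\<^sub>\<infinity>k\<in>nz. \<bar>b k\<bar> * \<eta> k) = (\<Sum>\<^sub>\<infinity>k\<in>F. \<bar>b k\<bar> * \<eta> k) + (\<Sum>\<^sub>\<infinity>k\<in>nz - F. \<bar>b k\<bar> * \<eta> k)"
      by (subst split) (intro infsum_Un_disjoint summable_on_finite F(1) 1, auto)
    also have "(\<Sum>\<^sub>\<infinity>k\<in>F. \<bar>b k\<bar> * \<eta> k) = s * \<rho>"
      using F(1) by (simp add: s_def \<eta>_def sum_distrib_right)
    finally show "(\<Sum>\<^sub>\<infinity>k\<in>nz. \<bar>b k\<bar> * \<eta> k) \<le> \<delta>"
      using 2 \<rho>(2) e(3) by linarith
    fix \<omega> k t assume \<omega>: "\<omega> \<in> E" and k: "(k::int) \<noteq> 0" and t: "t \<in> \<rat> \<inter> {0..<T}"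
    have "k \<in> J (nat \<bar>k\<bar>)" using k by (simp add: J_def)
    then have "\<omega> \<in> A k" using \<omega> unfolding E_def by blast
    then show "\<bar>l k t \<omega>\<bar> \<le> \<eta> k" using t by (simp add: A_def)
  qed
qed

end

section \<open>Measurability of the transition probabilities in time\<close>

lemma (in prob_space) expectation_rcll_measurable:
  fixes X :: "real \<Rightarrow> 'a \<Rightarrow> 'b::metric_space" and \<phi> :: "'b \<Rightarrow> real"
  assumes X: "\<And>t. 0 \<le> t \<Longrightarrow> X t \<in> borel_measurable M" and rcll: "AE \<omega> in M. rcll (\<lambda>t. X t \<omega>)"
    and \<phi>: "continuous_on UNIV \<phi>" and bound: "\<And>y. \<bar>\<phi> y\<bar> \<le> B"
  shows "(\<lambda>t. indicator {0..} t * expectation (\<lambda>\<omega>. \<phi> (X t \<omega>))) \<in> borel_measurable borel"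
proof (rule borel_measurable_LIMSEQ_real)
  \<comment> \<open>\<open>s n t\<close> tends to \<open>t\<close> strictly from the right and takes countably many values.\<close>
  define s where "s n t = (of_int \<lfloor>real (Suc n) * t\<rfloor> + 1) / real (Suc n)" for n :: nat and t :: real
  show "(\<lambda>t. indicator {0..} t * expectation (\<lambda>\<omega>. \<phi> (X (s n t) \<omega>))) \<in> borel_measurable borel" for n
  proof -
    have "(\<lambda>t. \<lfloor>real (Suc n) * t\<rfloor>) \<in> measurable borel (count_space UNIV)"
      by measurable
    then have "(\<lambda>t. (\<lambda>i. expectation (\<lambda>\<omega>. \<phi> (X ((of_int i + 1) / real (Suc n)) \<omega>))) \<lfloor>real (Suc n) * t\<rfloor>) \<in> borel_measurable borel"
      by (rule measurable_compose) simp
    then show ?thesis unfolding s_def by (intro borel_measurable_times) auto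
  qed
  fix t :: real
  have \<phi>m: "\<phi> \<in> borel_measurable borel" by (rule borel_measurable_continuous_onI[OF \<phi>])
  show "(\<lambda>n. indicator {0..} t * expectation (\<lambda>\<omega>. \<phi> (X (s n t) \<omega>))) \<longlonglongrightarrow> indicator {0..} t * expectation (\<lambda>\<omega>. \<phi> (X t \<omega>))"
  proof (cases "0 \<le> t")
    case True
    have s: "t < s n t" "s n t \<le> t + 1 / real (Suc n)" for n
    proof -
      have "real (Suc n) * t < of_int \<lfloor>real (Suc n) * t\<rfloor> + 1" by linarith
      then show "t < s n t" unfolding s_def by (simp add: pos_less_divide_eq mult.commute)
      have "s n t \<le> (real (Suc n) * t + 1) / real (Suc n)"
        unfolding s_def by (intro divide_right_mono) auto
      also have "\<dots> = t + 1 / real (Suc n)" by (simp add: add_divide_distrib)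
      finally show "s n t \<le> t + 1 / real (Suc n)" .
    qed
    have "(\<lambda>n. s n t) \<longlonglongrightarrow> t"
    proof (rule tendsto_sandwich[where f = "\<lambda>_. t"])
      show "(\<lambda>n. t + 1 / real (Suc n)) \<longlonglongrightarrow> t"
        using tendsto_add[OF tendsto_const[of t] LIMSEQ_inverse_real_of_nat] by (simp add: inverse_eq_divide)
    qed (use s in \<open>auto intro!: always_eventually intro: less_imp_le\<close>)
    then have lim: "filterlim (\<lambda>n. s n t) (at_right t) sequentially"
      unfolding filterlim_at using s(1) by (auto intro!: always_eventually simp: less_imp_neq[symmetric])
    have "(\<lambda>n. expectation (\<lambda>\<omega>. \<phi> (X (s n t) \<omega>))) \<longlonglongrightarrow> expectation (\<lambda>\<omega>. \<phi> (X t \<omega>))"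
    proof (rule integral_dominated_convergence[where w = "\<lambda>_. B"])
      show "(\<lambda>\<omega>. \<phi> (X t \<omega>)) \<in> borel_measurable M" "\<And>n. (\<lambda>\<omega>. \<phi> (X (s n t) \<omega>)) \<in> borel_measurable M"
        using True s(1) by (auto intro!: measurable_compose[OF X \<phi>m] intro: less_imp_le order_trans)
      show "AE \<omega> in M. (\<lambda>n. \<phi> (X (s n t) \<omega>)) \<longlonglongrightarrow> \<phi> (X t \<omega>)"
        using rcll
      proof eventually_elim
        case (elim \<omega>)
        then have "((\<lambda>t. X t \<omega>) \<longlongrightarrow> X t \<omega>) (at_right t)"
          using True by (simp add: rcll_def)
        from filterlim_compose[OF this lim] have "(\<lambda>n. X (s n t) \<omega>) \<longlonglongrightarrow> X t \<omega>" .
        then show ?case by (rule continuous_on_tendsto_compose[OF \<phi>]) auto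
      qed
    qed (use bound in auto)
    then show ?thesis by (intro tendsto_intros)
  qed simp
qed

text \<open>Needed because a Bochner integral takes the default value 0 on a non-integrable
  integrand. Indicators of open sets are limits of continuous functions; Dynkin induction gives the
  other Borel sets. The factor \<open>indicator {0..}\<close> removes negative times, where nothing
  is assumed on X.\<close>

lemma (in prob_space) prob_rcll_measurable:
  fixes X :: "real \<Rightarrow> 'a \<Rightarrow> 'b::metric_space"
  assumes X: "\<And>t. 0 \<le> t \<Longrightarrow> X t \<in> borel_measurable M" and rcll: "AE \<omega> in M. rcll (\<lambda>t. X t \<omega>)"
    and U: "U \<in> sets borel"
  shows "(\<lambda>t. indicator {0..} t * measure (distr M borel (X t)) U) \<in> borel_measurable borel"
proof -
  let ?f = "\<lambda>U t. indicator {0..} t * measure (distr M borel (X t)) U"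
  have distr: "measure (distr M borel (X t)) U = prob {\<omega>\<in>space M. X t \<omega> \<in> U}"
    if "0 \<le> t" "U \<in> sets borel" for t U
    using X[OF that(1)] that(2) by (simp add: measure_distr vimage_def Int_def conj_commute)
  have "Int_stable {S :: 'b set. open S}" by (auto simp: Int_stable_def)
  moreover have "{S :: 'b set. open S} \<subseteq> Pow UNIV" by simp
  moreover have "U \<in> sigma_sets UNIV {S. open S}" using U by (simp add: borel_def)
  ultimately show ?thesis
  proof (induction rule: sigma_sets_induct_disjoint)
    case (basic U)
    then have U: "open U" by simp
    show ?case
    proof (cases "U = UNIV")
      case True
      have "?f UNIV = (indicator {0..} :: real \<Rightarrow> real)"
        by (auto simp: fun_eq_iff indicator_def distr prob_space)
      then show ?thesis unfolding True by simp
    next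
      case False
      \<comment> \<open>For U = UNIV the distance to the empty complement would be 0 by default and
        these functions would vanish.\<close>
      define \<phi> where "\<phi> n y = min 1 (real n * infdist y (- U))" for n :: nat and y
      show ?thesis
      proof (rule borel_measurable_LIMSEQ_real)
        show "(\<lambda>t. indicator {0..} t * expectation (\<lambda>\<omega>. \<phi> n (X t \<omega>))) \<in> borel_measurable borel" for n
        proof (rule expectation_rcll_measurable[OF X rcll])
          show "continuous_on UNIV (\<phi> n)" unfolding \<phi>_def by (intro continuous_intros)
          show "\<bar>\<phi> n y\<bar> \<le> 1" for y by (simp add: \<phi>_def infdist_nonneg)
        qed
        fix t :: real
        show "(\<lambda>n. indicator {0..} t * expectation (\<lambda>\<omega>. \<phi> n (X t \<omega>))) \<longlonglongrightarrow> ?f U t"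
        proof (cases "0 \<le> t")
          case True
          have \<phi>lim: "(\<lambda>n. \<phi> n y) \<longlonglongrightarrow> indicator U y" for y
          proof (cases "y \<in> U")
            case True
            then have pos: "0 < infdist y (- U)"
              using U \<open>U \<noteq> UNIV\<close> by (intro infdist_pos_not_in_closed) auto
            have "filterlim (\<lambda>n. real n * infdist y (- U)) at_top sequentially"
              by (intro filterlim_at_top_mult_tendsto_pos[OF tendsto_const pos] filterlim_real_sequentially)
            then have "eventually (\<lambda>n. 1 \<le> real n * infdist y (- U)) sequentially"
              by (simp add: filterlim_at_top)
            then have "eventually (\<lambda>n. \<phi> n y = 1) sequentially"
              by eventually_elim (simp add: \<phi>_def)
            then show ?thesis using True by (simp add: tendsto_eventually)
          qed (simp add: \<phi>_def)
          have \<phi>m: "\<phi> n \<in> borel_measurable borel" for n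
            unfolding \<phi>_def by (intro borel_measurable_continuous_onI continuous_intros)
          have "(\<lambda>n. expectation (\<lambda>\<omega>. \<phi> n (X t \<omega>))) \<longlonglongrightarrow> expectation (\<lambda>\<omega>. indicator U (X t \<omega>))"
          proof (rule integral_dominated_convergence[where w = "\<lambda>_. 1"])
            show "(\<lambda>\<omega>. indicator U (X t \<omega>) :: real) \<in> borel_measurable M"
              using U by (intro measurable_compose[OF X[OF True]]) simp
            show "(\<lambda>\<omega>. \<phi> n (X t \<omega>)) \<in> borel_measurable M" for n
              by (rule measurable_compose[OF X[OF True] \<phi>m])
          qed (auto simp: \<phi>lim, simp add: \<phi>_def infdist_nonneg)
          also have "expectation (\<lambda>\<omega>. indicator U (X t \<omega>)) = measure (distr M borel (X t)) U"
          proof -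
            have "expectation (\<lambda>\<omega>. indicator U (X t \<omega>)) = expectation (\<lambda>\<omega>. indicator {\<omega>\<in>space M. X t \<omega> \<in> U} \<omega>)"
              by (intro Bochner_Integration.integral_cong) (auto simp: indicator_def)
            also have "\<dots> = prob {\<omega>\<in>space M. X t \<omega> \<in> U}"
              by (simp add: Int_absorb2 subset_eq)
            finally show ?thesis using distr[OF True] U by simp
          qed
          finally show ?thesis by (intro tendsto_intros)
        qed simp
      qed
    qed
  next
    case empty
    then show ?case by simp
  next
    case (compl A)
    then have A: "A \<in> sets borel" by (simp add: borel_def)
    have "?f (UNIV - A) = (\<lambda>t. indicator {0..} t - ?f A t)"
    proof
      fix t
      show "?f (UNIV - A) t = indicator {0..} t - ?f A t"
      proof (cases "0 \<le> t")
        case True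
        interpret D: prob_space "distr M borel (X t)" by (rule prob_space_distr[OF X[OF True]])
        show ?thesis using D.prob_compl[of A] A True by simp
      qed simp
    qed
    then show ?case using compl by simp
  next
    case (union A)
    then have A: "A i \<in> sets borel" for i by (auto simp: borel_def)
    have "?f (\<Union>i. A i) = (\<lambda>t. \<Sum>i. ?f (A i) t)"
    proof
      fix t
      show "?f (\<Union>i. A i) t = (\<Sum>i. ?f (A i) t)"
      proof (cases "0 \<le> t")
        case True
        interpret D: prob_space "distr M borel (X t)" by (rule prob_space_distr[OF X[OF True]])
        have "(\<lambda>i. D.prob (A i)) sums D.prob (\<Union>i. A i)"
          using A union(1) by (intro D.finite_measure_UNION) auto
        then show ?thesis using True by (simp add: sums_iff)
      qed simp
    qed
    then show ?case using union by simp
  qed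
qed


section \<open>Accessibility\<close>

text \<open>The interval [T, T + 1] alone contributes at least exp (- r (T + 1)) p. The comparison
  requires the whole integrand to be integrable, which domination by exp (- r t) provides.\<close>

lemma resolvent_pos:
  assumes meas: "(\<lambda>t. indicator {0..} t * measure (P t x) U) \<in> borel_measurable borel"
    and le_1: "\<And>t. 0 \<le> t \<Longrightarrow> measure (P t x) U \<le> 1"
    and "0 < r" "0 < p" "0 \<le> T" and ge: "\<And>t. T \<le> t \<Longrightarrow> t \<le> T + 1 \<Longrightarrow> p \<le> measure (P t x) U"
  shows "0 < resolvent P r x U"
proof -
  have exp_int: "integrable lborel (\<lambda>t. indicator {0..} t * exp (- r * t))"
  proof (rule integrableI_bounded)
    have "((\<lambda>t. - exp (- r * t) / r) \<longlongrightarrow> 0) at_top"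
    proof -
      have "filterlim (\<lambda>t. - r * t) at_bot at_top"
        using \<open>0 < r\<close> by (intro filterlim_tendsto_neg_mult_at_bot[OF tendsto_const _ filterlim_ident]) simp
      from filterlim_compose[OF exp_at_bot this]
      have "((\<lambda>t. - exp (- r * t) / r) \<longlongrightarrow> - 0 / r) at_top"
        using \<open>0 < r\<close> by (intro tendsto_intros) auto
      then show ?thesis by simp
    qed
    then have "(\<integral>\<^sup>+t. ennreal (exp (- r * t)) * indicator {0..} t \<partial>lborel) = 0 - (- exp (- r * 0) / r)"
      using \<open>0 < r\<close> by (intro nn_integral_FTC_atLeast) (auto intro!: derivative_eq_intros)
    moreover have "(\<integral>\<^sup>+t. ennreal (norm (indicator {0..} t * exp (- r * t))) \<partial>lborel) =
        (\<integral>\<^sup>+t. ennreal (exp (- r * t)) * indicator {0..} t \<partial>lborel)"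
      by (intro nn_integral_cong) (auto simp: indicator_def)
    ultimately show "(\<integral>\<^sup>+t. ennreal (norm (indicator {0..} t * exp (- r * t))) \<partial>lborel) < \<infinity>"
      by simp
  qed simp
  let ?g = "\<lambda>t. indicator {0..} t *\<^sub>R (exp (- r * t) * measure (P t x) U)"
  have g_int: "integrable lborel ?g"
  proof (rule Bochner_Integration.integrable_bound[OF exp_int])
    have "(\<lambda>t. exp (- r * t) * (indicator {0..} t * measure (P t x) U)) \<in> borel_measurable borel"
      using meas by measurable
    then show "?g \<in> borel_measurable lborel" by (simp add: mult.left_commute)
    show "AE t in lborel. norm (?g t) \<le> norm (indicator {0..} t * exp (- r * t))"
      using le_1 by (intro AE_I2) (auto simp: indicator_def mult_left_le)
  qed
  define c where "c = exp (- r * (T + 1)) * p"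
  have c: "0 < c" using \<open>0 < p\<close> by (simp add: c_def)
  have "c = (LINT t|lborel. indicator {T..T + 1} t * c)"
    by simp
  also have "\<dots> \<le> (LINT t|lborel. ?g t)"
  proof (rule integral_mono[OF _ g_int])
    show "integrable lborel (\<lambda>t. indicator {T..T + 1} t * c)"
      by (intro integrable_mult_left integrable_real_indicator) auto
    fix t
    show "indicator {T..T + 1} t * c \<le> ?g t"
    proof (cases "t \<in> {T..T + 1}")
      case True
      then have "exp (- r * (T + 1)) * p \<le> exp (- r * t) * measure (P t x) U"
        using \<open>0 < r\<close> \<open>0 < p\<close> ge[of t] by (intro mult_mono) auto
      then show ?thesis using True \<open>0 \<le> T\<close> by (simp add: c_def)
    qed simp
  qed
  finally show ?thesis
    using c unfolding resolvent_def set_lebesgue_integral_def by linarith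
qed

text \<open>Turns level bounds on the l k into the hypothesis on Z of
  \<open>small_noise_path\<close>. In \<delta> / 4 one factor 2 pays for the integration by parts,
  the other for the amplitude sqrt 2 <= 2 of the basis functions.\<close>

lemma mild_solution_near_0:
  assumes l: "\<And>k. k \<noteq> 0 \<Longrightarrow> rcll (\<lambda>t. l k t \<omega>)"
    and L: "\<And>t. 0 \<le> t \<Longrightarrow> ((\<lambda>k. (b k * l k t \<omega>) *\<^sub>R real_basis k) has_sum L t \<omega>) nz"
    and X0: "X 0 \<omega> = x" and X: "rcll (\<lambda>t. X t \<omega>)" "rcll_V (\<lambda>t. X t \<omega>)"
    and mild: "\<And>t. 0 \<le> t \<Longrightarrow> \<exists>D Z.
          ((\<lambda>s. semigroup_A (t - s) (nonlin (X s \<omega>))) has_integral D) {0..t} \<and>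
          has_stieltjes_integral (\<lambda>s. semigroup_A (t - s)) (\<lambda>s. L s \<omega>) Z 0 t \<and>
          X t \<omega> = semigroup_A t x - D + Z"
    and small: "\<And>k t. k \<noteq> 0 \<Longrightarrow> t \<in> \<rat> \<inter> {0..<T} \<Longrightarrow> \<bar>l k t \<omega>\<bar> \<le> \<eta> k"
    and \<eta>: "(\<lambda>k. \<bar>b k\<bar> * \<eta> k) summable_on nz" "(\<Sum>\<^sub>\<infinity>k\<in>nz. \<bar>b k\<bar> * \<eta> k) \<le> \<delta> / 4"
    and \<delta>: "0 \<le> \<delta>" "\<delta> \<le> 1" and t: "1 \<le> t" "t < T"
  shows "norm (X t \<omega>) \<le> sqrt (3 * \<delta>\<^sup>2 + (norm x + 2)\<^sup>2 * exp (1 - t)) + \<delta>"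
proof -
  have "\<forall>t. \<exists>D Z. 0 \<le> t \<longrightarrow>
          ((\<lambda>s. semigroup_A (t - s) (nonlin (X s \<omega>))) has_integral D) {0..t} \<and>
          has_stieltjes_integral (\<lambda>s. semigroup_A (t - s)) (\<lambda>s. L s \<omega>) Z 0 t \<and>
          X t \<omega> = semigroup_A t x - D + Z"
    using mild by blast
  then obtain D Z where *: "\<And>t. 0 \<le> t \<longrightarrow>
          ((\<lambda>s. semigroup_A (t - s) (nonlin (X s \<omega>))) has_integral D t) {0..t} \<and>
          has_stieltjes_integral (\<lambda>s. semigroup_A (t - s)) (\<lambda>s. L s \<omega>) (Z t) 0 t \<and>
          X t \<omega> = semigroup_A t x - D t + Z t"
    unfolding choice_iff by auto
  then have DZ: "\<And>t. 0 \<le> t \<Longrightarrow> ((\<lambda>s. semigroup_A (t - s) (nonlin (X s \<omega>))) has_integral D t) {0..t}"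
    "\<And>t. 0 \<le> t \<Longrightarrow> has_stieltjes_integral (\<lambda>s. semigroup_A (t - s)) (\<lambda>s. L s \<omega>) (Z t) 0 t"
    "\<And>t. 0 \<le> t \<Longrightarrow> X t \<omega> = semigroup_A t x - D t + Z t"
    by simp_all
  have lk: "\<bar>l k s \<omega>\<bar> \<le> \<eta> k" if "k \<noteq> 0" "0 \<le> s" "s < T" for k s
  proof (rule abs_le_of_dense[OF l[OF that(1)] _ small[OF that(1)] that(2,3)])
    fix s s' :: real assume "0 \<le> s" "s < s'" "s' \<le> T"
    then show "\<exists>u\<in>\<rat> \<inter> {0..<T}. s < u \<and> u < s'"
      using Rats_dense_in_real[OF \<open>s < s'\<close>] by force
  qed
  have Zk: "\<bar>rcoeff k (Z s)\<bar> \<le> 2 * (\<bar>b k\<bar> * \<eta> k)" if "k \<noteq> 0" "0 \<le> s" "s < T" for k s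
  proof (rule abs_rcoeff_stochastic_convolution_le[OF DZ(2)[OF that(2)] that(2,1)])
    fix u assume "0 \<le> u" "u \<le> s"
    then show "\<bar>rcoeff k (L u \<omega>)\<bar> \<le> \<bar>b k\<bar> * \<eta> k"
      using rcoeff_expansion[OF L[OF \<open>0 \<le> u\<close>] that(1)] lk[OF that(1), of u] that
      by (simp add: abs_mult mult_left_mono)
  qed
  have Z: "abs_conv (Z s) \<and> sup_bound (Z s) \<delta>" if s: "0 \<le> s" "s < T" for s
  proof -
    have sum2: "(\<lambda>k. 2 * (\<bar>b k\<bar> * \<eta> k)) summable_on nz"
      by (intro summable_on_cmult_right \<eta>)
    have conv: "abs_conv (Z s)"
      unfolding abs_conv_def by (rule summable_on_comparison_test[OF sum2]) (use Zk s in auto)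
    have "wiener_norm (Z s) \<le> (\<Sum>\<^sub>\<infinity>k\<in>nz. 2 * (\<bar>b k\<bar> * \<eta> k))"
      unfolding wiener_norm_def using conv[unfolded abs_conv_def] sum2 by (rule infsum_mono) (use Zk s in auto)
    also have "\<dots> = 2 * (\<Sum>\<^sub>\<infinity>k\<in>nz. \<bar>b k\<bar> * \<eta> k)"
      by (rule infsum_cmult_right) (rule \<eta>)
    finally have "wiener_norm (Z s) \<le> \<delta> / 2" using \<eta>(2) by simp
    then have "sqrt 2 * wiener_norm (Z s) \<le> 2 * (\<delta> / 2)"
      using wiener_norm_nonneg[of "Z s"] real_sqrt_le_iff[of 2 4] by (intro mult_mono) auto
    then have "sup_bound (Z s) \<delta>"
      using abs_conv_has_sum(2)[OF conv] sup_bound_mono unfolding sup_bound_def[symmetric] by force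
    with conv show ?thesis by blast
  qed
  interpret small_noise_path x "\<lambda>t. X t \<omega>" D Z \<delta> T
  proof
    have "((\<lambda>t. X t \<omega>) \<longlongrightarrow> X 0 \<omega>) (at_right 0)"
      using X(1) by (simp add: rcll_def)
    then show "((\<lambda>t. X t \<omega>) \<longlongrightarrow> x) (at_right 0)" by (simp add: X0)
  qed (use DZ X(2) Z \<delta> in auto)
  show ?thesis by (rule norm_X_le[OF t])
qed

theorem mainTheorem6:
  fixes M :: "'w measure" and \<alpha> \<beta> C1 C2 :: real and b :: "int \<Rightarrow> real"
    and l :: "int \<Rightarrow> real \<Rightarrow> 'w \<Rightarrow> real" and L :: "real \<Rightarrow> 'w \<Rightarrow> H"
    and X :: "H \<Rightarrow> real \<Rightarrow> 'w \<Rightarrow> H"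
  assumes "prob_space M"
    and "3 / 2 < \<alpha>" "\<alpha> < 2"
    and "1 / 2 + 1 / (2 * \<alpha>) < \<beta>" "\<beta> < 3 / 2 - 1 / \<alpha>"
    and "C1 > 0" "C2 > 0"
    and "\<And>k. k \<noteq> 0 \<Longrightarrow> C1 * eigenval k powr (- \<beta>) \<le> \<bar>b k\<bar> \<and> \<bar>b k\<bar> \<le> C2 * eigenval k powr (- \<beta>)"
    and "iid_stable_processes M \<alpha> l"
    and "noise M b l L"
    and "\<And>x. mild_solution M L x (X x)"
  shows "accessible_to (transition M X) 0"
  unfolding accessible_to_def
proof (intro allI ballI impI)
  fix r :: real and x :: H and U :: "H set"
  assume "0 < r" and U: "U \<in> sets borel" "0 \<in> interior U"
  interpret prob_space M by fact
  note X = assms(11)[of x, unfolded mild_solution_def]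
  obtain \<epsilon> where \<epsilon>: "0 < \<epsilon>" "ball 0 \<epsilon> \<subseteq> U"
    using U(2) by (auto simp: mem_interior)
  \<comment> \<open>With \<delta> <= \<epsilon> / 8 the square root is at most \<epsilon> / 2, as
    3/64 + 1/16 <= 1/4, and the last \<delta> adds at most \<epsilon> / 8.\<close>
  define \<delta> where "\<delta> = min 1 (\<epsilon> / 8)"
  have \<delta>: "0 < \<delta>" "\<delta> \<le> 1" "\<delta> \<le> \<epsilon> / 8" using \<epsilon>(1) by (auto simp: \<delta>_def)
  \<comment> \<open>From exp (t - 1) >= t >= T the initial energy has decayed to at most
    \<epsilon>^2 / 16.\<close>
  define T where "T = 1 + 16 * (norm x + 2)\<^sup>2 / \<epsilon>\<^sup>2"
  have T: "1 \<le> T" by (simp add: T_def)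
  have decay: "(norm x + 2)\<^sup>2 * exp (1 - t) \<le> \<epsilon>\<^sup>2 / 16" if "T \<le> t" for t
  proof -
    have "16 * (norm x + 2)\<^sup>2 / \<epsilon>\<^sup>2 \<le> exp (t - 1)"
      using exp_ge_add_one_self[of "t - 1"] that by (simp add: T_def)
    then have "16 * (norm x + 2)\<^sup>2 \<le> exp (t - 1) * \<epsilon>\<^sup>2"
      using \<epsilon>(1) by (simp add: pos_divide_le_eq)
    then have "(norm x + 2)\<^sup>2 / exp (t - 1) \<le> \<epsilon>\<^sup>2 / 16"
      by (simp add: pos_divide_le_eq mult.commute)
    moreover have "(norm x + 2)\<^sup>2 * exp (1 - t) = (norm x + 2)\<^sup>2 / exp (t - 1)"
      using exp_minus[of "t - 1"] by (simp only: divide_inverse minus_diff_eq)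
    ultimately show ?thesis by (simp only:)
  qed
  have pos: "0 < \<alpha>" "0 \<le> C2" "0 < T + 2" "0 < \<delta> / 4"
    using assms(2,7) T \<delta> by simp_all
  have b_le: "\<forall>k. k \<noteq> 0 \<longrightarrow> \<bar>b k\<bar> \<le> C2 * eigenval k powr (- \<beta>)"
    using assms(8) by simp
  \<comment> \<open>Horizon T + 2, because the path estimate holds strictly before the horizon and
    is used up to T + 1.\<close>
  obtain \<eta> E where E: "E \<in> events" "0 < prob E" and \<eta>: "(\<lambda>k. \<bar>b k\<bar> * \<eta> k) summable_on nz" "(\<Sum>\<^sub>\<infinity>k\<in>nz. \<bar>b k\<bar> * \<eta> k) \<le> \<delta> / 4"
    and small: "\<forall>\<omega>\<in>E. \<forall>k. k \<noteq> 0 \<longrightarrow> (\<forall>t\<in>\<rat> \<inter> {0..<T + 2}. \<bar>l k t \<omega>\<bar> \<le> \<eta> k)"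
    using small_noise_event[OF assms(9) pos(1) assms(4) pos(2-4) b_le]
    by (elim exE conjE) (rule that)
  have rcll_l: "AE \<omega> in M. \<forall>k. k \<noteq> 0 \<longrightarrow> rcll (\<lambda>t. l k t \<omega>)"
    unfolding AE_all_countable
    using assms(9) by (auto simp: iid_stable_processes_def symmetric_stable_process_def)
  \<comment> \<open>One null set serves all times of the interval, since it is a property of whole
    paths; prob E is thus a lower bound uniform in t.\<close>
  have near: "AE \<omega> in M. \<omega> \<in> E \<longrightarrow> (\<forall>t\<in>{T..T + 1}. X x t \<omega> \<in> U)"
    using rcll_l assms(10)[unfolded noise_def] X[THEN conjunct2]
  proof eventually_elim
    case (elim \<omega>)
    show ?case
    proof (intro impI ballI)
      fix t assume "\<omega> \<in> E" and t: "t \<in> {T..T + 1}"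
      have "norm (X x t \<omega>) \<le> sqrt (3 * \<delta>\<^sup>2 + (norm x + 2)\<^sup>2 * exp (1 - t)) + \<delta>"
        by (rule mild_solution_near_0[where l = l and b = b and L = L and \<eta> = \<eta> and T = "T + 2"])
           (use elim small[THEN bspec, OF \<open>\<omega> \<in> E\<close>] \<eta> \<delta> T t in auto)
      also have "sqrt (3 * \<delta>\<^sup>2 + (norm x + 2)\<^sup>2 * exp (1 - t)) \<le> sqrt ((\<epsilon> / 2)\<^sup>2)"
      proof (rule real_sqrt_le_mono)
        have "\<delta>\<^sup>2 \<le> (\<epsilon> / 8)\<^sup>2" using \<delta> by (intro power_mono) auto
        then show "3 * \<delta>\<^sup>2 + (norm x + 2)\<^sup>2 * exp (1 - t) \<le> (\<epsilon> / 2)\<^sup>2"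
        proof -
          have "(\<epsilon> / 2)\<^sup>2 = \<epsilon>\<^sup>2 / 4" "(\<epsilon> / 8)\<^sup>2 = \<epsilon>\<^sup>2 / 64"
            by (simp_all add: power_divide)
          moreover have "(norm x + 2)\<^sup>2 * exp (1 - t) \<le> \<epsilon>\<^sup>2 / 16"
            using decay t by simp
          ultimately show ?thesis
            using \<open>\<delta>\<^sup>2 \<le> (\<epsilon> / 8)\<^sup>2\<close> zero_le_power2[of \<epsilon>] by linarith
        qed
      qed
      finally have "norm (X x t \<omega>) \<le> \<epsilon> / 2 + \<epsilon> / 8"
        using \<epsilon>(1) \<delta>(3) by simp
      then have "X x t \<omega> \<in> ball 0 \<epsilon>"
        using \<epsilon>(1) by (simp add: dist_norm)
      then show "X x t \<omega> \<in> U" using \<epsilon>(2) by blast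
    qed
  qed
  have X_meas: "X x t \<in> borel_measurable M" if "0 \<le> t" for t
    using X that by blast
  show "0 < resolvent (transition M X) r x U"
  proof (rule resolvent_pos[OF _ _ \<open>0 < r\<close> E(2)])
    show "(\<lambda>t. indicator {0..} t * measure (transition M X t x) U) \<in> borel_measurable borel"
      unfolding transition_def
    proof (rule prob_rcll_measurable[OF X_meas _ U(1)])
      show "AE \<omega> in M. rcll (\<lambda>t. X x t \<omega>)"
        using X[THEN conjunct2] by eventually_elim blast
    qed
    show "measure (transition M X t x) U \<le> 1" if "0 \<le> t" for t
    proof -
      interpret D: prob_space "distr M borel (X x t)" by (rule prob_space_distr[OF X_meas[OF that]])
      show ?thesis unfolding transition_def by (rule D.prob_le_1)
    qed
    show "0 \<le> T" using T by simp
    fix t assume t: "T \<le> t" "t \<le> T + 1"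
    then have "0 \<le> t" using T by simp
    have "prob E \<le> prob (X x t -` U \<inter> space M)"
    proof (rule finite_measure_mono_AE)
      show "X x t -` U \<inter> space M \<in> events"
        by (rule measurable_sets[OF X_meas[OF \<open>0 \<le> t\<close>] U(1)])
      show "AE \<omega> in M. \<omega> \<in> E \<longrightarrow> \<omega> \<in> X x t -` U \<inter> space M"
        using near AE_space by eventually_elim (use t in auto)
    qed
    then show "prob E \<le> measure (transition M X t x) U"
      unfolding transition_def using X_meas[OF \<open>0 \<le> t\<close>] U(1) by (simp add: measure_distr)
  qed
qed

end
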